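(* Let $m,n$ be positive integers, $u$ a multilinear commutator word, $v$ the product of $896$ $u$-words and $w=v^m$. Let $\mathcal U(m,n,u)$ be the class of all groups $G$ in which every $w$-value is $n$-Engel in $G$ and the verbal subgroup $u(G)$ has an ascending normal series each of whose quotients is either locally soluble or locally finite. Then $\mathcal U(m,n,u)$ is precisely the class of all groups $G$ in which every $w$-value is $n$-Engel in $G$ and the verbal subgroup $u(G)$ is (locally nilpotent)-by-(locally finite).
   Context: A multilinear commutator word of weight $s$ is a word having the form of a multilinear Lie monomial in exactly $s$ independent variables: a single variable is one of weight $1$, and for $s\ge 2$ it is $[\alpha,\beta]$ with $\alpha,\beta$ multilinear commutator words in disjoint sets of variables whose weights sum to $s$. Here $[x,y]=x^{-1}y^{-1}xy$. Given a positive integer $s$ and a word $u=u(x_1,\dots,x_k)$, the product of $s$ $u$-words is the word $u(x_{11},\dots,x_{1k})u(x_{21},\dots,x_{2k})\cdots u(x_{s1},\dots,x_{sk})$ in $ks$ independent variables. For a word $w$, a $w$-value in $G$ is an element obtained by substituting elements of $G$ for the variables of $w$, and $w(G)$ is the subgroup generated by all $w$-values in $G$. An element $x\in G$ is (left) $n$-Engel if $[g,_n x]=1$ for all $g\in G$, where $[g,_0x]=g$ and $[g,_ix]=[[g,_{i-1}x],x]$. A group locally has a property if all its finitely generated subgroups have it. A group is (locally nilpotent)-by-(locally finite) if it has a locally nilpotent normal subgroup with locally finite quotient. An ascending normal series of a group $K$ is a chain $(K_\alpha)_{\alpha\le\beta}$ of normal subgroups of $K$ indexed by ordinals, with $K_0=1$,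 $K_\beta=K$, $K_\alpha\le K_{\alpha+1}$, and $K_\lambda=\bigcup_{\alpha<\lambda}K_\alpha$ for limit ordinals $\lambda\le\beta$; its quotients are the groups $K_{\alpha+1}/K_\alpha$. *)

theory Defs
  imports "HOL-Algebra.Solvable_Groups"
begin

section \<open>Group words\<close>

text \<open>Words are represented by terms; they are only ever used through their values in groups,
  so no reduction to normal form in the free group is needed.\<close>

datatype 'x gword = Var 'x | One | Inv "'x gword" | Mul "'x gword" "'x gword"

primrec word_eval :: "('a, 'b) monoid_scheme \<Rightarrow> ('x \<Rightarrow> 'a) \<Rightarrow> 'x gword \<Rightarrow> 'a" where
  "word_eval G \<rho> (Var x) = \<rho> x"
| "word_eval G \<rho> One = \<one>\<^bsub>G\<^esub>"
| "word_eval G \<rho> (Inv a) = inv\<^bsub>G\<^esub> (word_eval G \<rho> a)"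
| "word_eval G \<rho> (Mul a b) = word_eval G \<rho> a \<otimes>\<^bsub>G\<^esub> word_eval G \<rho> b"

definition word_values :: "('a, 'b) monoid_scheme \<Rightarrow> 'x gword \<Rightarrow> 'a set" where
  "word_values G w = {word_eval G \<rho> w | \<rho>. range \<rho> \<subseteq> carrier G}"

definition verbal_subgroup :: "('a, 'b) monoid_scheme \<Rightarrow> 'x gword \<Rightarrow> 'a set" where
  "verbal_subgroup G w = generate G (word_values G w)"

definition word_commutator :: "'x gword \<Rightarrow> 'x gword \<Rightarrow> 'x gword" where
  "word_commutator a b = Mul (Mul (Mul (Inv a) (Inv b)) a) b"

inductive multilinear_commutator :: "nat \<Rightarrow> 'x gword \<Rightarrow> bool" where
  variable: "multilinear_commutator 1 (Var x)"
| commutator: "\<lbrakk>multilinear_commutator s a; multilinear_commutator t b;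
    set_gword a \<inter> set_gword b = {}\<rbrakk> \<Longrightarrow>
    multilinear_commutator (s + t) (word_commutator a b)"

text \<open>The variable \<open>x\<close> of the \<open>i\<close>-th factor becomes \<open>(i, x)\<close>, so that the factors have
  pairwise disjoint sets of variables.\<close>

primrec product_of_words :: "nat \<Rightarrow> 'x gword \<Rightarrow> (nat \<times> 'x) gword" where
  "product_of_words 0 u = One"
| "product_of_words (Suc s) u = Mul (product_of_words s u) (map_gword (Pair s) u)"

primrec word_pow :: "'x gword \<Rightarrow> nat \<Rightarrow> 'x gword" where
  "word_pow v 0 = One"
| "word_pow v (Suc m) = Mul (word_pow v m) v"


section \<open>Group-theoretic properties\<close>

definition group_commutator :: "('a, 'b) monoid_scheme \<Rightarrow> 'a \<Rightarrow> 'a \<Rightarrow> 'a" where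
  "group_commutator G x y = inv\<^bsub>G\<^esub> x \<otimes>\<^bsub>G\<^esub> inv\<^bsub>G\<^esub> y \<otimes>\<^bsub>G\<^esub> x \<otimes>\<^bsub>G\<^esub> y"

definition engel_element :: "('a, 'b) monoid_scheme \<Rightarrow> nat \<Rightarrow> 'a \<Rightarrow> bool" where
  "engel_element G n x \<longleftrightarrow>
    x \<in> carrier G \<and> (\<forall>g \<in> carrier G. ((\<lambda>h. group_commutator G h x) ^^ n) g = \<one>\<^bsub>G\<^esub>)"

primrec lower_central :: "('a, 'b) monoid_scheme \<Rightarrow> nat \<Rightarrow> 'a set" where
  "lower_central G 0 = carrier G"
| "lower_central G (Suc i) =
    generate G {group_commutator G x y | x y. x \<in> lower_central G i \<and> y \<in> carrier G}"

definition nilpotent_group :: "('a, 'b) monoid_scheme \<Rightarrow> bool" where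
  "nilpotent_group G \<longleftrightarrow> (\<exists>c. lower_central G c = {\<one>\<^bsub>G\<^esub>})"

definition has_locally ::
  "(('a, 'b) monoid_scheme \<Rightarrow> bool) \<Rightarrow> ('a, 'b) monoid_scheme \<Rightarrow> bool" where
  "has_locally P G \<longleftrightarrow>
    (\<forall>S. finite S \<and> S \<subseteq> carrier G \<longrightarrow> P (G\<lparr>carrier := generate G S\<rparr>))"

abbreviation locally_nilpotent :: "('a, 'b) monoid_scheme \<Rightarrow> bool" where
  "locally_nilpotent \<equiv> has_locally nilpotent_group"

abbreviation locally_soluble :: "('a, 'b) monoid_scheme \<Rightarrow> bool" where
  "locally_soluble \<equiv> has_locally solvable"

abbreviation locally_finite :: "('a, 'b) monoid_scheme \<Rightarrow> bool" where
  "locally_finite \<equiv> has_locally (\<lambda>H. finite (carrier H))"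

definition locally_nilpotent_by_locally_finite :: "('a, 'b) monoid_scheme \<Rightarrow> bool" where
  "locally_nilpotent_by_locally_finite G \<longleftrightarrow>
    (\<exists>N. N \<lhd> G \<and> locally_nilpotent (G\<lparr>carrier := N\<rparr>) \<and> locally_finite (G Mod N))"


section \<open>Ascending normal series\<close>

definition is_successor :: "'i rel \<Rightarrow> 'i \<Rightarrow> 'i \<Rightarrow> bool" where
  "is_successor r i j \<longleftrightarrow> i \<in> Field r \<and> j \<in> Field r \<and> underS r j = under r i"

text \<open>The ordinals \<open>\<alpha> \<le> \<beta>\<close> are represented by a well-order \<open>r\<close> with a greatest element \<open>t\<close>.
  A limit is an element which is neither least nor a successor.\<close>

definition ascending_normal_series ::
  "('a, 'b) monoid_scheme \<Rightarrow> 'i rel \<Rightarrow> ('i \<Rightarrow> 'a set) \<Rightarrow> bool" where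
  "ascending_normal_series G r K \<longleftrightarrow>
    Well_order r \<and>
    (\<forall>i \<in> Field r. K i \<lhd> G) \<and>
    (\<forall>i \<in> Field r. underS r i = {} \<longrightarrow> K i = {\<one>\<^bsub>G\<^esub>}) \<and>
    (\<exists>t \<in> Field r. under r t = Field r \<and> K t = carrier G) \<and>
    (\<forall>i j. is_successor r i j \<longrightarrow> K i \<subseteq> K j) \<and>
    (\<forall>l \<in> Field r. underS r l \<noteq> {} \<and> (\<nexists>i. is_successor r i l) \<longrightarrow> K l = (\<Union>i \<in> underS r l. K i))"

lemma ascending_normal_series_mono:
  assumes "ascending_normal_series G r K" "(i, j) \<in> r"
  shows "K i \<subseteq> K j"
proof -
  have W: "Well_order r" using assms by (simp add: ascending_normal_series_def)
  interpret wo_rel r using W by unfold_locales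
  have "\<forall>i. (i, j) \<in> r \<longrightarrow> K i \<subseteq> K j"
  proof (rule well_order_induct[of "\<lambda>j. \<forall>i. (i, j) \<in> r \<longrightarrow> K i \<subseteq> K j"])
    fix j assume IH: "\<forall>k. k \<noteq> j \<and> (k, j) \<in> r \<longrightarrow> (\<forall>i. (i, k) \<in> r \<longrightarrow> K i \<subseteq> K k)"
    show "\<forall>i. (i, j) \<in> r \<longrightarrow> K i \<subseteq> K j"
    proof (intro allI impI)
      fix i assume ij: "(i, j) \<in> r"
      show "K i \<subseteq> K j"
      proof (cases "i = j")
        case False
        then have iu: "i \<in> underS j" using ij by (simp add: underS_def)
        have jF: "j \<in> Field r" using ij by (auto simp: Field_def)
        show ?thesis
        proof (cases "\<exists>k. is_successor r k j")
          case True
          then obtain k where k: "is_successor r k j" by blast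
          then have u: "underS j = under k" and kF: "k \<in> Field r"
            by (auto simp: is_successor_def)
          have "k \<in> underS j" using u kF Refl_under_in[OF REFL kF] by simp
          moreover have "(i, k) \<in> r" using iu u by (simp add: under_def)
          ultimately have "K i \<subseteq> K k" using IH by (auto simp: underS_def)
          also have "K k \<subseteq> K j" using assms(1) k by (simp add: ascending_normal_series_def)
          finally show ?thesis .
        next
          case False
          then have "K j = (\<Union>i \<in> underS j. K i)"
            using assms(1) jF iu unfolding ascending_normal_series_def by blast
          then show ?thesis using iu by blast
        qed
      qed simp
    qed
  qed
  then show ?thesis using assms(2) by blast
qed

text \<open>An ascending normal series over an arbitrary index type can be re-indexed by its own terms,
  ordered by inclusion, without changing its quotients (apart from dropping trivial ones).
  Hence nothing is lost by quantifying over series indexed by sets of group elements.\<close>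

lemma ascending_normal_series_reindex:
  fixes G :: "('a, 'b) monoid_scheme" and r :: "'i rel"
  assumes S: "ascending_normal_series G r K"
  shows "\<exists>(r' :: 'a set rel) K'. ascending_normal_series G r' K' \<and>
    (\<forall>A B. is_successor r' A B \<longrightarrow> (\<exists>i j. is_successor r i j \<and> K' A = K i \<and> K' B = K j))"
proof -
  have W: "Well_order r" using S by (simp add: ascending_normal_series_def)
  interpret wo_rel r using W by unfold_locales
  note mono = ascending_normal_series_mono[OF S]
  define T where "T = K ` Field r"
  define r' where "r' = {(A, B). A \<in> T \<and> B \<in> T \<and> A \<subseteq> B}"
  have F: "Field r' = T" by (auto simp: r'_def Field_def)
  have tot: "(i, j) \<in> r \<or> (j, i) \<in> r" if "i \<in> Field r" "j \<in> Field r" for i j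
    using TOTALS that by blast
  define f where "f A = minim {i \<in> Field r. K i = A}" for A
  have f: "f A \<in> Field r" "K (f A) = A" if "A \<in> T" for A
  proof -
    have "{i \<in> Field r. K i = A} \<noteq> {}" using that by (auto simp: T_def)
    from minim_in[OF _ this] show "f A \<in> Field r" "K (f A) = A" by (auto simp: f_def)
  qed
  have fleast: "(f (K i), i) \<in> r" if "i \<in> Field r" for i
    unfolding f_def by (rule minim_least) (use that in auto)
  have chain: "A \<subseteq> B \<longleftrightarrow> (f A, f B) \<in> r" if "A \<in> T" "B \<in> T" for A B
  proof
    assume "(f A, f B) \<in> r" then show "A \<subseteq> B" using mono f that by metis
  next
    assume AB: "A \<subseteq> B"
    show "(f A, f B) \<in> r"
    proof (rule ccontr)
      assume n: "(f A, f B) \<notin> r"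
      then have "(f B, f A) \<in> r" using tot f that by blast
      then have "B \<subseteq> A" using mono f that by metis
      with AB n REFL f(1)[OF that(1)] show False by (auto simp: refl_on_def)
    qed
  qed
  have W': "Well_order r'"
    unfolding well_order_on_def linear_order_on_def partial_order_on_def preorder_on_def F
  proof (intro conjI)
    show "refl_on T r'" by (auto simp: refl_on_def r'_def)
    show "trans r'" by (auto simp: trans_def r'_def)
    show "antisym r'" by (auto simp: antisym_def r'_def)
    show "total_on T r'" using chain tot f by (auto simp: total_on_def r'_def)
    show "r' \<subseteq> T \<times> T" by (auto simp: r'_def)
    show "wf (r' - Id)"
    proof (rule wf_subset[OF wf_inv_image[OF WF, of f]])
      show "r' - Id \<subseteq> inv_image (r - Id) f"
      proof
        fix p assume "p \<in> r' - Id"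
        then obtain A B where p: "p = (A, B)" "A \<in> T" "B \<in> T" "A \<subseteq> B" "A \<noteq> B"
          by (auto simp: r'_def)
        then have "f A \<noteq> f B" using f(2) by metis
        then show "p \<in> inv_image (r - Id) f" using p chain by (auto simp: inv_image_def)
      qed
    qed
  qed
  have uS: "Order_Relation.underS r' B = {A \<in> T. A \<subset> B}" if "B \<in> T" for B
    using that by (auto simp: underS_def r'_def)
  have un: "Order_Relation.under r' B = {A \<in> T. A \<subseteq> B}" if "B \<in> T" for B
    using that by (auto simp: under_def r'_def)
  have succ': "is_successor r' A B \<longleftrightarrow>
      A \<in> T \<and> B \<in> T \<and> {C \<in> T. C \<subset> B} = {C \<in> T. C \<subseteq> A}" for A B
  proof (cases "A \<in> T \<and> B \<in> T")
    case True
    then show ?thesis unfolding is_successor_def F by (simp only: uS un)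
  qed (auto simp only: is_successor_def F)
  have lt: "K i \<subset> B \<longleftrightarrow> i \<in> underS (f B)" if "B \<in> T" "i \<in> Field r" for B i
  proof
    assume "K i \<subset> B"
    then have "\<not> (f B, i) \<in> r" using mono f(2)[OF that(1)] by blast
    then show "i \<in> underS (f B)"
      using tot[OF that(2) f(1)[OF that(1)]] REFL that(2)
      by (auto simp: underS_def refl_on_def)
  next
    assume i: "i \<in> underS (f B)"
    then have "K i \<subseteq> B" using mono f(2)[OF that(1)] by (metis underS_E)
    moreover have "K i \<noteq> B"
      using fleast[OF that(2)] i ANTISYM by (auto simp: underS_def antisym_def)
    ultimately show "K i \<subset> B" by blast
  qed
  have below: "{A \<in> T. A \<subset> B} = K ` underS (f B)" if "B \<in> T" for B
    using lt[OF that] Order_Relation.underS_Field[of r "f B"] by (fastforce simp: T_def)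
  have succ: "is_successor r' (K i) B" if "B \<in> T" "is_successor r i (f B)" for i B
  proof -
    have iF: "i \<in> Field r" and u: "underS (f B) = under i"
      using that by (auto simp: is_successor_def)
    have "i \<in> underS (f B)" using u Refl_under_in[OF REFL iF] by simp
    then have lti: "K i \<subset> B" using lt[OF that(1) iF] by simp
    have "{A \<in> T. A \<subset> B} \<subseteq> {A \<in> T. A \<subseteq> K i}"
      using below[OF that(1)] u mono by (auto simp: under_def dest: subsetD[OF mono])
    then have "{A \<in> T. A \<subset> B} = {A \<in> T. A \<subseteq> K i}" using lti by auto
    moreover have "K i \<in> T" using iF by (simp add: T_def)
    ultimately show ?thesis using that(1) by (simp only: succ')
  qed
  have succ_ex: "\<exists>i. is_successor r i (f B) \<and> A = K i"
    if "is_successor r' A B" for A B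
  proof -
    have A: "A \<in> T" and B: "B \<in> T" and e: "{C \<in> T. C \<subset> B} = {C \<in> T. C \<subseteq> A}"
      using that by (auto simp only: succ')
    have AB: "A \<subset> B" using A e by blast
    have ne: "underS (f B) \<noteq> {}" using lt[OF B f(1)[OF A]] f(2)[OF A] AB by auto
    have "\<exists>i. is_successor r i (f B)"
    proof (rule ccontr)
      assume "\<nexists>i. is_successor r i (f B)"
      then have "K (f B) = (\<Union>i \<in> underS (f B). K i)"
        using S f(1)[OF B] ne unfolding ascending_normal_series_def by blast
      then have "B = \<Union> {C \<in> T. C \<subset> B}" using f(2)[OF B] below[OF B] by simp
      then have "B \<subseteq> A" using e by auto
      then show False using AB by blast
    qed
    then obtain i where i: "is_successor r i (f B)" by blast
    from succ[OF B i] have s: "{C \<in> T. C \<subset> B} = {C \<in> T. C \<subseteq> K i}" and "K i \<in> T"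
      by (auto simp only: succ')
    have q: "{C \<in> T. C \<subseteq> A} = {C \<in> T. C \<subseteq> K i}" using s unfolding e .
    have "A \<in> {C \<in> T. C \<subseteq> K i}" unfolding q[symmetric] using A by simp
    moreover have "K i \<in> {C \<in> T. C \<subseteq> A}" unfolding q using \<open>K i \<in> T\<close> by simp
    ultimately have "A = K i" by auto
    with i show ?thesis by blast
  qed
  have "ascending_normal_series G r' id"
    unfolding ascending_normal_series_def F id_apply
  proof (intro conjI ballI impI allI)
    show "well_order_on T r'" using W' unfolding F .
    show "A \<lhd> G" if "A \<in> T" for A
      using S that by (auto simp: ascending_normal_series_def T_def)
    show "A = {\<one>\<^bsub>G\<^esub>}" if "A \<in> T" "Order_Relation.underS r' A = {}" for A
    proof -
      have "underS (f A) = {}" using below uS that by auto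
      then have "K (f A) = {\<one>\<^bsub>G\<^esub>}"
        using S f(1)[OF that(1)] unfolding ascending_normal_series_def by blast
      then show ?thesis using f(2) that by simp
    qed
    obtain t where t: "t \<in> Field r" "under t = Field r" "K t = carrier G"
      using S[unfolded ascending_normal_series_def, THEN conjunct2, THEN conjunct2,
        THEN conjunct2, THEN conjunct1] by blast
    have "K t \<in> T" using t(1) by (simp add: T_def)
    moreover have "Order_Relation.under r' (K t) = T"
      using un[OF \<open>K t \<in> T\<close>] t(2) mono[of _ t] by (fastforce simp: T_def under_def)
    ultimately show "\<exists>t\<in>T. Order_Relation.under r' t = T \<and> t = carrier G" using t(3) by auto
    show "A \<subseteq> B" if "is_successor r' A B" for A B
    proof -
      have "A \<in> T" "B \<in> T" "{C \<in> T. C \<subset> B} = {C \<in> T. C \<subseteq> A}"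
        using that by (auto simp only: succ')
      then have "A \<in> {C \<in> T. C \<subset> B}" by simp
      then show ?thesis by auto
    qed
    show "L = (\<Union>A \<in> Order_Relation.underS r' L. A)"
      if L: "L \<in> T" and l: "Order_Relation.underS r' L \<noteq> {} \<and> (\<nexists>A. is_successor r' A L)" for L
    proof -
      have "underS (f L) \<noteq> {}" using l uS[OF L] below[OF L] by auto
      moreover have "\<nexists>i. is_successor r i (f L)" using succ[OF L] l by blast
      ultimately have "K (f L) = (\<Union>i \<in> underS (f L). K i)"
        using S f(1)[OF L] unfolding ascending_normal_series_def by blast
      then show ?thesis using f(2)[OF L] below[OF L] uS[OF L] by simp
    qed
  qed
  moreover have "\<exists>i j. is_successor r i j \<and> id A = K i \<and> id B = K j"
    if "is_successor r' A B" for A B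
  proof -
    have "B \<in> T" using that by (simp only: succ')
    then show ?thesis using succ_ex[OF that] f(2)[OF \<open>B \<in> T\<close>] by (metis id_apply)
  qed
  ultimately show ?thesis by blast
qed

definition has_locally_soluble_or_finite_series :: "('a, 'b) monoid_scheme \<Rightarrow> bool" where
  "has_locally_soluble_or_finite_series G \<longleftrightarrow>
    (\<exists>(r :: 'a set rel) K. ascending_normal_series G r K \<and>
      (\<forall>i j. is_successor r i j \<longrightarrow>
        locally_soluble (G\<lparr>carrier := K j\<rparr> Mod K i) \<or>
        locally_finite (G\<lparr>carrier := K j\<rparr> Mod K i)))"

definition class_U :: "nat \<Rightarrow> nat \<Rightarrow> 'x gword \<Rightarrow> 'a monoid set" where
  "class_U m n u = {G. group G \<and>
    (\<forall>x \<in> word_values G (word_pow (product_of_words 896 u) m). engel_element G n x) \<and>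
    has_locally_soluble_or_finite_series (G\<lparr>carrier := verbal_subgroup G u\<rparr>)}"

end

theory Submission
  imports Defs
begin

text \<open>Let \<open>N = w(G)\<close>; it is the witness for the normal subgroup of \<open>u(G)\<close>.

  \<^emph>\<open>The quotient \<open>u(G)/N\<close> is locally finite.\<close> In it, all products of four \<open>u\<close>-values have order
  dividing \<open>m\<close>, and \<open>T\<close>, the set of products of two \<open>u\<close>-values, is normal and symmetric. By
  induction along the series, \<open>E\<^sub>\<alpha> = \<langle>T \<inter> K\<^sub>\<alpha>\<rangle>\<close> is locally finite: as \<open>[a, t] = t\<^sup>-\<^sup>a t\<close> is in \<open>T\<close>
  for every \<open>u\<close>-value \<open>t\<close>, \<open>K\<^sub>\<alpha>\<close> is central modulo \<open>E\<^sub>\<alpha>\<close>, so a finite subset of \<open>T \<inter> K\<^sub>\<alpha>\<^sub>+\<^sub>1\<close> generates modulo \<open>E\<^sub>\<alpha>\<close> either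
  a central-by-finite group (finite by Dietzmann's lemma) or a soluble one. In the latter
  case take an abelian normal subgroup \<open>M\<close> with finite quotient: \<open>[x, t]\<close> is a product of two
  elements of \<open>T\<close> for \<open>x \<in> M\<close>, hence \<open>M\<^sup>m\<close> is central and Dietzmann's lemma applies again.

  \<^emph>\<open>The subgroup \<open>N\<close> is locally nilpotent.\<close> By induction along the series
  \<open>A\<^sub>\<alpha> = K\<^sub>\<alpha> \<inter> N\<close>, the conjugates of a \<open>w\<close>-value \<open>x\<close> under \<open>A\<^sub>\<alpha>\<close> generate a locally nilpotent group.
  Hence \<open>[A\<^sub>\<alpha>, N]\<close> lies in the Hirsch-Plotkin radical \<open>R\<close> of \<open>A\<^sub>\<alpha>\<close>. Finitely many conjugates of \<open>x\<close>
  under \<open>A\<^sub>\<alpha>\<^sub>+\<^sub>1\<close> generate a nilpotent group modulo \<open>A\<^sub>\<alpha>\<close>, by Gruenberg's argument (bounded Engel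
  elements of soluble groups are subnormal) or by Baer's theorem on Engel elements of finite
  groups, hence also modulo \<open>R\<close>. Finally \<open>R\<langle>x\<rangle>\<close> is locally nilpotent and subnormal in the
  group which \<open>R\<close> and these conjugates generate.\<close>

section \<open>Subgroups of additively written groups\<close>

text \<open>The number four is two times two. A commutator with a \<open>u\<close>-value is a
  product of two \<open>u\<close>-values, hence the two factors in the elements of \<open>T\<close>;
  in the soluble case \<open>[x, t]\<close> with \<open>t\<close> in \<open>T\<close> is a product
  of two elements of \<open>T\<close> and must still have order dividing \<open>m\<close>. The
  obstacle in the second half is that a \<open>w\<close>-value \<open>x\<close> need not lie in the
  term whose factor is locally soluble or locally finite, so nothing is known about the group
  generated by \<open>x\<close> and finitely many elements of that term. The bounded Engel condition
  overcomes this: the iterated commutators of these elements with \<open>x\<close> generate a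
  finitely generated subgroup that \<open>x\<close> normalizes, and it is soluble or finite modulo
  the previous term. In the finite case \<open>x\<close> may still have infinite order there, so
  Baer's theorem is extended to finite-by-cyclic groups. Both inductions speak of finite subsets
  only, which makes limit ordinals harmless. The converse inclusion uses the series
  \<open>1 <= N <= u(G)\<close>: its first factor is locally nilpotent, hence locally soluble, and
  its second is locally finite.\<close>

text \<open>Most of the argument takes place in a type of class \<^class>\<open>group_add\<close>, which is written
  additively but is not commutative; arbitrary groups are embedded into such a type by Cayley's
  theorem. This removes all carrier conditions, and without the simp rule for differences the
  simplifier decides the word problem of free groups.\<close>

declare add_uminus_conv_diff [simp del]

lemmas free_group_simps = add.assoc minus_add

definition subgrp :: "'g::group_add set \<Rightarrow> bool" where
  "subgrp H \<longleftrightarrow> 0 \<in> H \<and> (\<forall>x \<in> H. \<forall>y \<in> H. x + y \<in> H) \<and> (\<forall>x \<in> H. - x \<in> H)"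

text \<open>Words grow by one letter or inverse letter in front, so that induction treats a single
  letter at a time; closure under sums and inverses then becomes a lemma.\<close>

inductive_set gen :: "'g::group_add set \<Rightarrow> 'g set" for S where
  zero: "0 \<in> gen S"
| add: "\<lbrakk>s \<in> S; h \<in> gen S\<rbrakk> \<Longrightarrow> s + h \<in> gen S"
| sub: "\<lbrakk>s \<in> S; h \<in> gen S\<rbrakk> \<Longrightarrow> - s + h \<in> gen S"

definition conjg :: "'g::group_add \<Rightarrow> 'g \<Rightarrow> 'g" where
  "conjg g x = - g + x + g"

definition comm :: "'g::group_add \<Rightarrow> 'g \<Rightarrow> 'g" where
  "comm x y = - x + - y + x + y"

definition normalizes :: "'g::group_add \<Rightarrow> 'g set \<Rightarrow> bool" where
  "normalizes g N \<longleftrightarrow> (\<forall>x \<in> N. conjg g x \<in> N \<and> conjg (- g) x \<in> N)"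

definition nsubgrp :: "'g::group_add set \<Rightarrow> 'g set \<Rightarrow> bool" where
  "nsubgrp N H \<longleftrightarrow> subgrp N \<and> N \<subseteq> H \<and> (\<forall>h \<in> H. normalizes h N)"

primrec lcs :: "nat \<Rightarrow> 'g::group_add set \<Rightarrow> 'g set" where
  "lcs 0 H = H"
| "lcs (Suc k) H = gen {comm x y | x y. x \<in> lcs k H \<and> y \<in> H}"

primrec ders :: "nat \<Rightarrow> 'g::group_add set \<Rightarrow> 'g set" where
  "ders 0 H = H"
| "ders (Suc k) H = gen {comm x y | x y. x \<in> ders k H \<and> y \<in> ders k H}"

lemma subgrpD:
  assumes "subgrp H"
  shows "0 \<in> H" "x \<in> H \<Longrightarrow> y \<in> H \<Longrightarrow> x + y \<in> H" "x \<in> H \<Longrightarrow> - x \<in> H"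
  using assms unfolding subgrp_def by auto

lemma subgrp_conjg: "subgrp H \<Longrightarrow> g \<in> H \<Longrightarrow> x \<in> H \<Longrightarrow> conjg g x \<in> H"
  unfolding conjg_def by (intro subgrpD)

lemma subgrp_comm: "subgrp H \<Longrightarrow> g \<in> H \<Longrightarrow> x \<in> H \<Longrightarrow> comm g x \<in> H"
  unfolding comm_def by (intro subgrpD)

lemma subgrp_Int: "subgrp H \<Longrightarrow> subgrp K \<Longrightarrow> subgrp (H \<inter> K)"
  unfolding subgrp_def by blast

lemma subgrp_zero: "subgrp {0::'g::group_add}" and subgrp_UNIV: "subgrp (UNIV :: 'g set)"
  by (auto simp: subgrp_def)

lemma gen_incl: "s \<in> S \<Longrightarrow> s \<in> gen S"
  using gen.add[OF _ gen.zero] by fastforce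

lemma gen_incl': "S \<subseteq> gen S"
  using gen_incl by blast

lemma gen_plus: "x \<in> gen S \<Longrightarrow> y \<in> gen S \<Longrightarrow> x + y \<in> gen S"
  by (induction rule: gen.induct) (auto simp: add.assoc intro: gen.intros)

lemma gen_uminus: "x \<in> gen S \<Longrightarrow> - x \<in> gen S"
proof (induction rule: gen.induct)
  case (add s h) then show ?case
    using gen_plus[OF _ gen.sub[OF _ gen.zero], of "- h" S s] by (simp add: minus_add)
next
  case (sub s h) then show ?case
    using gen_plus[OF _ gen_incl, of "- h" S s] by (simp add: minus_add)
qed (simp add: gen.zero)

lemma subgrp_gen: "subgrp (gen S)"
  by (simp add: subgrp_def gen.zero gen_plus gen_uminus)

lemma gen_least: "S \<subseteq> H \<Longrightarrow> subgrp H \<Longrightarrow> gen S \<subseteq> H"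
proof
  fix x assume "x \<in> gen S" "S \<subseteq> H" "subgrp H"
  then show "x \<in> H" by (induction rule: gen.induct) (auto intro: subgrpD)
qed

lemma gen_mono: "S \<subseteq> S' \<Longrightarrow> gen S \<subseteq> gen S'"
  using gen_least[OF _ subgrp_gen] gen_incl' by blast

lemma gen_mono': "S \<subseteq> gen S' \<Longrightarrow> gen S \<subseteq> gen S'"
  using gen_least[OF _ subgrp_gen] by blast

lemma gen_subgrp: "subgrp H \<Longrightarrow> gen H = H"
  using gen_least[of H H] gen_incl'[of H] by blast

lemma conjg_0 [simp]: "conjg g 0 = 0" "conjg 0 x = x"
  by (simp_all add: conjg_def)

lemma conjg_plus: "conjg g (x + y) = conjg g x + conjg g y"
  by (simp add: conjg_def free_group_simps)

lemma conjg_uminus: "conjg g (- x) = - conjg g x"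
  by (simp add: conjg_def free_group_simps)

lemma conjg_add: "conjg (g + h) x = conjg h (conjg g x)"
  by (simp add: conjg_def free_group_simps)

lemma conjg_inverse [simp]: "conjg g (conjg (- g) x) = x" "conjg (- g) (conjg g x) = x"
  by (simp_all add: conjg_def free_group_simps)

lemma conjg_comm: "conjg g (comm x y) = comm (conjg g x) (conjg g y)"
  by (simp add: conjg_def comm_def free_group_simps)

lemma conjg_conv_comm: "conjg g x = x + comm x g"
  by (simp add: conjg_def comm_def free_group_simps)

lemma comm_conv_conjg: "comm x y = - x + conjg y x" "comm x y = - conjg x y + y"
  by (simp_all add: conjg_def comm_def free_group_simps)

lemma comm_swap: "comm y x = - comm x y"
  by (simp add: comm_def free_group_simps)

lemma comm_0 [simp]: "comm 0 x = 0" "comm x 0 = 0"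
  by (simp_all add: comm_def)

lemma comm_add_left: "comm (a + b) x = conjg b (comm a x) + comm b x"
  by (simp add: conjg_def comm_def free_group_simps)

lemma comm_add_right: "comm x (a + b) = comm x b + conjg b (comm x a)"
  by (simp add: conjg_def comm_def free_group_simps)

lemma comm_uminus_left: "comm (- a) x = - conjg (- a) (comm a x)"
  by (simp add: conjg_def comm_def free_group_simps)

lemma comm_uminus_right: "comm x (- a) = - conjg (- a) (comm x a)"
  by (simp add: conjg_def comm_def free_group_simps)

lemma normalizesD: "normalizes g N \<Longrightarrow> x \<in> N \<Longrightarrow> conjg g x \<in> N"
    "normalizes g N \<Longrightarrow> x \<in> N \<Longrightarrow> conjg (- g) x \<in> N"
  by (auto simp: normalizes_def)

lemma subgrp_normalizer: "subgrp {g. normalizes g N}"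
  unfolding subgrp_def normalizes_def by (auto simp: conjg_add minus_add)

lemma normalizes_uminus: "normalizes g N \<Longrightarrow> normalizes (- g) N"
  by (auto simp: normalizes_def)

lemma normalizes_gen: "\<forall>g \<in> S. normalizes g N \<Longrightarrow> g \<in> gen S \<Longrightarrow> normalizes g N"
  using gen_least[OF _ subgrp_normalizer, of S N] by blast

lemma normalizes_subgrp: "subgrp H \<Longrightarrow> g \<in> H \<Longrightarrow> normalizes g H"
  by (simp add: normalizes_def subgrp_conjg subgrpD)

lemma normalizes_Int: "normalizes g H \<Longrightarrow> normalizes g K \<Longrightarrow> normalizes g (H \<inter> K)"
  by (auto simp: normalizes_def)

lemma normalizes_Un: "normalizes g H \<Longrightarrow> normalizes g K \<Longrightarrow> normalizes g (H \<union> K)"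
  by (auto simp: normalizes_def)

lemma normalizes_genI:
  assumes "\<And>s. s \<in> S \<Longrightarrow> conjg g s \<in> gen S" "\<And>s. s \<in> S \<Longrightarrow> conjg (- g) s \<in> gen S"
  shows "normalizes g (gen S)"
proof -
  have *: "conjg g x \<in> gen S" if "x \<in> gen S" "\<And>s. s \<in> S \<Longrightarrow> conjg g s \<in> gen S" for x g
    using that(1) by (induction rule: gen.induct)
      (auto simp: conjg_plus conjg_uminus gen.zero intro!: gen_plus gen_uminus that(2))
  show ?thesis unfolding normalizes_def using *[of _ g] *[of _ "- g"] assms by blast
qed

lemma normalizes_gen_set: "normalizes g S \<Longrightarrow> normalizes g (gen S)"
  by (rule normalizes_genI) (auto simp: normalizes_def gen_incl)

lemma nsubgrpD:
  assumes "nsubgrp N H"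
  shows "subgrp N" "N \<subseteq> H" "h \<in> H \<Longrightarrow> normalizes h N"
    "h \<in> H \<Longrightarrow> x \<in> N \<Longrightarrow> conjg h x \<in> N" "h \<in> H \<Longrightarrow> x \<in> N \<Longrightarrow> comm x h \<in> N"
    "h \<in> H \<Longrightarrow> x \<in> N \<Longrightarrow> comm h x \<in> N"
proof -
  show 1: "normalizes h N" if "h \<in> H" for h
    using assms that by (auto simp: nsubgrp_def)
  show "subgrp N" "N \<subseteq> H" using assms by (auto simp: nsubgrp_def)
  show c: "conjg h x \<in> N" if "h \<in> H" "x \<in> N" for h x
    using 1 that by (simp add: normalizes_def)
  show 2: "comm x h \<in> N" if "h \<in> H" "x \<in> N"
    using c[OF that] that \<open>subgrp N\<close> by (simp add: comm_conv_conjg(1) subgrpD)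
  show "comm h x \<in> N" if "h \<in> H" "x \<in> N"
    using c[OF that] that \<open>subgrp N\<close> by (simp add: comm_conv_conjg(2) subgrpD)
qed

lemma nsubgrpI: "subgrp N \<Longrightarrow> N \<subseteq> H \<Longrightarrow> (\<And>h. h \<in> H \<Longrightarrow> normalizes h N) \<Longrightarrow> nsubgrp N H"
  by (simp add: nsubgrp_def)

lemma nsubgrpI':
  assumes "subgrp N" "N \<subseteq> H" "subgrp H" "\<And>h x. h \<in> H \<Longrightarrow> x \<in> N \<Longrightarrow> conjg h x \<in> N"
  shows "nsubgrp N H"
  using assms by (simp add: nsubgrp_def normalizes_def subgrpD)

lemma nsubgrp_refl: "subgrp H \<Longrightarrow> nsubgrp H H"
  by (simp add: nsubgrpI normalizes_subgrp)

lemma nsubgrp_Int: "nsubgrp N H \<Longrightarrow> subgrp K \<Longrightarrow> nsubgrp (N \<inter> K) (H \<inter> K)"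
  by (rule nsubgrpI) (auto simp: subgrp_Int normalizes_subgrp intro: normalizes_Int dest: nsubgrpD)

subsection \<open>Lower central and derived series\<close>

lemma subgrp_lcs: "subgrp H \<Longrightarrow> subgrp (lcs k H)"
  by (cases k) (auto simp: subgrp_gen)

lemma subgrp_ders: "subgrp H \<Longrightarrow> subgrp (ders k H)"
  by (cases k) (auto simp: subgrp_gen)

lemma normalizes_lcs: "normalizes g H \<Longrightarrow> normalizes g (lcs k H)"
proof (induction k)
  case (Suc k) show ?case unfolding lcs.simps
    by (rule normalizes_gen_set) (use Suc in \<open>auto simp: normalizes_def conjg_comm; blast\<close>)
qed simp

lemma normalizes_ders: "normalizes g H \<Longrightarrow> normalizes g (ders k H)"
proof (induction k)
  case (Suc k) show ?case unfolding ders.simps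
    by (rule normalizes_gen_set) (use Suc in \<open>auto simp: normalizes_def conjg_comm; blast\<close>)
qed simp

lemma lcs_decreasing: "subgrp H \<Longrightarrow> lcs (Suc k) H \<subseteq> lcs k H"
proof -
  assume H: "subgrp H"
  have "comm x y \<in> lcs k H" if "x \<in> lcs k H" "y \<in> H" for x y
    using normalizesD(1)[OF normalizes_lcs[OF normalizes_subgrp[OF H that(2)]] that(1)] that(1)
      subgrp_lcs[OF H] by (simp add: comm_conv_conjg(1) subgrpD)
  then show ?thesis unfolding lcs.simps using subgrp_lcs[OF H] by (intro gen_least) auto
qed

lemma lcs_antimono: "subgrp H \<Longrightarrow> i \<le> j \<Longrightarrow> lcs j H \<subseteq> lcs i H"
  by (rule lift_Suc_antimono_le[of "\<lambda>k. lcs k H"]) (auto simp: lcs_decreasing simp del: lcs.simps)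

lemma ders_decreasing: "subgrp H \<Longrightarrow> ders (Suc k) H \<subseteq> ders k H"
  unfolding ders.simps using subgrp_ders[of H k] by (intro gen_least) (auto intro: subgrp_comm)

lemma ders_antimono: "subgrp H \<Longrightarrow> i \<le> j \<Longrightarrow> ders j H \<subseteq> ders i H"
  by (rule lift_Suc_antimono_le[of "\<lambda>k. ders k H"]) (auto simp: ders_decreasing simp del: ders.simps)

lemma lcs_gen_zeroI: "lcs c (gen S) \<subseteq> {0} \<Longrightarrow> lcs c (gen S) = {0}"
  using subgrpD(1)[OF subgrp_lcs[OF subgrp_gen]] by blast

lemma nsubgrp_lcs: "subgrp H \<Longrightarrow> nsubgrp (lcs k H) H"
  using lcs_antimono[of H 0 k] by (auto intro!: nsubgrpI subgrp_lcs normalizes_lcs normalizes_subgrp)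

lemma nsubgrp_ders: "subgrp H \<Longrightarrow> nsubgrp (ders k H) H"
  using ders_antimono[of H 0 k] by (auto intro!: nsubgrpI subgrp_ders normalizes_ders normalizes_subgrp)

lemma lcs_mono: "H \<subseteq> K \<Longrightarrow> lcs k H \<subseteq> lcs k K"
proof (induction k)
  case (Suc k) then show ?case unfolding lcs.simps ders.simps by (intro gen_mono) auto
qed simp

lemma ders_mono: "H \<subseteq> K \<Longrightarrow> ders k H \<subseteq> ders k K"
proof (induction k)
  case (Suc k) then show ?case unfolding lcs.simps ders.simps by (intro gen_mono) auto
qed simp

lemma ders_subset_lcs: "subgrp H \<Longrightarrow> ders k H \<subseteq> lcs k H"
proof (induction k)
  case (Suc k)
  then show ?case using ders_antimono[of H 0 k] unfolding lcs.simps ders.simps by (intro gen_mono) auto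
qed simp

lemma comm_lcs: "x \<in> lcs k H \<Longrightarrow> y \<in> H \<Longrightarrow> comm x y \<in> lcs (Suc k) H"
  by (auto intro!: gen_incl)

lemma lcs_le_chain:
  assumes "H \<subseteq> L 0" "\<And>k. subgrp (L k)" "\<And>k x y. x \<in> L k \<Longrightarrow> y \<in> H \<Longrightarrow> comm x y \<in> L (Suc k)"
  shows "lcs k H \<subseteq> L k"
proof (induction k)
  case (Suc k) then show ?case unfolding lcs.simps by (intro gen_least) (auto intro: assms)
qed (simp add: assms)

lemma ders_add: "ders i (ders j H) = ders (i + j) H"
  by (induction i) auto

subsection \<open>Homomorphisms\<close>

text \<open>Relative to a subgroup \<open>D\<close>, since a quotient map of \<open>D\<close> has no
  reason to extend to a homomorphism on the whole type.\<close>

definition hom_on :: "'g::group_add set \<Rightarrow> ('g \<Rightarrow> 'h::group_add) \<Rightarrow> bool" where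
  "hom_on D f \<longleftrightarrow> subgrp D \<and> (\<forall>x \<in> D. \<forall>y \<in> D. f (x + y) = f x + f y)"

lemma hom_onD:
  assumes "hom_on D f"
  shows "subgrp D" "x \<in> D \<Longrightarrow> y \<in> D \<Longrightarrow> f (x + y) = f x + f y" "f 0 = 0" "x \<in> D \<Longrightarrow> f (- x) = - f x"
    "x \<in> D \<Longrightarrow> y \<in> D \<Longrightarrow> f (conjg y x) = conjg (f y) (f x)"
    "x \<in> D \<Longrightarrow> y \<in> D \<Longrightarrow> f (comm x y) = comm (f x) (f y)"
proof -
  show p: "f (x + y) = f x + f y" if "x \<in> D" "y \<in> D" for x y
    using assms that by (auto simp: hom_on_def)
  show s: "subgrp D" using assms by (auto simp: hom_on_def)
  then have "f (0 + 0) = f 0 + f 0" by (intro p subgrpD(1))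
  then show z: "f 0 = 0" by (metis add_0_right add_left_cancel)
  show m: "f (- x) = - f x" if "x \<in> D" for x
  proof -
    have "f (x + - x) = f x + f (- x)" using s that by (intro p subgrpD(3))
    then have "f x + f (- x) = 0" using z by (simp)
    then show ?thesis by (simp add: minus_unique)
  qed
  show "f (conjg y x) = conjg (f y) (f x)" if "x \<in> D" "y \<in> D"
    unfolding conjg_def using s that by (simp add: p m subgrpD)
  show "f (comm x y) = comm (f x) (f y)" if "x \<in> D" "y \<in> D"
    unfolding comm_def using s that by (simp add: p m subgrpD)
qed

lemma hom_on_subset: "hom_on D f \<Longrightarrow> subgrp E \<Longrightarrow> E \<subseteq> D \<Longrightarrow> hom_on E f"
  by (auto simp: hom_on_def)

lemma hom_on_conjg: "hom_on UNIV (conjg g)"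
  by (simp add: hom_on_def conjg_plus subgrp_UNIV)

lemma subgrp_image: "hom_on D f \<Longrightarrow> subgrp H \<Longrightarrow> H \<subseteq> D \<Longrightarrow> subgrp (f ` H)"
proof -
  assume a: "hom_on D f" "subgrp H" "H \<subseteq> D"
  note h = hom_on_subset[OF a]
  have "f x + f y \<in> f ` H" if "x \<in> H" "y \<in> H" for x y
    using that hom_onD(2)[OF h that] a(2) by (metis imageI subgrpD(2))
  moreover have "- f x \<in> f ` H" if "x \<in> H" for x
    using that hom_onD(4)[OF h that] a(2) by (metis imageI subgrpD(3))
  moreover have "0 \<in> f ` H" using hom_onD(3)[OF h] a(2) by (metis imageI subgrpD(1))
  ultimately show ?thesis unfolding subgrp_def by blast
qed

lemma image_gen:
  assumes "hom_on D f" "S \<subseteq> D"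
  shows "f ` gen S = gen (f ` S)"
proof
  have g: "gen S \<subseteq> D" using assms hom_onD(1) gen_least by metis
  have "f x \<in> gen (f ` S)" if "x \<in> gen S" for x using that
  proof (induction rule: gen.induct)
    case zero then show ?case by (simp add: hom_onD[OF assms(1)] gen.zero)
  next
    case (add s h)
    then have "s \<in> D" "h \<in> D" using assms g by auto
    then show ?case using add hom_onD(2)[OF assms(1)] by (simp add: gen.add)
  next
    case (sub s h)
    then have "s \<in> D" "h \<in> D" "- s \<in> D" using assms g by (auto intro: subgrpD hom_onD(1)[OF assms(1)])
    then show ?case using sub hom_onD(2,4)[OF assms(1)] gen.sub[of "f s" "f ` S" "f h"]
      by (simp)
  qed
  then show "f ` gen S \<subseteq> gen (f ` S)" by blast
  show "gen (f ` S) \<subseteq> f ` gen S"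
    by (rule gen_least) (use gen_incl' in blast, rule subgrp_image[OF assms(1) subgrp_gen g])
qed

lemma image_comm_set:
  assumes "hom_on D f" "A \<subseteq> D" "B \<subseteq> D"
  shows "f ` {comm x y |x y. x \<in> A \<and> y \<in> B} = {comm x y |x y. x \<in> f ` A \<and> y \<in> f ` B}" (is "f ` ?L = ?R")
proof
  have c: "f (comm x y) = comm (f x) (f y)" if "x \<in> A" "y \<in> B" for x y
    using that assms(2,3) by (intro hom_onD(6)[OF assms(1)]) auto
  then show "f ` ?L \<subseteq> ?R" by blast
  show "?R \<subseteq> f ` ?L"
  proof
    fix z assume "z \<in> ?R"
    then obtain x y where "z = comm (f x) (f y)" "x \<in> A" "y \<in> B" by blast
    then show "z \<in> f ` ?L" using c[of x y] by (intro image_eqI[of _ _ "comm x y"]) auto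
  qed
qed

lemma comm_set_subset: "subgrp D \<Longrightarrow> A \<subseteq> D \<Longrightarrow> B \<subseteq> D \<Longrightarrow> {comm x y |x y. x \<in> A \<and> y \<in> B} \<subseteq> D"
  using subgrp_comm by blast

lemma image_lcs:
  assumes "hom_on D f" "subgrp H" "H \<subseteq> D"
  shows "f ` lcs k H = lcs k (f ` H)"
proof (induction k)
  case (Suc k)
  have l: "lcs k H \<subseteq> D" using lcs_antimono[OF assms(2), of 0 k] assms(3) by simp
  show ?case
    using image_gen[OF assms(1) comm_set_subset[OF hom_onD(1)[OF assms(1)] l assms(3)]]
    by (simp add: image_comm_set[OF assms(1) l assms(3)] Suc)
qed simp

lemma image_ders:
  assumes "hom_on D f" "subgrp H" "H \<subseteq> D"
  shows "f ` ders k H = ders k (f ` H)"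
proof (induction k)
  case (Suc k)
  have l: "ders k H \<subseteq> D" using ders_antimono[OF assms(2), of 0 k] assms(3) by simp
  show ?case
    using image_gen[OF assms(1) comm_set_subset[OF hom_onD(1)[OF assms(1)] l l]]
    by (simp add: image_comm_set[OF assms(1) l l] Suc)
qed simp

lemma normalizes_hom_image:
  assumes "hom_on D f" "normalizes g M" "g \<in> D" "M \<subseteq> D"
  shows "normalizes (f g) (f ` M)"
proof -
  have c: "conjg (f g) a \<in> f ` M" if a: "a \<in> f ` M" and g: "normalizes g M" "g \<in> D" for a g
  proof -
    obtain b where b: "a = f b" "b \<in> M" using a by blast
    then have "conjg (f g) a = f (conjg g b)" using hom_onD(5)[OF assms(1), of b g] g assms(4) by auto
    moreover have "conjg g b \<in> M" using g b(2) by (simp add: normalizes_def)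
    ultimately show ?thesis by (rule image_eqI)
  qed
  have "- g \<in> D" using assms(3) hom_onD(1)[OF assms(1)] by (simp add: subgrpD)
  then show ?thesis
    using c[OF _ assms(2,3)] c[OF _ normalizes_uminus[OF assms(2)]] hom_onD(4)[OF assms(1,3)]
    by (auto simp: normalizes_def)
qed

lemma nsubgrp_image:
  assumes "hom_on D f" "nsubgrp N H" "subgrp H" "H \<subseteq> D"
  shows "nsubgrp (f ` N) (f ` H)"
proof (rule nsubgrpI')
  note N = nsubgrpD[OF assms(2)]
  show "subgrp (f ` N)" "subgrp (f ` H)" using subgrp_image[OF assms(1)] N assms(3,4) by auto
  show "f ` N \<subseteq> f ` H" using N by auto
  fix h x assume "h \<in> f ` H" "x \<in> f ` N"
  then obtain h' x' where h: "h = f h'" "x = f x'" "h' \<in> H" "x' \<in> N" by auto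
  then have "f (conjg h' x') = conjg h x" using hom_onD(5)[OF assms(1)] N(2) assms(4) by auto
  then show "conjg h x \<in> f ` N" using N(4) h by (metis imageI)
qed

section \<open>Permutation groups and quotients\<close>

typedef 'a bijn = "{f :: 'a \<Rightarrow> 'a. bij f}" morphisms app Bijn
  by (auto intro: exI[of _ id])

instantiation bijn :: (type) group_add
begin

definition "0 = Bijn id"
definition "f + g = Bijn (app f \<circ> app g)"
definition "- f = Bijn (inv_into UNIV (app f))"
definition "f - g = f + - (g :: 'a bijn)"

instance
proof
  have b: "bij (app f)" for f :: "'a bijn" using app by auto
  have p: "app (f + g) = app f \<circ> app g" for f g :: "'a bijn"
    using Bijn_inverse[of "app f \<circ> app g"] b by (auto simp: plus_bijn_def bij_comp)
  have z: "app 0 = (id :: 'a \<Rightarrow> 'a)" by (simp add: zero_bijn_def Bijn_inverse)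
  have m: "app (- f) = inv_into UNIV (app f)" for f :: "'a bijn"
    using Bijn_inverse[of "inv_into UNIV (app f)"] b by (auto simp: uminus_bijn_def bij_imp_bij_inv)
  fix f g h :: "'a bijn"
  show "f + g + h = f + (g + h)" by (simp add: app_inject[symmetric] p o_assoc)
  show "0 + f = f" "f + 0 = f" by (simp_all add: app_inject[symmetric] p z)
  show "- f + f = 0" using b[of f] by (simp add: app_inject[symmetric] p z m bij_def)
  show "f + - g = f - g" by (simp add: minus_bijn_def)
qed

end

definition embeds :: "('a, 'b) monoid_scheme \<Rightarrow> ('a \<Rightarrow> 'g::group_add) \<Rightarrow> bool" where
  "embeds G f \<longleftrightarrow> group G \<and> inj_on f (carrier G) \<and>
    (\<forall>x \<in> carrier G. \<forall>y \<in> carrier G. f (x \<otimes>\<^bsub>G\<^esub> y) = f x + f y)"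

lemma cayley_embedding:
  fixes G :: "('a, 'b) monoid_scheme"
  assumes "group G"
  shows "\<exists>f :: 'a \<Rightarrow> 'a bijn. embeds G f"
proof -
  interpret group G by fact
  \<comment> \<open>Left translation on the carrier, extended by the identity so that it permutes
    the whole type.\<close>
  define c where "c g = (\<lambda>x. if x \<in> carrier G then g \<otimes>\<^bsub>G\<^esub> x else x)" for g
  have c1: "c g \<circ> c h = c (g \<otimes>\<^bsub>G\<^esub> h)" if "g \<in> carrier G" "h \<in> carrier G" for g h
    using that by (auto simp: c_def m_assoc)
  have c2: "c \<one>\<^bsub>G\<^esub> = id" by (auto simp: c_def)
  have b: "bij (c g)" if "g \<in> carrier G" for g
    using c1[of g "inv\<^bsub>G\<^esub> g"] c1[of "inv\<^bsub>G\<^esub> g" g] that c2 by (intro o_bij[of "c (inv\<^bsub>G\<^esub> g)"]) auto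
  have "embeds G (Bijn \<circ> c)"
    unfolding embeds_def
  proof (intro conjI ballI inj_onI)
    fix x y assume a: "x \<in> carrier G" "y \<in> carrier G"
    show "(Bijn \<circ> c) (x \<otimes>\<^bsub>G\<^esub> y) = (Bijn \<circ> c) x + (Bijn \<circ> c) y"
      using a b by (simp add: plus_bijn_def Bijn_inverse c1)
    assume "(Bijn \<circ> c) x = (Bijn \<circ> c) y"
    then have "c x = c y" using a b by (simp add: Bijn_inject)
    then have "c x \<one>\<^bsub>G\<^esub> = c y \<one>\<^bsub>G\<^esub>" by simp
    then show "x = y" using a by (simp add: c_def)
  qed fact
  then show ?thesis by blast
qed

lemma embedsD:
  assumes "embeds K f"
  shows "group K" "inj_on f (carrier K)"
    "x \<in> carrier K \<Longrightarrow> y \<in> carrier K \<Longrightarrow> f (x \<otimes>\<^bsub>K\<^esub> y) = f x + f y"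
    "f \<one>\<^bsub>K\<^esub> = 0" "x \<in> carrier K \<Longrightarrow> f (inv\<^bsub>K\<^esub> x) = - f x"
    "x \<in> carrier K \<Longrightarrow> y \<in> carrier K \<Longrightarrow> f (group_commutator K x y) = comm (f x) (f y)"
proof -
  show "group K" and i: "inj_on f (carrier K)" using assms by (auto simp: embeds_def)
  then interpret group K by simp
  show m: "f (x \<otimes>\<^bsub>K\<^esub> y) = f x + f y" if "x \<in> carrier K" "y \<in> carrier K" for x y
    using assms that by (auto simp: embeds_def)
  have "f (\<one>\<^bsub>K\<^esub> \<otimes>\<^bsub>K\<^esub> \<one>\<^bsub>K\<^esub>) = f \<one>\<^bsub>K\<^esub> + f \<one>\<^bsub>K\<^esub>" by (rule m) simp_all
  then have "f \<one>\<^bsub>K\<^esub> + f \<one>\<^bsub>K\<^esub> = f \<one>\<^bsub>K\<^esub> + 0" by simp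
  then show o: "f \<one>\<^bsub>K\<^esub> = 0" unfolding add_left_cancel .
  show n: "f (inv\<^bsub>K\<^esub> x) = - f x" if "x \<in> carrier K" for x
  proof -
    have "f (x \<otimes>\<^bsub>K\<^esub> inv\<^bsub>K\<^esub> x) = f x + f (inv\<^bsub>K\<^esub> x)" by (rule m) (use that in simp_all)
    then have "f x + f (inv\<^bsub>K\<^esub> x) = 0" using that o by simp
    then show ?thesis by (simp add: minus_unique)
  qed
  show "f (group_commutator K x y) = comm (f x) (f y)" if "x \<in> carrier K" "y \<in> carrier K" for x y
    using that by (simp add: group_commutator_def comm_def m n)
qed

lemma embeds_subgroup:
  assumes "embeds K f" "subgroup H K" shows "embeds (K\<lparr>carrier := H\<rparr>) f"
proof -
  interpret group K by (rule embedsD(1)[OF assms(1)])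
  show ?thesis using assms subgroup_imp_group[OF assms(2)] subgroup.subset[OF assms(2)]
    by (auto simp: embeds_def subset_iff intro: inj_on_subset)
qed

lemma subgrp_embeds_image:
  assumes "embeds K f" "subgroup H K" shows "subgrp (f ` H)"
proof -
  note f = embedsD[OF assms(1)] and H = subgroup.subset[OF assms(2)]
  show ?thesis unfolding subgrp_def
  proof (intro conjI ballI)
    show "0 \<in> f ` H" using imageI[OF subgroup.one_closed[OF assms(2)], of f] f(4) by simp
    fix a assume "a \<in> f ` H"
    then obtain x where x: "a = f x" "x \<in> H" by blast
    then have "f (inv\<^bsub>K\<^esub> x) = - a" using f(5) H by auto
    then show "- a \<in> f ` H" using imageI[OF subgroup.m_inv_closed[OF assms(2) x(2)], of f] by simp
    fix b assume "b \<in> f ` H"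
    then obtain y where y: "b = f y" "y \<in> H" by blast
    then have "f (x \<otimes>\<^bsub>K\<^esub> y) = a + b" using f(3)[of x y] H x by auto
    then show "a + b \<in> f ` H" using imageI[OF subgroup.m_closed[OF assms(2) x(2) y(2)], of f] by simp
  qed
qed

lemma subgrp_carrier_image: "embeds K f \<Longrightarrow> subgrp (f ` carrier K)"
  using subgrp_embeds_image group.subgroup_self embedsD(1) by metis

text \<open>The quotient is represented by permutations of its cosets through \<open>\<psi>\<close>,
  and \<open>h\<close> is the coset map followed by \<open>\<psi>\<close>. Both are returned because
  \<open>h\<close> speaks about the additive group and \<open>\<psi>\<close> about
  \<open>K Mod N\<close>; their common image is where local properties are compared.\<close>

lemma quotient_embeds:
  fixes K :: "('a, 'b) monoid_scheme" and f :: "'a \<Rightarrow> 'g::group_add"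
  assumes "embeds K f" "N \<lhd> K"
  obtains h :: "'g \<Rightarrow> 'a set bijn" and \<psi> where "embeds (K Mod N) \<psi>" "hom_on (f ` carrier K) h"
    "\<And>x. x \<in> f ` carrier K \<Longrightarrow> h x = 0 \<longleftrightarrow> x \<in> f ` N" "h ` f ` carrier K = \<psi> ` carrier (K Mod N)"
proof -
  note f = embedsD[OF assms(1)]
  interpret N: normal N K by (rule assms(2))
  obtain \<psi> :: "'a set \<Rightarrow> 'a set bijn" where p: "embeds (K Mod N) \<psi>"
    using cayley_embedding[OF N.factorgroup_is_group] by blast
  note \<psi> = embedsD[OF p]
  define h where "h y = \<psi> (N #>\<^bsub>K\<^esub> inv_into (carrier K) f y)" for y
  have h: "h (f x) = \<psi> (N #>\<^bsub>K\<^esub> x)" if "x \<in> carrier K" for x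
    using that inv_into_f_f[OF f(2)] by (simp add: h_def)
  have cl: "N #>\<^bsub>K\<^esub> x \<in> carrier (K Mod N)" if "x \<in> carrier K" for x
    using that by (auto simp: FactGroup_def RCOSETS_def)
  have hom: "hom_on (f ` carrier K) h"
    unfolding hom_on_def
  proof (intro conjI ballI)
    show "subgrp (f ` carrier K)" by (rule subgrp_carrier_image[OF assms(1)])
    fix a b assume "a \<in> f ` carrier K" "b \<in> f ` carrier K"
    then obtain x y where xy: "a = f x" "x \<in> carrier K" "b = f y" "y \<in> carrier K" by blast
    then have "h (a + b) = h (f (x \<otimes>\<^bsub>K\<^esub> y))" by (simp add: f(3))
    also have "\<dots> = \<psi> (N #>\<^bsub>K\<^esub> (x \<otimes>\<^bsub>K\<^esub> y))" using xy by (intro h) simp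
    also have "N #>\<^bsub>K\<^esub> (x \<otimes>\<^bsub>K\<^esub> y) = (N #>\<^bsub>K\<^esub> x) \<otimes>\<^bsub>K Mod N\<^esub> (N #>\<^bsub>K\<^esub> y)"
      using N.rcos_sum[of x y] xy by (simp add: FactGroup_def)
    also have "\<psi> \<dots> = h a + h b" using \<psi>(3) cl xy by (simp add: h)
    finally show "h (a + b) = h a + h b" .
  qed
  have ker: "h a = 0 \<longleftrightarrow> a \<in> f ` N" if a: "a \<in> f ` carrier K" for a
  proof -
    obtain x where x: "a = f x" "x \<in> carrier K" using a by blast
    have "h a = 0 \<longleftrightarrow> \<psi> (N #>\<^bsub>K\<^esub> x) = \<psi> \<one>\<^bsub>K Mod N\<^esub>" unfolding x(1) h[OF x(2)] \<psi>(4) ..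
    also have "\<dots> \<longleftrightarrow> N #>\<^bsub>K\<^esub> x = \<one>\<^bsub>K Mod N\<^esub>"
      by (rule inj_on_eq_iff[OF \<psi>(2) cl[OF x(2)]]) (rule monoid.one_closed[OF group.is_monoid[OF \<psi>(1)]])
    also have "\<dots> \<longleftrightarrow> x \<in> N"
      using N.coset_join1[of N x] N.coset_join2[of x N] N.is_subgroup x N.subset by (auto simp: FactGroup_def)
    also have "\<dots> \<longleftrightarrow> a \<in> f ` N" unfolding x(1) using inj_on_image_mem_iff[OF f(2) x(2) N.subset] by simp
    finally show ?thesis .
  qed
  have "carrier (K Mod N) = (\<lambda>x. N #>\<^bsub>K\<^esub> x) ` carrier K" by (auto simp: FactGroup_def RCOSETS_def)
  then have "h ` f ` carrier K = \<psi> ` carrier (K Mod N)" by (simp add: image_image h cong: image_cong)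
  then show thesis using that p hom ker by blast
qed

text \<open>Keeps quotients within the class of additive groups: \<open>D\<close> is packaged as a
  monoid record, the quotient is formed there and is embedded again. Later arguments use only the
  homomorphism and its kernel.\<close>

lemma quotient_hom:
  fixes D A :: "'g::group_add set"
  assumes "subgrp D" "nsubgrp A D"
  shows "\<exists>q :: 'g \<Rightarrow> 'g set bijn. hom_on D q \<and> (\<forall>x \<in> D. q x = 0 \<longleftrightarrow> x \<in> A)"
proof -
  define K where "K = \<lparr>carrier = D, mult = (+), one = (0::'g)\<rparr>"
  have K: "carrier K = D" "mult K = (+)" "one K = 0" by (auto simp: K_def)
  interpret K: group K
  proof (rule groupI)
    show "\<exists>y\<in>carrier K. y \<otimes>\<^bsub>K\<^esub> x = \<one>\<^bsub>K\<^esub>" if "x \<in> carrier K" for x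
      by (rule bexI[of _ "- x"]) (use that assms(1) in \<open>auto simp: K subgrpD\<close>)
  qed (use assms(1) in \<open>auto simp: K subgrpD add.assoc\<close>)
  have i: "inv\<^bsub>K\<^esub> x = - x" if "x \<in> D" for x
    by (rule K.inv_equality) (use that assms(1) in \<open>auto simp: K subgrpD\<close>)
  note A = nsubgrpD[OF assms(2)]
  have "subgroup A K"
    by (rule K.subgroupI) (use A(1,2) in \<open>auto simp: K i subset_iff dest: subgrpD\<close>)
  then have N: "A \<lhd> K"
  proof (rule K.normal_invI)
    fix x h assume "x \<in> carrier K" "h \<in> A"
    then show "x \<otimes>\<^bsub>K\<^esub> h \<otimes>\<^bsub>K\<^esub> inv\<^bsub>K\<^esub> x \<in> A"
      using A(4)[of "- x" h] assms(1) by (simp add: K i conjg_def subgrpD)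
  qed
  have "embeds K id" by (simp add: embeds_def K)
  from quotient_embeds[OF this N] obtain q :: "'g \<Rightarrow> 'g set bijn" where "hom_on (id ` carrier K) q"
    "\<And>x. x \<in> id ` carrier K \<Longrightarrow> q x = 0 \<longleftrightarrow> x \<in> id ` A" by metis
  then show ?thesis by (auto simp: K)
qed

section \<open>Finiteness\<close>

primrec nmul :: "nat \<Rightarrow> 'g::group_add \<Rightarrow> 'g" where
  "nmul 0 x = 0"
| "nmul (Suc k) x = nmul k x + x"

lemma nmul_commutes: "a + b = b + a \<Longrightarrow> nmul k a + b = b + nmul k a"
  by (induction k) (auto simp: add.assoc, metis add.assoc)

lemma nmul_Suc': "nmul (Suc k) x = x + nmul k x"
  by (simp add: nmul_commutes)

lemma nmul_add_left: "nmul (i + j) x = nmul i x + nmul j x"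
  by (induction j) (simp_all add: add.assoc)

lemma nmul_0_right [simp]: "nmul k 0 = 0"
  by (induction k) auto

lemma nmul_add: "a + b = b + a \<Longrightarrow> nmul k (a + b) = nmul k a + nmul k b"
proof (induction k)
  case (Suc k)
  then show ?case using nmul_commutes[of b a k] by (simp add: add.assoc) (metis add.assoc)
qed simp

lemma nmul_uminus: "nmul k (- a) = - nmul k a"
  by (induction k) (simp_all add: minus_add nmul_commutes)

lemma nmul_mem: "subgrp H \<Longrightarrow> x \<in> H \<Longrightarrow> nmul k x \<in> H"
  by (induction k) (auto intro: subgrpD)

lemma hom_on_nmul: "hom_on D f \<Longrightarrow> x \<in> D \<Longrightarrow> f (nmul k x) = nmul k (f x)"
  by (induction k) (auto simp: hom_onD nmul_mem)

lemma conjg_nmul: "conjg g (nmul k x) = nmul k (conjg g x)"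
  by (rule hom_on_nmul[OF hom_on_conjg]) simp

lemma sum_list_replicate_nmul: "sum_list (replicate k x) = nmul k x"
  by (induction k) (auto simp: nmul_commutes)

text \<open>A word with more than \<open>card S * m\<close> letters contains some \<open>s\<close>
  at least \<open>m\<close> times. These occurrences can be moved to the front, at the price of
  conjugating the letters that they pass, which stay in \<open>S\<close>; there they cancel. So
  every element is a word of bounded length.\<close>

theorem dietzmann:
  fixes S :: "'g::group_add set"
  assumes "finite S" "m > 0" and tors: "\<And>s. s \<in> S \<Longrightarrow> nmul m s = 0"
    and nrm: "\<And>s t. s \<in> S \<Longrightarrow> t \<in> S \<Longrightarrow> conjg t s \<in> S"
  shows "finite (gen S)"
proof -
  have mv1: "\<exists>ys. set ys \<subseteq> S \<and> length xs = Suc (length ys) \<and>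
      count_list xs s = Suc (count_list ys s) \<and> sum_list xs = s + sum_list ys"
    if s: "s \<in> set xs" and "set xs \<subseteq> S" for s xs
  proof -
    obtain as bs where x: "xs = as @ s # bs" "s \<notin> set as"
      using split_list_first[OF s] by blast
    \<comment> \<open>Conjugation by \<open>s\<close> turns no other letter into \<open>s\<close>,
      so that moving one occurrence to the front leaves exactly one occurrence fewer.\<close>
    have "count_list (map (conjg s) as) s = 0"
    proof -
      have "conjg s a \<noteq> s" if "a \<noteq> s" for a
        using that by (metis conjg_inverse(2) conjg_def add.assoc minus_minus minus_add_cancel add_0_right right_minus)
      then show ?thesis using x(2) by (auto simp: count_list_0_iff) (metis)
    qed
    moreover have "sum_list as + s = s + sum_list (map (conjg s) as)"
      by (induction as) (auto simp: conjg_def add.assoc)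
    moreover have "set (map (conjg s) as @ bs) \<subseteq> S" using that x nrm by auto
    ultimately show ?thesis using x
      by (intro exI[of _ "map (conjg s) as @ bs"]) (auto simp: add.assoc[symmetric])
  qed
  have mv: "\<exists>ys. set ys \<subseteq> S \<and> length xs = k + length ys \<and> sum_list xs = nmul k s + sum_list ys"
    if "k \<le> count_list xs s" "set xs \<subseteq> S" for k s xs
    using that
  proof (induction k arbitrary: xs)
    case (Suc k)
    then have "s \<in> set xs" by (metis Suc_le_D count_list_0_iff nat.distinct(1))
    from mv1[OF this Suc.prems(2)] obtain ys where y: "set ys \<subseteq> S" "length xs = Suc (length ys)"
      "count_list xs s = Suc (count_list ys s)" "sum_list xs = s + sum_list ys" by blast
    from Suc.IH[of ys] y Suc.prems obtain zs where "set zs \<subseteq> S" "length ys = k + length zs"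
      "sum_list ys = nmul k s + sum_list zs" by auto
    then show ?case using y nmul_Suc'[of k s]
      by (intro exI[of _ zs]) (auto simp: add.assoc[symmetric] simp del: nmul.simps)
  qed auto
  have short: "\<exists>ys. set ys \<subseteq> S \<and> length ys \<le> card S * m \<and> sum_list xs = sum_list ys"
    if "set xs \<subseteq> S" for xs using that
  proof (induction "length xs" arbitrary: xs rule: less_induct)
    case less
    show ?case
    proof (cases "length xs \<le> card S * m")
      case False
      have "\<exists>s \<in> S. m \<le> count_list xs s"
      proof (rule ccontr)
        assume "\<not> ?thesis"
        then have "sum (count_list xs) S \<le> (\<Sum>s\<in>S. m)" by (intro sum_mono) auto
        then show False using False sum_count_set[OF less.prems assms(1)] by simp
      qed
      then obtain s where s: "s \<in> S" "m \<le> count_list xs s" by blast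
      from mv[OF s(2) less.prems] obtain ys where "set ys \<subseteq> S" "length xs = m + length ys"
        "sum_list xs = sum_list ys" using tors[OF s(1)] by auto
      then show ?thesis using less.hyps[of ys] \<open>m > 0\<close> by auto
    qed (use less in blast)
  qed
  have "gen S \<subseteq> sum_list ` {xs. set xs \<subseteq> S}"
  proof
    fix x assume "x \<in> gen S"
    then show "x \<in> sum_list ` {xs. set xs \<subseteq> S}"
    proof (induction rule: gen.induct)
      case zero show ?case by (rule image_eqI[of _ _ "[]"]) auto
    next
      case (add s h)
      then obtain xs where "set xs \<subseteq> S" "h = sum_list xs" by auto
      then show ?case using add by (intro image_eqI[of _ _ "s # xs"]) auto
    next
      case (sub s h)
      then obtain xs where x: "set xs \<subseteq> S" "h = sum_list xs" by auto
      \<comment> \<open>Inverse letters are replaced by \<open>m - 1\<close> copies of the letter,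
        so positive words suffice.\<close>
      obtain k where k: "m = Suc k" using \<open>m > 0\<close> gr0_implies_Suc by blast
      have "s + nmul k s = 0" using tors[OF sub(1)] nmul_Suc'[of k s] by (simp add: k del: nmul.simps)
      then have "- s = nmul k s" by (rule minus_unique)
      then show ?case using sub(1) x
        by (intro image_eqI[of _ _ "replicate k s @ xs"]) (auto simp: sum_list_replicate_nmul)
    qed
  qed
  also have "\<dots> \<subseteq> sum_list ` {xs. set xs \<subseteq> S \<and> length xs \<le> card S * m}"
  proof (rule image_subsetI)
    fix xs assume "xs \<in> {xs. set xs \<subseteq> S}"
    then obtain ys where "set ys \<subseteq> S" "length ys \<le> card S * m" "sum_list xs = sum_list ys"
      using short by blast
    then show "sum_list xs \<in> sum_list ` {xs. set xs \<subseteq> S \<and> length xs \<le> card S * m}" by blast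
  qed
  finally show ?thesis
    using finite_lists_length_le[OF assms(1), of "card S * m"] by (auto intro: finite_subset)
qed

section \<open>Finite index, transversals and Schreier's lemma\<close>

definition finmod :: "'g::group_add set \<Rightarrow> 'g set \<Rightarrow> bool" where
  "finmod X A \<longleftrightarrow> finite ((\<lambda>x. (+) x ` A) ` X)"

lemma finite_image_factor:
  assumes "finite (c ` X)" "\<And>x y. x \<in> X \<Longrightarrow> y \<in> X \<Longrightarrow> c x = c y \<Longrightarrow> f x = f y"
  shows "finite (f ` X)"
proof -
  have "f ` X \<subseteq> (\<lambda>z. f (SOME y. y \<in> X \<and> c y = z)) ` c ` X"
  proof (rule image_subsetI, rule image_eqI[OF _ imageI])
    fix x assume "x \<in> X"
    then have "(SOME y. y \<in> X \<and> c y = c x) \<in> X \<and> c (SOME y. y \<in> X \<and> c y = c x) = c x"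
      by (intro someI[of "\<lambda>y. y \<in> X \<and> c y = c x" x]) simp
    then show "f x = f (SOME y. y \<in> X \<and> c y = c x)"
      using \<open>x \<in> X\<close> by (intro assms(2)) simp_all
  qed simp
  then show ?thesis by (rule finite_subset) (intro finite_imageI assms(1))
qed

lemma coset_eq_iff:
  assumes "subgrp A" shows "(+) x ` A = (+) y ` A \<longleftrightarrow> - y + x \<in> A"
proof
  assume "(+) x ` A = (+) y ` A"
  moreover have "x + 0 \<in> (+) x ` A" using assms by (intro imageI subgrpD)
  ultimately obtain a where "x + 0 = y + a" "a \<in> A" by blast
  then show "- y + x \<in> A" by simp
next
  assume a: "- y + x \<in> A"
  have "(+) x ` A \<subseteq> (+) y ` A" if "- y + x \<in> A" for x y
  proof
    fix z assume "z \<in> (+) x ` A"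
    then obtain b where "z = x + b" "b \<in> A" by blast
    then have "z = y + ((- y + x) + b)" "(- y + x) + b \<in> A"
      using subgrpD(2)[OF assms that] by (simp_all add: add.assoc)
    then show "z \<in> (+) y ` A" by (rule image_eqI)
  qed
  moreover have "- x + y \<in> A" using subgrpD(3)[OF assms a] by (simp add: minus_add)
  ultimately show "(+) x ` A = (+) y ` A" using a by blast
qed

lemma finmod_iff:
  assumes "subgrp A"
  shows "finmod X A \<longleftrightarrow> (\<exists>F. finite F \<and> F \<subseteq> X \<and> (\<forall>x \<in> X. \<exists>f \<in> F. - f + x \<in> A))"
proof
  assume "finmod X A"
  then obtain F where F: "F \<subseteq> X" "finite F" "(\<lambda>x. (+) x ` A) ` X = (\<lambda>x. (+) x ` A) ` F"
    unfolding finmod_def by (meson finite_subset_image order_refl)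
  have "\<exists>f \<in> F. - f + x \<in> A" if "x \<in> X" for x
  proof -
    have "(+) x ` A \<in> (\<lambda>x. (+) x ` A) ` F" unfolding F(3)[symmetric] using that by (rule imageI)
    then obtain f where f: "f \<in> F" "(+) x ` A = (+) f ` A" by (rule imageE)
    then show ?thesis unfolding coset_eq_iff[OF assms] by (rule bexI[rotated])
  qed
  with F(1,2) show "\<exists>F. finite F \<and> F \<subseteq> X \<and> (\<forall>x \<in> X. \<exists>f \<in> F. - f + x \<in> A)" by blast
next
  assume "\<exists>F. finite F \<and> F \<subseteq> X \<and> (\<forall>x \<in> X. \<exists>f \<in> F. - f + x \<in> A)"
  then obtain F where F: "finite F" "\<forall>x \<in> X. \<exists>f \<in> F. - f + x \<in> A" by blast
  have "(\<lambda>x. (+) x ` A) ` X \<subseteq> (\<lambda>x. (+) x ` A) ` F"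
  proof clarify
    fix x assume "x \<in> X"
    then obtain f where "f \<in> F" "- f + x \<in> A" using F(2) by blast
    then have "(+) x ` A = (+) f ` A" by (simp only: coset_eq_iff[OF assms])
    then show "(+) x ` A \<in> (\<lambda>x. (+) x ` A) ` F" using \<open>f \<in> F\<close> by (rule image_eqI)
  qed
  then show "finmod X A" unfolding finmod_def by (rule finite_subset) (intro finite_imageI F)
qed

lemma finmodE:
  assumes "finmod X A" "subgrp A"
  obtains F where "finite F" "F \<subseteq> X" "\<forall>x \<in> X. \<exists>f \<in> F. - f + x \<in> A"
  using finmod_iff[OF assms(2), THEN iffD1, OF assms(1)] by (elim exE conjE)

lemma finmod_Int:
  assumes "subgrp A" "subgrp H" "X \<subseteq> H" "finmod X A"
  shows "finmod X (A \<inter> H)"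
proof -
  obtain F where F: "finite F" "F \<subseteq> X" "\<forall>x \<in> X. \<exists>f \<in> F. - f + x \<in> A"
    by (rule finmodE[OF assms(4,1)])
  have "\<exists>f \<in> F. - f + x \<in> A \<inter> H" if "x \<in> X" for x
  proof -
    from F(3) that obtain f where "f \<in> F" "- f + x \<in> A" by blast
    moreover have "- f + x \<in> H" using that \<open>f \<in> F\<close> F(2) assms(2,3) by (auto intro: subgrpD)
    ultimately show ?thesis by blast
  qed
  then show ?thesis unfolding finmod_iff[OF subgrp_Int[OF assms(1,2)], of X] using F(1,2) by blast
qed

lemma finmod_trans:
  assumes "subgrp A" "subgrp B" "finmod X A" "finmod A B"
  shows "finmod X B"
proof -
  obtain F where F: "finite F" "F \<subseteq> X" "\<forall>x \<in> X. \<exists>f \<in> F. - f + x \<in> A"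
    by (rule finmodE[OF assms(3,1)])
  obtain E where E: "finite E" "E \<subseteq> A" "\<forall>x \<in> A. \<exists>f \<in> E. - f + x \<in> B"
    by (rule finmodE[OF assms(4,2)])
  have "(\<lambda>x. (+) x ` B) ` X \<subseteq> (\<lambda>(f, e). (+) (f + e) ` B) ` (F \<times> E)"
  proof clarify
    fix x assume "x \<in> X"
    then obtain f e where "f \<in> F" "e \<in> E" "- e + (- f + x) \<in> B" using F(3) E(3) by metis
    then have "(+) x ` B = (+) (f + e) ` B"
      by (simp only: coset_eq_iff[OF assms(2)] minus_add add.assoc)
    then show "(+) x ` B \<in> (\<lambda>(f, e). (+) (f + e) ` B) ` (F \<times> E)"
      using \<open>f \<in> F\<close> \<open>e \<in> E\<close> by (intro image_eqI[of _ _ "(f, e)"]) simp_all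
  qed
  then show ?thesis unfolding finmod_def by (rule finite_subset) (intro finite_imageI finite_SigmaI F(1) E(1))
qed

lemma finmod_hom:
  assumes "hom_on D f" "\<And>x. x \<in> D \<Longrightarrow> f x = 0 \<longleftrightarrow> x \<in> A" "subgrp A" "X \<subseteq> D"
  shows "finmod X A \<longleftrightarrow> finite (f ` X)"
proof -
  have "f x = f y \<longleftrightarrow> (+) x ` A = (+) y ` A" if "x \<in> X" "y \<in> X" for x y
  proof -
    have m: "x \<in> D" "y \<in> D" "- y \<in> D" "- y + x \<in> D"
      using that assms(4) hom_onD(1)[OF assms(1)] by (auto intro: subgrpD)
    have "f (- y + x) = - f y + f x" using m hom_onD(2,4)[OF assms(1)] by simp
    also have "\<dots> = 0 \<longleftrightarrow> f x = f y" by (metis add_minus_cancel add_0_right left_minus)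
    finally show ?thesis using coset_eq_iff[OF assms(3)] assms(2)[OF m(4)] by simp
  qed
  then show ?thesis unfolding finmod_def
    using finite_image_factor[of "\<lambda>x. (+) x ` A" X f] finite_image_factor[of f X "\<lambda>x. (+) x ` A"] by blast
qed

lemma finmod_image:
  assumes "hom_on D f" "subgrp A" "A \<subseteq> D" "X \<subseteq> D" "finmod X A"
  shows "finmod (f ` X) (f ` A)"
proof -
  obtain F where F: "finite F" "F \<subseteq> X" "\<forall>x \<in> X. \<exists>g \<in> F. - g + x \<in> A"
    by (rule finmodE[OF assms(5,2)])
  have *: "\<exists>g \<in> f ` F. - g + y \<in> f ` A" if "y \<in> f ` X" for y
  proof -
    obtain x where x: "y = f x" "x \<in> X" using \<open>y \<in> f ` X\<close> by blast
    then obtain g where g: "g \<in> F" "- g + x \<in> A" using F by blast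
    have "- g \<in> D" "g \<in> D" "x \<in> D" using g x F(2) assms(4) hom_onD(1)[OF assms(1)] by (auto intro: subgrpD)
    then have "f (- g + x) = - f g + f x" by (simp add: hom_onD[OF assms(1)])
    then show ?thesis using g x by (metis imageI)
  qed
  show ?thesis unfolding finmod_iff[OF subgrp_image[OF assms(1-3)]]
    by (intro exI[of _ "f ` F"] conjI ballI finite_imageI image_mono F *)
qed

text \<open>Pushing a letter \<open>s\<close> past a representative \<open>r\<close> produces a new
  representative \<open>r'\<close> and the element \<open>- r' + (s + r)\<close> of
  \<open>N\<close>; only finitely many such elements occur. The clause on
  \<open>R \<inter> N\<close> lets an element of \<open>N\<close> absorb its own representative,
  which yields generators of \<open>N\<close>.\<close>

lemma schreier:
  assumes "finite S" "subgrp N" "N \<subseteq> gen S" "finmod (gen S) N"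
  shows "\<exists>Y R. finite Y \<and> finite R \<and> Y \<subseteq> N \<and> R \<inter> N \<subseteq> Y \<and> (\<forall>h \<in> gen S. \<exists>r \<in> R. \<exists>y \<in> gen Y. h = r + y)"
proof -
  obtain F where F: "finite F" "F \<subseteq> gen S" "\<forall>x \<in> gen S. \<exists>f \<in> F. - f + x \<in> N"
    by (rule finmodE[OF assms(4,2)])
  define R where "R = insert 0 F"
  define S' where "S' = S \<union> uminus ` S"
  have R: "finite R" "R \<subseteq> gen S" "\<forall>x \<in> gen S. \<exists>f \<in> R. - f + x \<in> N" "0 \<in> R"
    using F by (auto simp: R_def gen.zero)
  \<comment> \<open>The second set consists of the Schreier generators, the first of the
    representatives that lie in \<open>N\<close>.\<close>
  define Y where "Y = (R \<inter> N) \<union> ((\<lambda>(r, s, r'). - r' + (s + r)) ` (R \<times> S' \<times> R) \<inter> N)"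
  have fin: "finite Y" using R(1) assms(1) by (auto simp: Y_def S'_def)
  have step: "\<exists>r \<in> R. \<exists>y \<in> gen Y. s + h = r + y" if "s \<in> S'" and h: "\<exists>r \<in> R. \<exists>y \<in> gen Y. h = r + y" for s h
  proof -
    obtain r y where r: "r \<in> R" "y \<in> gen Y" "h = r + y" using h by blast
    have "s \<in> gen S" using that(1) unfolding S'_def by (auto intro: gen_uminus gen_incl)
    then have "s + r \<in> gen S" using r R(2) by (auto intro: gen_plus)
    then obtain r' where r': "r' \<in> R" "- r' + (s + r) \<in> N" using R(3) by blast
    then have "- r' + (s + r) \<in> Y" using that r(1)
      by (auto simp: Y_def intro!: image_eqI[of _ _ "(r, s, r')"])
    then have "- r' + (s + r) + y \<in> gen Y" by (intro gen_plus r gen_incl)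
    moreover have "s + h = r' + (- r' + (s + r) + y)" by (simp add: r(3) add.assoc)
    ultimately show ?thesis using r'(1) by blast
  qed
  have "\<exists>r \<in> R. \<exists>y \<in> gen Y. h = r + y" if "h \<in> gen S" for h using that
  proof (induction rule: gen.induct)
    case zero
    have "0 = 0 + (0 :: 'a)" by simp
    then show ?case using R(4) gen.zero by blast
  next
    case (add s h) then show ?case by (intro step) (auto simp: S'_def)
  next
    case (sub s h) then show ?case by (intro step) (auto simp: S'_def)
  qed
  then show ?thesis using fin R(1) by (intro exI[of _ Y] exI[of _ R]) (auto simp: Y_def)
qed

lemma finite_index_finitely_generated:
  assumes "finite S" "subgrp N" "N \<subseteq> gen S" "finmod (gen S) N"
  shows "\<exists>Y. finite Y \<and> N = gen Y"
proof -
  obtain Y R where Y: "finite Y" "Y \<subseteq> N" "R \<inter> N \<subseteq> Y" "\<forall>h \<in> gen S. \<exists>r \<in> R. \<exists>y \<in> gen Y. h = r + y"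
    using schreier[OF assms] by blast
  have g: "gen Y \<subseteq> N" using gen_least[OF Y(2) assms(2)] .
  have "n \<in> gen Y" if n: "n \<in> N" for n
  proof -
    obtain r y where r: "r \<in> R" "y \<in> gen Y" "n = r + y" using Y(4) n assms(3) by blast
    then have "r = n + - y" by (simp add: add.assoc)
    then have "r \<in> N" using that r(2) g assms(2) by (auto intro: subgrpD)
    then show ?thesis using r Y(3) by (auto intro: gen_plus gen_incl)
  qed
  then show ?thesis using g Y(1) by blast
qed

lemma finite_gen_extension:
  assumes "finite S" "subgrp N" "N \<subseteq> gen S" "finmod (gen S) N"
    and "\<And>Y. finite Y \<Longrightarrow> Y \<subseteq> N \<Longrightarrow> finite (gen Y)"
  shows "finite (gen S)"
proof -
  obtain Y R where Y: "finite Y" "finite R" "Y \<subseteq> N" "\<forall>h \<in> gen S. \<exists>r \<in> R. \<exists>y \<in> gen Y. h = r + y"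
    using schreier[OF assms(1-4)] by blast
  then have "gen S \<subseteq> (\<lambda>(r, y). r + y) ` (R \<times> gen Y)" by fastforce
  then show ?thesis by (rule finite_subset) (intro finite_imageI finite_SigmaI Y(2) assms(5)[OF Y(1,3)])
qed

section \<open>Finiteness of groups generated by torsion elements\<close>

lemma subgrp_centralizer: "subgrp {h. \<forall>z \<in> Z. comm z h = 0}"
  by (auto simp: subgrp_def comm_add_right comm_uminus_right)

text \<open>Conjugating \<open>s\<close> by two elements of one coset of the central subgroup
  \<open>Z\<close> has the same effect, so \<open>S\<close> has only finitely many conjugates, and
  \<open>dietzmann\<close> applies to the set of all of them.\<close>

lemma central_by_finite:
  assumes "finite S" "m > 0" and tors: "\<And>s. s \<in> S \<Longrightarrow> nmul m s = 0"
    and Z: "subgrp Z" "\<And>z h. z \<in> Z \<Longrightarrow> h \<in> gen S \<Longrightarrow> comm z h = 0"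
    and fin: "finmod (gen S) Z"
  shows "finite (gen S)"
proof -
  define S' where "S' = (\<Union>s \<in> S. (\<lambda>h. conjg h s) ` gen S)"
  have sub: "S' \<subseteq> gen S" by (auto simp: S'_def intro: subgrp_conjg[OF subgrp_gen] gen_incl)
  have f: "finite S'" unfolding S'_def
  proof (intro finite_UN_I assms(1) finite_image_factor[OF fin[unfolded finmod_def]])
    fix s x y assume s: "s \<in> S" and e: "(+) x ` Z = (+) y ` Z"
    define z where "z = - y + x"
    have "z \<in> Z" using e coset_eq_iff[OF Z(1)] by (simp add: z_def)
    have "comm z (conjg y s) = 0" if "y \<in> gen S"
      using Z(2)[OF \<open>z \<in> Z\<close>] subgrp_conjg[OF subgrp_gen that gen_incl[OF s]] by blast
    moreover have "x = y + z" by (simp add: z_def)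
    moreover assume "x \<in> gen S" "y \<in> gen S"
    ultimately show "conjg x s = conjg y s"
      by (simp add: conjg_add conjg_conv_comm[of z] comm_swap[of z])
  qed
  have "finite (gen S')"
  proof (rule dietzmann[OF f \<open>m > 0\<close>])
    show "nmul m s = 0" if "s \<in> S'" for s
      using that tors by (auto simp: S'_def conjg_nmul[symmetric])
    show "conjg t s \<in> S'" if "s \<in> S'" "t \<in> S'" for s t
    proof -
      obtain h r where "s = conjg h r" "r \<in> S" "h \<in> gen S" using \<open>s \<in> S'\<close> by (auto simp: S'_def)
      then have "conjg t s = conjg (h + t) r" "h + t \<in> gen S"
        using that sub by (auto simp: conjg_add intro: gen_plus)
      then show ?thesis using \<open>r \<in> S\<close> by (auto simp: S'_def)
    qed
  qed
  moreover have "S \<subseteq> S'" by (force simp: S'_def intro: image_eqI[of _ _ 0] gen.zero)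
  ultimately show ?thesis using finite_subset[OF gen_mono] by blast
qed

text \<open>The exponent is imposed on sums of two elements because \<open>comm x t\<close> is
  \<open>- conjg x t + t\<close>; with one summand \<open>0\<close> it covers single
  elements.\<close>

definition torset :: "nat \<Rightarrow> 'g::group_add set \<Rightarrow> 'g set \<Rightarrow> bool" where
  "torset m T H \<longleftrightarrow> subgrp H \<and> T \<subseteq> H \<and> 0 \<in> T \<and> (\<forall>t \<in> T. - t \<in> T) \<and>
    (\<forall>h \<in> H. \<forall>t \<in> T. conjg h t \<in> T) \<and> (\<forall>a \<in> T. \<forall>b \<in> T. nmul m (a + b) = 0)"

lemma torset_Int: "torset m T H \<Longrightarrow> subgrp K \<Longrightarrow> K \<subseteq> H \<Longrightarrow> torset m (T \<inter> K) K"
  by (auto simp: torset_def subgrpD subgrp_conjg subset_iff)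

lemma torset_image:
  assumes "torset m T H" "hom_on D f" "H \<subseteq> D"
  shows "torset m (f ` T) (f ` H)"
proof -
  have T: "subgrp H" "T \<subseteq> H" "0 \<in> T" "\<And>t. t \<in> T \<Longrightarrow> - t \<in> T"
    "\<And>h t. h \<in> H \<Longrightarrow> t \<in> T \<Longrightarrow> conjg h t \<in> T" "\<And>a b. a \<in> T \<Longrightarrow> b \<in> T \<Longrightarrow> nmul m (a + b) = 0"
    using assms(1) by (auto simp: torset_def)
  note f = hom_onD[OF hom_on_subset[OF assms(2) T(1) assms(3)]]
  show ?thesis unfolding torset_def
  proof (intro conjI ballI)
    show "subgrp (f ` H)" by (rule subgrp_image) (use assms T in auto)
    show "f ` T \<subseteq> f ` H" using T(2) by blast
    show "0 \<in> f ` T" using imageI[OF T(3), of f] f(3) by simp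
    show "- t \<in> f ` T" if t: "t \<in> f ` T" for t
    proof -
      obtain x where x: "t = f x" "x \<in> T" using t by blast
      then have "f (- x) = - t" using f(4) T(2) by auto
      then show ?thesis using imageI[OF T(4)[OF x(2)], of f] by simp
    qed
    show "conjg h t \<in> f ` T" if ht: "h \<in> f ` H" "t \<in> f ` T" for h t
    proof -
      obtain x y where x: "t = f x" "x \<in> T" "h = f y" "y \<in> H" using ht by blast
      then have "f (conjg y x) = conjg h t" using f(5)[of x y] T(2) by auto
      then show ?thesis using imageI[OF T(5)[OF x(4,2)], of f] by simp
    qed
    show "nmul m (a + b) = 0" if ab: "a \<in> f ` T" "b \<in> f ` T" for a b
    proof -
      obtain c d where "a = f c" "b = f d" "c \<in> T" "d \<in> T" using ab by blast
      moreover from this have "f (nmul m (c + d)) = nmul m (f c + f d)"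
        using T(1,2) f(2) hom_on_nmul[OF hom_on_subset[OF assms(2) T(1) assms(3)], of "c + d" m]
        by (auto simp: subgrpD subset_iff)
      ultimately show ?thesis using T(6)[of c d] f(3) by simp
    qed
  qed
qed

lemma abelian_by_finite:
  fixes S :: "'g::group_add set"
  assumes T: "torset m T (gen S)" "S \<subseteq> T" "finite S" "m > 0"
    and M: "nsubgrp M (gen S)" "\<And>x y. x \<in> M \<Longrightarrow> y \<in> M \<Longrightarrow> comm x y = 0"
    and fin: "finmod (gen S) M"
  shows "finite (gen S)"
proof -
  note M' = nsubgrpD[OF M(1)]
  have cm: "x + y = y + x" if "x \<in> M" "y \<in> M" for x y
  proof -
    have "y + x + comm x y = x + y" by (simp add: comm_def add.assoc)
    then show ?thesis using M(2)[OF that] by simp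
  qed
  define Z where "Z = nmul m ` M"
  have Zs: "subgrp Z"
    unfolding subgrp_def
  proof (intro conjI ballI)
    show "0 \<in> Z" unfolding Z_def using M'(1) by (intro image_eqI[of _ _ 0]) (auto intro: subgrpD)
    show "x + y \<in> Z" if "x \<in> Z" "y \<in> Z" for x y
      using that M'(1) cm unfolding Z_def by (auto simp: nmul_add[symmetric] subgrpD)
    show "- x \<in> Z" if "x \<in> Z" for x
      using that M'(1) unfolding Z_def by (auto simp: nmul_uminus[symmetric] subgrpD)
  qed
  have ZM: "Z \<subseteq> M" unfolding Z_def using M'(1) by (auto intro: nmul_mem)
  have "comm x t \<in> M \<and> comm (nmul k x) t = nmul k (comm x t)" if "x \<in> M" "t \<in> gen S" for x t k
  proof (induction k)
    case (Suc k)
    have "conjg x (comm (nmul k x) t) = comm (nmul k x) t"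
      using Suc that M'(1,5) M(2) by (simp add: conjg_conv_comm nmul_mem)
    then show ?case using Suc by (simp add: comm_add_left)
  qed (use that M'(5) in simp)
  moreover have "nmul m (comm x t) = 0" if "x \<in> M" "t \<in> S" for x t
  proof -
    have "t \<in> T" "x \<in> gen S" using that T(2) M'(2) by auto
    then have "t \<in> T" "conjg x t \<in> T" using T(1) unfolding torset_def by auto
    then have "nmul m (- conjg x t + t) = 0" using T(1) unfolding torset_def by blast
    then show ?thesis by (simp add: comm_conv_conjg(2))
  qed
  ultimately have "S \<subseteq> {h. \<forall>z \<in> Z. comm z h = 0}" by (auto simp: Z_def gen_incl)
  then have cen: "gen S \<subseteq> {h. \<forall>z \<in> Z. comm z h = 0}" by (rule gen_least[OF _ subgrp_centralizer])
  have "nsubgrp Z M"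
    using M(2) ZM M'(1) by (intro nsubgrpI' Zs) (auto simp: conjg_conv_comm subset_iff)
  from quotient_hom[OF M'(1) this] obtain q :: "'g \<Rightarrow> 'g set bijn"
    where q: "hom_on M q" "\<forall>x \<in> M. q x = 0 \<longleftrightarrow> x \<in> Z" by blast
  obtain Y where Y: "finite Y" "M = gen Y"
    using finite_index_finitely_generated[OF T(3) M'(1,2) fin] by blast
  have "finite (gen (q ` Y))"
  proof (rule dietzmann[OF _ \<open>m > 0\<close>])
    have YM: "Y \<subseteq> M" using Y(2) gen_incl' by blast
    show "nmul m s = 0" if s: "s \<in> q ` Y" for s
    proof -
      obtain y where "s = q y" "y \<in> M" using s YM by blast
      then have "nmul m s = q (nmul m y)" "nmul m y \<in> Z" by (auto simp: hom_on_nmul[OF q(1)] Z_def)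
      then show ?thesis using q(2) ZM by auto
    qed
    show "conjg t s \<in> q ` Y" if st: "s \<in> q ` Y" "t \<in> q ` Y" for s t
    proof -
      obtain y x where "s = q y" "t = q x" "y \<in> Y" "x \<in> Y" using st by blast
      moreover from this have "conjg x y = y" using M(2)[of y x] subsetD[OF YM] by (simp add: conjg_conv_comm)
      moreover have "conjg (q x) (q y) = q (conjg x y)"
        using calculation hom_onD(5)[OF q(1), of y x] subsetD[OF YM] by simp
      ultimately show ?thesis by simp
    qed
  qed (use Y in simp)
  then have "finite (q ` M)" using image_gen[OF q(1), of Y] Y(2) gen_incl'[of Y] by simp
  then have "finmod M Z" using finmod_hom[OF q(1) _ Zs, of M] q(2) by blast
  then have "finmod (gen S) Z" using finmod_trans[OF M'(1) Zs fin] by blast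
  moreover have "nmul m s = 0" if "s \<in> S" for s
  proof -
    have "nmul m (s + 0) = 0" using T(1,2) that unfolding torset_def by blast
    then show ?thesis by simp
  qed
  ultimately show ?thesis
    using central_by_finite[OF T(3,4) _ Zs] cen by blast
qed

text \<open>Each derived term has finite index, by induction: modulo the next term the current one
  is abelian, normal and of finite index, so \<open>abelian_by_finite\<close> makes that quotient
  finite. The last term is trivial.\<close>

lemma soluble_torset_finite:
  fixes S :: "'g::group_add set"
  assumes T: "torset m T (gen S)" "S \<subseteq> T" "finite S" "m > 0" and d: "ders d (gen S) = {0}"
  shows "finite (gen S)"
proof -
  have fm: "finmod (gen S) (ders i (gen S))" for i
  proof (induction i)
    case 0
    have "(+) x ` gen S = gen S" if "x \<in> gen S" for x
      using coset_eq_iff[OF subgrp_gen, of x S 0] that by simp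
    then have "(\<lambda>x. (+) x ` gen S) ` gen S \<subseteq> {gen S}" by blast
    then show ?case unfolding finmod_def ders.simps using finite_subset by blast
  next
    case (Suc i)
    let ?M = "ders i (gen S)" and ?N = "ders (Suc i) (gen S)"
    have N: "nsubgrp ?N (gen S)" "nsubgrp ?M (gen S)" by (rule nsubgrp_ders[OF subgrp_gen])+
    from quotient_hom[OF subgrp_gen this(1)] obtain q :: "'g \<Rightarrow> 'g set bijn"
      where q: "hom_on (gen S) q" "\<forall>x \<in> gen S. q x = 0 \<longleftrightarrow> x \<in> ?N" by blast
    have qg: "q ` gen S = gen (q ` S)" by (rule image_gen[OF q(1) gen_incl'])
    have "finite (gen (q ` S))"
    proof (rule abelian_by_finite[of m "q ` T"])
      show "torset m (q ` T) (gen (q ` S))" using torset_image[OF T(1) q(1)] qg by simp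
      show "nsubgrp (q ` ?M) (gen (q ` S))"
        using nsubgrp_image[OF q(1) N(2) subgrp_gen] qg by simp
      show "finmod (gen (q ` S)) (q ` ?M)"
        using finmod_image[OF q(1) _ _ _ Suc] nsubgrpD[OF N(2)] qg by simp
      fix x y assume "x \<in> q ` ?M" "y \<in> q ` ?M"
      then obtain a b where ab: "x = q a" "y = q b" "a \<in> ?M" "b \<in> ?M" by blast
      then have "comm a b \<in> ?N" by (auto intro: gen_incl)
      moreover have "a \<in> gen S" "b \<in> gen S" using ab nsubgrpD(2)[OF N(2)] by auto
      ultimately show "comm x y = 0" using q(2) nsubgrpD(2)[OF N(1)] hom_onD(6)[OF q(1)] ab(1,2)
        by (metis subsetD)
    qed (use T in auto)
    then show ?case using finmod_hom[OF q(1) _ nsubgrpD(1)[OF N(1)], of "gen S"] q(2) qg by auto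
  qed
  have "hom_on (gen S) id" by (simp add: hom_on_def subgrp_gen)
  from finmod_hom[OF this _ subgrp_zero, of "gen S"] show ?thesis using fm[of d] d by simp
qed

section \<open>Local properties modulo a subgroup, and the successor step for local
  finiteness\<close>

definition lnil :: "'g::group_add set \<Rightarrow> bool" where
  "lnil H \<longleftrightarrow> (\<forall>S. finite S \<and> S \<subseteq> H \<longrightarrow> (\<exists>c. lcs c (gen S) = {0}))"

text \<open>Says that \<open>H\<close> is locally soluble modulo \<open>A\<close> without forming a
  quotient, so that all factors of a series are described inside one type; \<open>lfinmod\<close> is
  its finite counterpart.\<close>

definition lsolmod :: "'g::group_add set \<Rightarrow> 'g set \<Rightarrow> bool" where
  "lsolmod H A \<longleftrightarrow> (\<forall>S. finite S \<and> S \<subseteq> H \<longrightarrow> (\<exists>d. ders d (gen S) \<subseteq> A))"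

definition lfinmod :: "'g::group_add set \<Rightarrow> 'g set \<Rightarrow> bool" where
  "lfinmod H A \<longleftrightarrow> (\<forall>S. finite S \<and> S \<subseteq> H \<longrightarrow> finmod (gen S) A)"

lemma lnilD: "lnil H \<Longrightarrow> finite S \<Longrightarrow> S \<subseteq> H \<Longrightarrow> \<exists>c. lcs c (gen S) = {0}"
  by (simp add: lnil_def)

lemma lsolmodD: "lsolmod H A \<Longrightarrow> finite S \<Longrightarrow> S \<subseteq> H \<Longrightarrow> \<exists>d. ders d (gen S) \<subseteq> A"
  by (simp add: lsolmod_def)

lemma lfinmodD: "lfinmod H A \<Longrightarrow> finite S \<Longrightarrow> S \<subseteq> H \<Longrightarrow> finmod (gen S) A"
  by (simp add: lfinmod_def)

text \<open>By \<open>comm_add_right\<close> and \<open>comm_uminus_right\<close> the set of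
  \<open>u\<close> that commute with \<open>a\<close> modulo \<open>E\<close> is closed under words
  in \<open>S\<close>, because these words normalize \<open>E\<close>.\<close>

lemma comm_gen_mem:
  assumes "subgrp E" "\<And>u. u \<in> gen S \<Longrightarrow> normalizes u E" "\<And>s. s \<in> S \<Longrightarrow> comm a s \<in> E" "u \<in> gen S"
  shows "comm a u \<in> E"
  using assms(4)
proof (induction rule: gen.induct)
  case zero then show ?case using assms(1) by (simp add: subgrpD)
next
  case (add s h)
  then have "conjg h (comm a s) \<in> E" using assms(2)[of h] assms(3)[of s] by (simp add: normalizes_def)
  then show ?case using add assms(1) by (simp add: comm_add_right subgrpD)
next
  case (sub s h)
  then have "conjg (- s) (comm a s) \<in> E"
    using assms(2)[OF gen_incl[of s]] assms(3)[of s] by (simp add: normalizes_def)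
  then have "comm a (- s) \<in> E" using assms(1) by (simp add: comm_uminus_right subgrpD)
  then have "conjg h (comm a (- s)) \<in> E" using sub assms(2)[of h] by (simp add: normalizes_def)
  then show ?case using sub assms(1) by (simp add: comm_add_right subgrpD)
qed

lemma finite_subset_gen:
  assumes "finite Y" "Y \<subseteq> gen S"
  shows "\<exists>S0. finite S0 \<and> S0 \<subseteq> S \<and> Y \<subseteq> gen S0"
proof -
  have 1: "\<exists>S0. finite S0 \<and> S0 \<subseteq> S \<and> y \<in> gen S0" if "y \<in> gen S" for y using that
  proof (induction rule: gen.induct)
    case zero then show ?case by (intro exI[of _ "{}"]) (auto simp: gen.zero)
  next
    case (add s h)
    then obtain S0 where "finite S0" "S0 \<subseteq> S" "h \<in> gen S0" by blast
    then have "h \<in> gen (insert s S0)" using gen_mono[of S0 "insert s S0"] by blast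
    then show ?case using \<open>finite S0\<close> \<open>S0 \<subseteq> S\<close> add by (intro exI[of _ "insert s S0"]) (auto intro: gen.add)
  next
    case (sub s h)
    then obtain S0 where "finite S0" "S0 \<subseteq> S" "h \<in> gen S0" by blast
    then have "h \<in> gen (insert s S0)" using gen_mono[of S0 "insert s S0"] by blast
    then show ?case using \<open>finite S0\<close> \<open>S0 \<subseteq> S\<close> sub by (intro exI[of _ "insert s S0"]) (auto intro: gen.sub)
  qed
  show ?thesis using assms
  proof (induction rule: finite_induct)
    case empty then show ?case by (intro exI[of _ "{}"]) auto
  next
    case (insert y Y)
    then obtain S0 S1 where S: "finite S0" "S0 \<subseteq> S" "Y \<subseteq> gen S0" "finite S1" "S1 \<subseteq> S" "y \<in> gen S1"
      using 1[of y] by blast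
    then show ?case using gen_mono[of S0 "S0 \<union> S1"] gen_mono[of S1 "S0 \<union> S1"]
      by (intro exI[of _ "S0 \<union> S1"]) auto
  qed
qed

lemma hom_image_trivial:
  assumes "hom_on D q" "\<And>x. x \<in> D \<Longrightarrow> q x = 0 \<longleftrightarrow> x \<in> E" "X \<subseteq> D" "0 \<in> X"
  shows "q ` X = {0} \<longleftrightarrow> X \<subseteq> E"
proof -
  have "0 \<in> q ` X" using imageI[OF assms(4), of q] hom_onD(3)[OF assms(1)] by simp
  then show ?thesis using assms(2,3) by (auto simp: image_subset_iff subset_iff)
qed

text \<open>Here \<open>?E\<close> is the part already known to be locally finite. Once
  \<open>gen S\<close> is finite modulo \<open>?E\<close>, its intersection with \<open>?E\<close>
  has finite index, hence is finitely generated and therefore finite.\<close>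

lemma locally_finite_step:
  fixes U :: "'g::group_add set"
  assumes T: "torset m T U" "m > 0" and A: "nsubgrp A U" and B: "B \<subseteq> U"
    and cen: "\<And>a u. a \<in> A \<Longrightarrow> u \<in> U \<Longrightarrow> comm a u \<in> gen (T \<inter> A)"
    and fin: "\<And>S. finite S \<Longrightarrow> S \<subseteq> T \<inter> A \<Longrightarrow> finite (gen S)"
    and fac: "lsolmod B A \<or> lfinmod B A"
    and S: "finite S" "S \<subseteq> T \<inter> B"
  shows "finite (gen S)"
proof -
  let ?E = "gen (T \<inter> A)" and ?H = "gen S"
  note A' = nsubgrpD[OF A]
  have U: "subgrp U" and TU: "T \<subseteq> U" and Tc: "\<And>h t. h \<in> U \<Longrightarrow> t \<in> T \<Longrightarrow> conjg h t \<in> T"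
    using T(1) by (auto simp: torset_def)
  have HU: "?H \<subseteq> U" using S(2) TU U by (intro gen_least) auto
  have EA: "?E \<subseteq> A" by (rule gen_least[OF _ A'(1)]) simp
  have En: "nsubgrp ?E U"
  proof (rule nsubgrpI[OF subgrp_gen])
    show "?E \<subseteq> U" using EA A'(2) by simp
    fix h assume h: "h \<in> U"
    then have "normalizes h T" using Tc[of h] Tc[of "- h"] U by (auto simp: normalizes_def subgrpD)
    then show "normalizes h ?E" by (intro normalizes_gen_set normalizes_Int A'(3) h)
  qed
  from quotient_hom[OF U En] obtain q :: "'g \<Rightarrow> 'g set bijn"
    where q: "hom_on U q" "\<And>x. x \<in> U \<Longrightarrow> q x = 0 \<longleftrightarrow> x \<in> ?E" by blast
  have qH: "q ` ?H = gen (q ` S)" using image_gen[OF q(1)] HU gen_incl'[of S] by blast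
  have "finite (q ` ?H)"
    using fac
  proof
    assume "lfinmod B A"
    then have "finmod ?H A" using S by (auto simp: lfinmod_def)
    then have f: "finmod ?H (A \<inter> ?H)" by (rule finmod_Int[OF A'(1) subgrp_gen subset_refl])
    have "finite (gen (q ` S))"
    proof (rule central_by_finite[of _ m "q ` (A \<inter> ?H)"])
      show "nmul m s = 0" if s: "s \<in> q ` S" for s
      proof -
        obtain t where t: "s = q t" "t \<in> T" using s S(2) by blast
        have "nmul m (t + 0) = 0" using T(1) t(2) unfolding torset_def by blast
        then have "q (nmul m t) = 0" using hom_onD(3)[OF q(1)] by simp
        then show ?thesis using hom_on_nmul[OF q(1), of t m] t TU by auto
      qed
      show "subgrp (q ` (A \<inter> ?H))"
        by (rule subgrp_image[OF q(1)]) (use A' HU in \<open>auto intro: subgrp_Int subgrp_gen\<close>)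
      show "finmod (gen (q ` S)) (q ` (A \<inter> ?H))"
        using finmod_image[OF q(1) _ _ _ f] A'(1) HU subgrp_Int[OF A'(1) subgrp_gen] unfolding qH by blast
      fix z h assume "z \<in> q ` (A \<inter> ?H)" "h \<in> gen (q ` S)"
      then obtain a g where ag: "z = q a" "a \<in> A" "h = q g" "g \<in> ?H" unfolding qH[symmetric] by blast
      then have "comm a g \<in> ?E" "a \<in> U" "g \<in> U" using cen[of a g] A'(2) HU by auto
      moreover from this have "comm a g \<in> U" using U by (simp add: subgrp_comm)
      ultimately show "comm z h = 0" using q(2)[of "comm a g"] hom_onD(6)[OF q(1), of a g] ag by simp
    qed (use S T in auto)
    then show ?thesis by (simp add: qH)
  next
    assume "lsolmod B A"
    then obtain d where d: "ders d ?H \<subseteq> A" using S by (auto simp: lsolmod_def)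
    \<comment> \<open>Since \<open>A\<close> is central modulo \<open>?E\<close>, one further
      derived step leads from \<open>A\<close> into \<open>?E\<close>.\<close>
    have "{comm x y |x y. x \<in> ders d ?H \<and> y \<in> ders d ?H} \<subseteq> ?E"
      using d cen A'(2) by blast
    then have d': "ders (Suc d) ?H \<subseteq> ?E" by (simp add: gen_mono')
    have dU: "ders (Suc d) ?H \<subseteq> U" using ders_antimono[OF subgrp_gen, of 0 "Suc d" S] HU by simp
    have "q ` ders (Suc d) ?H = {0}"
      using hom_image_trivial[OF q dU] d' subgrpD(1)[OF subgrp_ders[OF subgrp_gen]] by blast
    then have "ders (Suc d) (gen (q ` S)) = {0}"
      using image_ders[OF q(1) subgrp_gen HU, of "Suc d"] qH by simp
    moreover have "torset m (q ` (T \<inter> ?H)) (gen (q ` S))"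
      using torset_image[OF torset_Int[OF T(1) subgrp_gen HU] q(1) HU] qH by simp
    moreover have "q ` S \<subseteq> q ` (T \<inter> ?H)" using S(2) gen_incl'[of S] by blast
    ultimately have "finite (gen (q ` S))" using soluble_torset_finite S(1) T(2) by blast
    then show ?thesis by (simp add: qH)
  qed
  \<comment> \<open>Back from the quotient: Schreier generators of \<open>?E \<inter> ?H\<close> are
    words in finitely many elements of \<open>T \<inter> A\<close>, to which the assumption on
    finite subsets applies.\<close>
  then have "finmod ?H ?E" using finmod_hom[OF q subgrp_gen HU] by simp
  then have f: "finmod ?H (?E \<inter> ?H)" by (rule finmod_Int[OF subgrp_gen subgrp_gen subset_refl])
  show ?thesis
  proof (rule finite_gen_extension[OF S(1) subgrp_Int[OF subgrp_gen subgrp_gen] _ f])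
    fix Y assume Y: "finite Y" "Y \<subseteq> ?E \<inter> ?H"
    then obtain S0 where "finite S0" "S0 \<subseteq> T \<inter> A" "Y \<subseteq> gen S0"
      using finite_subset_gen[of Y "T \<inter> A"] by auto
    then show "finite (gen Y)" using fin[of S0] finite_subset[OF gen_mono'] by blast
  qed simp
qed

section \<open>The Hirsch-Plotkin radical\<close>

lemma nsubgrp_gen_Un:
  assumes "\<And>g. g \<in> M \<union> N \<Longrightarrow> normalizes g M" "subgrp M"
  shows "nsubgrp M (gen (M \<union> N))"
  by (rule nsubgrpI[OF assms(2)]) (use gen_incl'[of "M \<union> N"] assms in \<open>auto intro: normalizes_gen[of "M \<union> N"]\<close>)

text \<open>\<open>L k\<close> is generated by the intersections of an \<open>i\<close>-th term for
  \<open>M\<close> with a \<open>(k - i)\<close>-th term for \<open>N\<close>. Commuting with an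
  element of \<open>M\<close> raises the first index, with one of \<open>N\<close> the second, so
  the lower central series runs below \<open>L\<close>; for large \<open>k\<close> one of the two
  indices is always past the end.\<close>

theorem fitting:
  fixes M N :: "'g::group_add set"
  assumes M: "subgrp M" "\<And>g. g \<in> M \<union> N \<Longrightarrow> normalizes g M" "lcs c M = {0}"
    and N: "subgrp N" "\<And>g. g \<in> M \<union> N \<Longrightarrow> normalizes g N" "lcs d N = {0}"
  shows "\<exists>e. lcs e (gen (M \<union> N)) = {0}"
proof -
  let ?G = "gen (M \<union> N)"
  have G: "subgrp ?G" by (rule subgrp_gen)
  have MG: "nsubgrp M ?G" by (rule nsubgrp_gen_Un) (use M in auto)
  have NG: "nsubgrp N ?G" using nsubgrp_gen_Un[of N M] N by (auto simp: Un_commute)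
  \<comment> \<open>Index \<open>0\<close> stands for the whole group and the series of
    \<open>M\<close> starts at \<open>1\<close>, so that \<open>a (Suc c)\<close> is trivial. This
    shift makes \<open>Suc c + Suc d\<close> the final level.\<close>
  define a where "a i = (case i of 0 \<Rightarrow> ?G | Suc k \<Rightarrow> lcs k M)" for i
  define b where "b i = (case i of 0 \<Rightarrow> ?G | Suc k \<Rightarrow> lcs k N)" for i
  define L where "L k = gen (\<Union>i \<le> k. a i \<inter> b (k - i))" for k
  have "lcs j M \<subseteq> ?G" "lcs j N \<subseteq> ?G" for j
    using nsubgrpD(2)[OF MG] nsubgrpD(2)[OF NG] lcs_antimono[OF M(1), of 0 j] lcs_antimono[OF N(1), of 0 j] by auto
  note sub = this
  have an: "nsubgrp (a i) ?G" for i
    using nsubgrp_refl[OF G] nsubgrpD[OF MG]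
    by (cases i) (auto simp: a_def intro!: nsubgrpI subgrp_lcs normalizes_lcs intro: sub(1)[THEN subsetD])
  have bn: "nsubgrp (b i) ?G" for i
    using nsubgrp_refl[OF G] nsubgrpD[OF NG]
    by (cases i) (auto simp: b_def intro!: nsubgrpI subgrp_lcs normalizes_lcs intro: sub(2)[THEN subsetD])
  have as: "comm x y \<in> a (Suc i)" if "x \<in> a i" "y \<in> M" for x y i
    using that nsubgrpD(6)[OF MG, of x y] by (cases i) (auto simp: a_def intro: gen_incl)
  have bs: "comm x y \<in> b (Suc i)" if "x \<in> b i" "y \<in> N" for x y i
    using that nsubgrpD(6)[OF NG, of x y] by (cases i) (auto simp: b_def intro: gen_incl)
  have Ln: "normalizes g (L k)" if "g \<in> ?G" for g k
    unfolding L_def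
  proof (rule normalizes_gen_set)
    have "normalizes g (a i \<inter> b (k - i))" for i
      using nsubgrpD(3)[OF an that] nsubgrpD(3)[OF bn that] by (rule normalizes_Int)
    then show "normalizes g (\<Union>i \<le> k. a i \<inter> b (k - i))"
      unfolding normalizes_def by blast
  qed
  have LG: "L k \<subseteq> ?G" for k
    unfolding L_def by (rule gen_least[OF _ G]) (use nsubgrpD(2)[OF an] in blast)
  have gens: "comm x y \<in> L (Suc k)" if x: "x \<in> a i" "x \<in> b (k - i)" "i \<le> k" and "y \<in> M \<union> N" for x y i k
  proof -
    have y: "y \<in> ?G" using that(4) by (rule gen_incl)
    have "comm x y \<in> a (Suc i) \<inter> b (Suc k - Suc i) \<or> comm x y \<in> a i \<inter> b (Suc k - i)"
      using that as bs[of x "k - i" y] nsubgrpD(5)[OF an y] nsubgrpD(5)[OF bn y]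
      by (auto simp: Suc_diff_le)
    then show ?thesis unfolding L_def using x(3)
      by (elim disjE) (rule gen_incl, rule UN_I[of "Suc i"], simp, assumption,
        rule gen_incl, rule UN_I[of i], simp, assumption)
  qed
  have step: "comm x y \<in> L (Suc k)" if x: "x \<in> L k" and y: "y \<in> ?G" for x y k
  proof -
    have 1: "comm x y \<in> L (Suc k)" if "x \<in> (\<Union>i \<le> k. a i \<inter> b (k - i))" for x
      by (rule comm_gen_mem[OF _ _ _ y]) (use that gens Ln in \<open>auto simp: L_def subgrp_gen\<close>)
    \<comment> \<open>\<open>comm_gen_mem\<close> extends only the second argument from generators
      to the group; swapping the commutator extends the first one too.\<close>
    have "comm y x \<in> L (Suc k)"
    proof (rule comm_gen_mem[of _ "\<Union>i \<le> k. a i \<inter> b (k - i)"])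
      show "subgrp (L (Suc k))" by (simp add: L_def subgrp_gen)
      show "x \<in> gen (\<Union>i \<le> k. a i \<inter> b (k - i))" using x by (simp add: L_def)
      show "normalizes u (L (Suc k))" if "u \<in> gen (\<Union>i \<le> k. a i \<inter> b (k - i))" for u
        using that Ln LG[of k] by (auto simp: L_def)
      fix s assume "s \<in> (\<Union>i \<le> k. a i \<inter> b (k - i))"
      then have "- comm s y \<in> L (Suc k)" using 1 by (simp add: L_def gen_uminus)
      then show "comm y s \<in> L (Suc k)" by (simp add: comm_swap[of s])
    qed
    then have "- comm y x \<in> L (Suc k)" by (simp add: L_def gen_uminus)
    then show ?thesis by (simp add: comm_swap[of y])
  qed
  have "lcs k ?G \<subseteq> L k" for k
  proof (rule lcs_le_chain[of _ L])
    show "comm x y \<in> L (Suc k)" if "x \<in> L k" "y \<in> ?G" for x y k using that by (rule step)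
    show "?G \<subseteq> L 0" by (auto simp: L_def a_def b_def intro: gen_incl)
  qed (simp_all add: L_def subgrp_gen)
  moreover have "L (Suc c + Suc d) \<subseteq> {0}"
    unfolding L_def
  proof (rule gen_least[OF _ subgrp_zero], rule UN_least)
    fix i assume i: "i \<in> {..Suc c + Suc d}"
    show "a i \<inter> b (Suc c + Suc d - i) \<subseteq> {0}"
    proof (cases "Suc c \<le> i")
      case True
      then obtain k where "i = Suc k" "c \<le> k" by (metis Suc_le_D Suc_le_mono)
      then show ?thesis using lcs_antimono[OF M(1), of c k] M(3) by (auto simp: a_def)
    next
      case False
      then have "Suc d \<le> Suc c + Suc d - i" by simp
      then obtain k where "Suc c + Suc d - i = Suc k" "d \<le> k" by (metis Suc_le_D Suc_le_mono)
      then show ?thesis using lcs_antimono[OF N(1), of d k] N(3) by (auto simp: b_def)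
    qed
  qed
  ultimately have "lcs (Suc c + Suc d) ?G \<subseteq> {0}" by blast
  then have "lcs (Suc c + Suc d) ?G = {0}" using subgrpD(1)[OF subgrp_lcs[OF G]] by blast
  then show ?thesis by blast
qed

text \<open>\<open>D\<close> collects the iterated commutators of \<open>C\<close> with elements of
  \<open>X\<close>. By nilpotence they are trivial from length \<open>c\<close> on, so
  \<open>D\<close> is finite, and \<open>conjg x a = a + comm a x\<close> stays in
  \<open>gen D\<close>. The last clause is how \<open>D\<close> is located inside other
  sets.\<close>

lemma nilpotent_closure:
  assumes "finite X" "finite C" "\<And>x. x \<in> X \<Longrightarrow> - x \<in> X" "lcs c (gen (X \<union> C)) = {0}"
  obtains D where "finite D" "C \<subseteq> D" "\<And>x. x \<in> X \<Longrightarrow> normalizes x (gen D)"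
    "\<And>P. C \<subseteq> P \<Longrightarrow> (\<And>a x. a \<in> P \<Longrightarrow> x \<in> X \<Longrightarrow> comm a x \<in> P) \<Longrightarrow> D \<subseteq> P"
proof -
  define f where "f A = (\<lambda>(a, x). comm a x) ` (A \<times> X)" for A
  define D where "D = (\<Union>k \<le> c. (f ^^ k) C)"
  have fin: "finite ((f ^^ k) C)" for k
    by (induction k) (auto simp: f_def assms(1,2))
  have l: "(f ^^ k) C \<subseteq> lcs k (gen (X \<union> C))" for k
  proof (induction k)
    case (Suc k)
    show ?case
    proof
      fix z assume "z \<in> (f ^^ Suc k) C"
      then obtain a x where z: "z = comm a x" "a \<in> (f ^^ k) C" "x \<in> X" by (auto simp: f_def)
      then have "x \<in> gen (X \<union> C)" by (simp add: gen_incl)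
      then show "z \<in> lcs (Suc k) (gen (X \<union> C))" using z Suc comm_lcs by blast
    qed
  qed (auto intro: gen_incl)
  have conj: "conjg x a \<in> gen D" if a: "a \<in> D" "x \<in> X" for a x
  proof -
    obtain k where k: "k \<le> c" "a \<in> (f ^^ k) C" using a by (auto simp: D_def)
    show ?thesis
    proof (cases "k = c")
      case True
      then have "a = 0" using k l[of c] assms(4) by auto
      then show ?thesis by (simp add: gen.zero)
    next
      case False
      have "comm a x \<in> (f ^^ Suc k) C" using k a by (auto simp: f_def)
      then have "comm a x \<in> D" using False k(1) unfolding D_def by (intro UN_I[of "Suc k"]) auto
      then show ?thesis using a by (simp add: conjg_conv_comm gen_plus gen_incl)
    qed
  qed
  show thesis
  proof (rule that)
    show "finite D" using fin by (simp add: D_def)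
    have "(f ^^ 0) C \<subseteq> D" unfolding D_def by (rule UN_upper) simp
    then show "C \<subseteq> D" by simp
    show "normalizes x (gen D)" if "x \<in> X" for x
      by (rule normalizes_genI) (use conj that assms(3) in auto)
    show "D \<subseteq> P" if "C \<subseteq> P" "\<And>a x. a \<in> P \<Longrightarrow> x \<in> X \<Longrightarrow> comm a x \<in> P" for P
    proof -
      have "(f ^^ k) C \<subseteq> P" for k
        by (induction k) (use that in \<open>auto simp: f_def\<close>)
      then show ?thesis by (auto simp: D_def)
    qed
  qed
qed

lemma lnil_mono: "lnil H \<Longrightarrow> K \<subseteq> H \<Longrightarrow> lnil K"
  by (auto simp: lnil_def)

lemma nilpotent_imp_lnil:
  assumes "subgrp H" "lcs c H = {0}" shows "lnil H"
  unfolding lnil_def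
proof (intro allI impI)
  fix S assume "finite S \<and> S \<subseteq> H"
  then have "gen S \<subseteq> H" using assms(1) gen_least by blast
  then have "lcs c (gen S) \<subseteq> {0}" using lcs_mono assms(2) by metis
  then have "lcs c (gen S) = {0}" by (rule lcs_gen_zeroI)
  then show "\<exists>c. lcs c (gen S) = {0}" by blast
qed

text \<open>The commutators of \<open>X\<close> with \<open>Y\<close> lie in
  \<open>H \<inter> K\<close>. Local nilpotence of \<open>K\<close> gives them a finite closure
  \<open>D\<close> under \<open>Y\<close>, still inside \<open>H \<inter> K\<close>. Then
  \<open>M = gen (X \<union> D)\<close> is finitely generated in \<open>H\<close>, hence nilpotent,
  and \<open>Y\<close> normalizes it. Exchanging the roles gives the second subgroup needed for
  \<open>fitting\<close>.\<close>

lemma hirsch_plotkin_half: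
  assumes H: "subgrp H" "lnil H" "\<And>g. g \<in> K \<Longrightarrow> normalizes g H"
    and K: "subgrp K" "lnil K" "\<And>g. g \<in> H \<Longrightarrow> normalizes g K"
    and X: "finite X" "X \<subseteq> H" "\<And>x. x \<in> X \<Longrightarrow> - x \<in> X"
    and Y: "finite Y" "Y \<subseteq> K" "\<And>y. y \<in> Y \<Longrightarrow> - y \<in> Y"
  obtains M c where "subgrp M" "X \<subseteq> M" "M \<subseteq> gen (X \<union> Y)" "\<And>g. g \<in> X \<union> Y \<Longrightarrow> normalizes g M" "lcs c M = {0}"
proof -
  define C where "C = (\<lambda>(x, y). comm x y) ` (X \<times> Y)"
  have cHK: "comm a y \<in> H \<inter> K" if "a \<in> H" "y \<in> K" for a y
  proof -
    have "- a + conjg y a \<in> H" "- conjg a y + y \<in> K"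
      using that H(1,3) K(1,3) by (auto simp: normalizes_def subgrpD)
    then show ?thesis using comm_conv_conjg[of a y] by simp
  qed
  have CHK: "C \<subseteq> H \<inter> K"
  proof
    fix z assume "z \<in> C"
    then obtain x y where "z = comm x y" "x \<in> X" "y \<in> Y" by (auto simp: C_def)
    then show "z \<in> H \<inter> K" using cHK[of x y] X(2) Y(2) by auto
  qed
  have fin: "finite C" using X Y by (simp add: C_def)
  have "finite (Y \<union> C) \<and> Y \<union> C \<subseteq> K" using Y CHK fin by blast
  then obtain c where "lcs c (gen (Y \<union> C)) = {0}" using K(2) unfolding lnil_def by blast
  from nilpotent_closure[OF Y(1) fin Y(3) this] obtain D where D: "finite D" "C \<subseteq> D"
    "\<And>y. y \<in> Y \<Longrightarrow> normalizes y (gen D)"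
    "\<And>P. C \<subseteq> P \<Longrightarrow> (\<And>a x. a \<in> P \<Longrightarrow> x \<in> Y \<Longrightarrow> comm a x \<in> P) \<Longrightarrow> D \<subseteq> P" by blast
  have DHK: "D \<subseteq> H \<inter> K"
    by (rule D(4)[OF CHK]) (use cHK subsetD[OF Y(2)] in auto)
  have sg: "subgrp (gen (X \<union> Y))" by (rule subgrp_gen)
  have XYi: "X \<subseteq> gen (X \<union> Y)" "Y \<subseteq> gen (X \<union> Y)" by (auto intro: gen_incl)
  have "C \<subseteq> gen (X \<union> Y)"
  proof
    fix z assume "z \<in> C"
    then obtain x y where "z = comm x y" "x \<in> X" "y \<in> Y" by (auto simp: C_def)
    then show "z \<in> gen (X \<union> Y)" using subgrp_comm[OF sg, of x y] XYi by auto
  qed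
  then have DXY: "D \<subseteq> gen (X \<union> Y)"
    by (rule D(4)) (use subsetD[OF XYi(2)] subgrp_comm[OF sg] in auto)
  let ?M = "gen (X \<union> D)"
  have "finite (X \<union> D) \<and> X \<union> D \<subseteq> H" using X D(1) DHK by blast
  then obtain e where e: "lcs e ?M = {0}" using H(2) unfolding lnil_def by blast
  have conj: "conjg y s \<in> ?M" if "y \<in> Y" "s \<in> X \<union> D" for y s
  proof (cases "s \<in> D")
    case True
    then have "conjg y s \<in> gen D" using D(3)[OF that(1)] by (simp add: normalizes_def gen_incl)
    then show ?thesis using gen_mono[of D "X \<union> D"] by blast
  next
    case False
    then have "comm s y \<in> D" using that D(2) by (auto simp: C_def)
    then show ?thesis using that by (simp add: conjg_conv_comm gen_plus gen_incl)
  qed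
  show thesis
  proof (rule that[OF subgrp_gen _ _ _ e])
    show "X \<subseteq> ?M" by (auto intro: gen_incl)
    show "?M \<subseteq> gen (X \<union> Y)" using XYi DXY by (intro gen_mono') auto
    fix g assume "g \<in> X \<union> Y"
    then show "normalizes g ?M"
    proof
      assume "g \<in> X"
      then show ?thesis by (intro normalizes_subgrp[OF subgrp_gen] gen_incl) simp
    next
      assume "g \<in> Y"
      then show ?thesis using conj Y(3) by (intro normalizes_genI) auto
    qed
  qed
qed

theorem hirsch_plotkin:
  assumes H: "subgrp H" "lnil H" "\<And>g. g \<in> K \<Longrightarrow> normalizes g H"
    and K: "subgrp K" "lnil K" "\<And>g. g \<in> H \<Longrightarrow> normalizes g K"
  shows "lnil (gen (H \<union> K))"
  unfolding lnil_def
proof (intro allI impI)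
  fix S assume "finite S \<and> S \<subseteq> gen (H \<union> K)"
  then obtain S0 where S0: "finite S0" "S0 \<subseteq> H \<union> K" "S \<subseteq> gen S0" using finite_subset_gen by metis
  define X where "X = (S0 \<inter> H) \<union> uminus ` (S0 \<inter> H)"
  define Y where "Y = (S0 \<inter> K) \<union> uminus ` (S0 \<inter> K)"
  have X: "finite X" "X \<subseteq> H" "\<And>x. x \<in> X \<Longrightarrow> - x \<in> X"
    using S0(1) H(1) by (auto simp: X_def intro: subgrpD)
  have Y: "finite Y" "Y \<subseteq> K" "\<And>x. x \<in> Y \<Longrightarrow> - x \<in> Y"
    using S0(1) K(1) by (auto simp: Y_def intro: subgrpD)
  have "S0 \<subseteq> X \<union> Y" using S0(2) by (auto simp: X_def Y_def)
  then have S: "gen S \<subseteq> gen (X \<union> Y)" using gen_mono'[OF S0(3)] gen_mono by blast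
  obtain M c where M: "subgrp M" "X \<subseteq> M" "M \<subseteq> gen (X \<union> Y)" "\<And>g. g \<in> X \<union> Y \<Longrightarrow> normalizes g M" "lcs c M = {0}"
    using hirsch_plotkin_half[OF H K X Y] by blast
  obtain N d where N: "subgrp N" "Y \<subseteq> N" "N \<subseteq> gen (Y \<union> X)" "\<And>g. g \<in> Y \<union> X \<Longrightarrow> normalizes g N" "lcs d N = {0}"
    using hirsch_plotkin_half[OF K H Y X] by blast
  have MN: "M \<union> N \<subseteq> gen (X \<union> Y)" using M(3) N(3) by (simp add: Un_commute)
  have "\<exists>e. lcs e (gen (M \<union> N)) = {0}"
  proof (rule fitting[OF M(1) _ M(5) N(1) _ N(5)])
    show "normalizes g M" if "g \<in> M \<union> N" for g
      using normalizes_gen[of "X \<union> Y" M] M(4) MN that by blast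
    show "normalizes g N" if "g \<in> M \<union> N" for g
      using normalizes_gen[of "X \<union> Y" N] N(4) MN that by blast
  qed
  moreover have "gen S \<subseteq> gen (M \<union> N)" using S gen_mono[of "X \<union> Y" "M \<union> N"] M(2) N(2) by blast
  ultimately obtain e where "lcs e (gen S) \<subseteq> {0}" using lcs_mono by metis
  then have "lcs e (gen S) = {0}" by (rule lcs_gen_zeroI)
  then show "\<exists>c. lcs c (gen S) = {0}" by blast
qed

section \<open>The radical and its behaviour under subnormality\<close>

definition hp :: "'g::group_add set \<Rightarrow> 'g set" where
  "hp B = \<Union> {N. nsubgrp N B \<and> lnil N}"

lemma lnil_zero: "lnil {0}"
  by (rule nilpotent_imp_lnil[OF subgrp_zero, of 0]) simp

lemma nsubgrp_lnil_join:
  assumes "nsubgrp M B" "lnil M" "nsubgrp N B" "lnil N" "subgrp B"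
  shows "nsubgrp (gen (M \<union> N)) B \<and> lnil (gen (M \<union> N))"
proof
  note M = nsubgrpD[OF assms(1)] and N = nsubgrpD[OF assms(3)]
  show "nsubgrp (gen (M \<union> N)) B"
    by (intro nsubgrpI subgrp_gen gen_least normalizes_gen_set normalizes_Un) (use M N assms(5) in auto)
  show "lnil (gen (M \<union> N))"
    by (rule hirsch_plotkin) (use M N assms(2,4) in auto)
qed

text \<open>The locally nilpotent normal subgroups form a directed family by
  \<open>nsubgrp_lnil_join\<close>. Both local nilpotence of the union and its being a subgroup
  follow from this.\<close>

lemma hp_finite:
  assumes "subgrp B" "finite S" "S \<subseteq> hp B"
  shows "\<exists>N. nsubgrp N B \<and> lnil N \<and> S \<subseteq> N"
  using assms(2,3)
proof (induction rule: finite_induct)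
  case empty
  have "nsubgrp {0} B" using assms(1) by (auto simp: nsubgrp_def subgrp_zero normalizes_def subgrpD)
  then show ?case using lnil_zero by blast
next
  case (insert x S)
  then obtain M N where "nsubgrp M B" "lnil M" "x \<in> M" "nsubgrp N B" "lnil N" "S \<subseteq> N"
    by (auto simp: hp_def)
  then have "nsubgrp (gen (M \<union> N)) B \<and> lnil (gen (M \<union> N)) \<and> insert x S \<subseteq> gen (M \<union> N)"
    using nsubgrp_lnil_join assms(1) gen_incl'[of "M \<union> N"] by blast
  then show ?case by blast
qed

lemma lnil_hp:
  assumes "subgrp B" shows "lnil (hp B)"
  unfolding lnil_def
proof (intro allI impI)
  fix S assume "finite S \<and> S \<subseteq> hp B"
  then obtain N where "lnil N" "S \<subseteq> N" "finite S" using hp_finite[OF assms] by blast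
  then show "\<exists>c. lcs c (gen S) = {0}" unfolding lnil_def by blast
qed

lemma subset_hp: "nsubgrp N B \<Longrightarrow> lnil N \<Longrightarrow> N \<subseteq> hp B"
  by (auto simp: hp_def)

lemma subgrp_hp:
  assumes "subgrp B" shows "subgrp (hp B)"
  unfolding subgrp_def
proof (intro conjI ballI)
  show "0 \<in> hp B" using hp_finite[OF assms, of "{}"] nsubgrpD(1) subgrpD(1) unfolding hp_def by blast
  fix x y assume "x \<in> hp B" "y \<in> hp B"
  then obtain N where "nsubgrp N B" "lnil N" "x \<in> N" "y \<in> N" using hp_finite[OF assms, of "{x, y}"] by auto
  then have "x + y \<in> N" "N \<subseteq> hp B" by (auto intro: subgrpD nsubgrpD(1) subset_hp[THEN subsetD])
  then show "x + y \<in> hp B" by blast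
next
  fix x assume "x \<in> hp B"
  then obtain N where "nsubgrp N B" "lnil N" "x \<in> N" by (auto simp: hp_def)
  then have "- x \<in> N" "N \<subseteq> hp B" by (auto intro: subgrpD nsubgrpD(1) subset_hp[THEN subsetD])
  then show "- x \<in> hp B" by blast
qed

lemma hp_subset: "hp B \<subseteq> B"
  by (auto simp: hp_def dest: nsubgrpD(2))

lemma lnil_conjg:
  assumes "lnil N" shows "lnil (conjg g ` N)"
  unfolding lnil_def
proof (intro allI impI)
  fix S assume "finite S \<and> S \<subseteq> conjg g ` N"
  then obtain S' where S': "finite S'" "S' \<subseteq> N" "S = conjg g ` S'" by (meson finite_subset_image)
  then obtain c where c: "lcs c (gen S') = {0}" using assms unfolding lnil_def by blast
  have "lcs c (gen S) = conjg g ` lcs c (gen S')"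
    using image_lcs[OF hom_on_conjg subgrp_gen subset_UNIV, of g c S'] image_gen[OF hom_on_conjg subset_UNIV, of g S']
    by (simp add: S'(3))
  then show "\<exists>c. lcs c (gen S) = {0}" using c by auto
qed

lemma normalizes_image: "normalizes g B \<Longrightarrow> conjg g ` B = B"
proof
  assume g: "normalizes g B"
  then show "conjg g ` B \<subseteq> B" by (auto simp: normalizes_def)
  show "B \<subseteq> conjg g ` B"
  proof
    fix x assume "x \<in> B"
    then have "conjg (- g) x \<in> B" using g by (simp add: normalizes_def)
    then show "x \<in> conjg g ` B" by (intro image_eqI[of _ _ "conjg (- g) x"]) simp_all
  qed
qed

lemma normalizes_hp:
  assumes "subgrp B" "normalizes g B" shows "normalizes g (hp B)"
proof -
  have "conjg g x \<in> hp B" if x: "x \<in> hp B" and g: "normalizes g B" for x g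
  proof -
    obtain N where N: "nsubgrp N B" "lnil N" "x \<in> N" using x by (auto simp: hp_def)
    have "nsubgrp (conjg g ` N) B"
      using nsubgrp_image[OF hom_on_conjg N(1) assms(1) subset_UNIV, of g] normalizes_image[OF g] by simp
    then show ?thesis using subset_hp lnil_conjg[OF N(2)] N(3) by blast
  qed
  then show ?thesis using assms(2) normalizes_uminus by (auto simp: normalizes_def)
qed

lemma nsubgrp_hp: "subgrp B \<Longrightarrow> nsubgrp (hp B) B"
  by (intro nsubgrpI subgrp_hp hp_subset normalizes_hp normalizes_subgrp)

text \<open>\<open>hp B\<close> is normalized by everything that normalizes \<open>B\<close>, hence
  is normal in \<open>C\<close>. Iterated along a subnormal chain, this puts every locally nilpotent
  subnormal subgroup into the radical.\<close>

lemma hp_normal_subset: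
  assumes "nsubgrp B C" shows "hp B \<subseteq> hp C"
proof (rule subset_hp)
  note B = nsubgrpD[OF assms]
  show "nsubgrp (hp B) C"
    by (intro nsubgrpI subgrp_hp B normalizes_hp) (use hp_subset B(2) in auto)
  show "lnil (hp B)" by (rule lnil_hp[OF B(1)])
qed

inductive subn :: "'g::group_add set \<Rightarrow> 'g set \<Rightarrow> bool" for A where
  refl: "subgrp A \<Longrightarrow> subn A A"
| step: "subn A B \<Longrightarrow> nsubgrp B C \<Longrightarrow> subgrp C \<Longrightarrow> subn A C"

lemma subn_subset_hp: "subn A B \<Longrightarrow> lnil A \<Longrightarrow> A \<subseteq> hp B"
proof (induction rule: subn.induct)
  case refl then show ?case using subset_hp nsubgrp_refl by blast
next
  case (step B C) then show ?case using hp_normal_subset[of B C] by blast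
qed

lemma subn_trans: "subn B C \<Longrightarrow> subn A B \<Longrightarrow> subn A C"
  by (induction rule: subn.induct) (auto intro: subn.intros)

lemma subn_chain:
  assumes "\<And>j. j < n \<Longrightarrow> nsubgrp (L j) (L (Suc j))" "\<And>j. subgrp (L j)"
  shows "subn (L 0) (L n)"
  using assms
proof (induction n)
  case 0 then show ?case by (auto intro: subn.refl)
next
  case (Suc n) then show ?case by (auto intro: subn.step)
qed

section \<open>Engel elements\<close>

definition engel :: "nat \<Rightarrow> 'g::group_add \<Rightarrow> 'g set \<Rightarrow> bool" where
  "engel n x D \<longleftrightarrow> x \<in> D \<and> (\<forall>g \<in> D. ((\<lambda>h. comm h x) ^^ n) g = 0)"

lemma engel_subset: "engel n x D \<Longrightarrow> E \<subseteq> D \<Longrightarrow> x \<in> E \<Longrightarrow> engel n x E"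
  by (auto simp: engel_def)

lemma funpow_comm_mem: "subgrp D \<Longrightarrow> x \<in> D \<Longrightarrow> g \<in> D \<Longrightarrow> ((\<lambda>h. comm h x) ^^ k) g \<in> D"
  by (induction k) (auto intro: subgrp_comm)

lemma engel_image:
  assumes "hom_on D f" "engel n x D" shows "engel n (f x) (f ` D)"
proof -
  have x: "x \<in> D" and D: "subgrp D" using assms(2) hom_onD(1)[OF assms(1)] by (simp_all add: engel_def)
  have "((\<lambda>h. comm h (f x)) ^^ k) (f g) = f (((\<lambda>h. comm h x) ^^ k) g)" if "g \<in> D" for g k
    by (induction k) (use that x D in \<open>auto simp: hom_onD(6)[OF assms(1)] funpow_comm_mem\<close>)
  then show ?thesis using assms(2) hom_onD(3)[OF assms(1)] by (auto simp: engel_def)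
qed

section \<open>Gruenberg's argument in soluble groups\<close>

lemma gen_singleton_lnil: "lnil (gen {x})"
proof (rule nilpotent_imp_lnil[OF subgrp_gen])
  have "gen {x} \<subseteq> {h. \<forall>z \<in> {x}. comm z h = 0}"
    by (rule gen_least[OF _ subgrp_centralizer]) (simp add: comm_def add.assoc)
  then have 1: "comm h x = 0" if "h \<in> gen {x}" for h using that comm_swap[of x h] by auto
  have "gen {x} \<subseteq> {h. \<forall>z \<in> gen {x}. comm z h = 0}"
    by (rule gen_least[OF _ subgrp_centralizer]) (use 1 in auto)
  then have "{comm y z |y z. y \<in> gen {x} \<and> z \<in> gen {x}} \<subseteq> {0}" by auto
  then have "lcs 1 (gen {x}) \<subseteq> {0}" using gen_least[OF _ subgrp_zero] by simp
  then show "lcs 1 (gen {x}) = {0}" by (rule lcs_gen_zeroI)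
qed

text \<open>Set \<open>A 0 = N\<close> and let \<open>A (Suc j)\<close> consist of the
  \<open>a\<close> in \<open>M\<close> with \<open>comm a x\<close> in \<open>A j\<close>; as
  \<open>M\<close> is abelian modulo \<open>N\<close>, these are subgroups. An element
  \<open>a\<close> of \<open>A (Suc j)\<close> moves \<open>x\<close> only by an element of
  \<open>A j\<close>, so the group generated by \<open>x\<close> and \<open>A j\<close> is normal in
  the next one.\<close>

lemma soluble_engel_step:
  assumes S: "subgrp S" "x \<in> S" and e: "engel n x S"
    and N: "nsubgrp N S" and M: "nsubgrp M S" and NM: "N \<subseteq> M" and ab: "\<And>a b. a \<in> M \<Longrightarrow> b \<in> M \<Longrightarrow> comm a b \<in> N"
  shows "subn (gen (insert x N)) (gen (insert x M))"
proof -
  note N' = nsubgrpD[OF N] and M' = nsubgrpD[OF M]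
  define A where "A = rec_nat N (\<lambda>_ B. {a \<in> M. comm a x \<in> B})"
  have A0: "A 0 = N" and AS: "A (Suc j) = {a \<in> M. comm a x \<in> A j}" for j by (auto simp: A_def)
  have NA: "N \<subseteq> A j \<and> A j \<subseteq> M" for j
    by (induction j) (use NM N'(5)[OF S(2)] in \<open>auto simp: A0 AS\<close>)
  have mono: "A j \<subseteq> A (Suc j)" for j
    by (induction j) (use NM N'(5)[OF S(2)] in \<open>auto simp: A0 AS\<close>)
  have sub: "subgrp (A j)" for j
  proof (induction j)
    case 0 then show ?case by (simp add: A0 N')
  next
    case (Suc j)
    have cj: "conjg b c \<in> A j" if "b \<in> M" "c \<in> A j" for b c
    proof -
      have "comm c b \<in> A j" using ab[of c b] that NA[of j] by blast
      then show ?thesis using that Suc by (simp add: conjg_conv_comm subgrpD)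
    qed
    show ?case unfolding subgrp_def AS
      using Suc M'(1) cj by (auto simp: subgrpD comm_add_left comm_uminus_left)
  qed
  have cx: "conjg g a \<in> A j" if "a \<in> A j" "g \<in> S" "comm g x = 0" for a j g
    using that(1)
  proof (induction j arbitrary: a)
    case 0 then show ?case using N'(4) that(2) by (simp add: A0)
  next
    case (Suc j)
    have "conjg g x = x" using that(3) by (simp add: conjg_conv_comm comm_swap[of g])
    then have "comm (conjg g a) x = conjg g (comm a x)" by (simp add: conjg_comm)
    then show ?case using Suc M'(4) that(2) by (simp add: AS)
  qed
  define L where "L j = gen (insert x (A j))" for j
  have "subn (L 0) (L n)"
  proof (rule subn_chain)
    show "subgrp (L j)" for j by (simp add: L_def subgrp_gen)
    fix j
    show "nsubgrp (L j) (L (Suc j))"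
    proof (rule nsubgrpI)
      show "subgrp (L j)" by (simp add: L_def subgrp_gen)
      show "L j \<subseteq> L (Suc j)" unfolding L_def using mono[of j] by (intro gen_mono) auto
      have ca: "conjg a s \<in> L j" if a: "a \<in> A (Suc j)" and s: "s \<in> insert x (A j)" for a s
      proof (cases "s = x")
        case True
        have "- comm a x \<in> A j" using a sub[of j] by (simp add: AS subgrpD)
        then show ?thesis unfolding L_def True conjg_conv_comm comm_swap[of a]
          by (intro gen_plus gen_incl) auto
      next
        case False
        then have "s \<in> A j" using s by simp
        moreover have "comm s a \<in> A j" using ab[of s a] a NA[of j] NA[of "Suc j"] \<open>s \<in> A j\<close> by blast
        ultimately show ?thesis unfolding L_def conjg_conv_comm
          by (intro gen_plus gen_incl) auto
      qed
      fix h assume "h \<in> L (Suc j)"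
      then have "h \<in> gen (insert x (A (Suc j)))" by (simp add: L_def)
      then show "normalizes h (L j)"
      proof (rule normalizes_gen[rotated], intro ballI)
        fix g assume "g \<in> insert x (A (Suc j))"
        then show "normalizes g (L j)"
        proof
          assume g: "g = x"
          have "x \<in> L j" by (simp add: L_def gen_incl)
          then show ?thesis unfolding g L_def by (intro normalizes_subgrp subgrp_gen)
        next
          assume g: "g \<in> A (Suc j)"
          then have "- g \<in> A (Suc j)" using sub by (simp add: subgrpD)
          then show ?thesis using ca g unfolding L_def by (intro normalizes_genI) auto
        qed
      qed
    qed
  qed
  \<comment> \<open>The uniform Engel bound makes the chain end after \<open>n\<close> steps, which
    gives subnormality.\<close>
  moreover have "A n = M"
  proof -
    have "((\<lambda>h. comm h x) ^^ k) a \<in> N \<Longrightarrow> a \<in> M \<Longrightarrow> a \<in> A k" for k a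
    proof (induction k arbitrary: a)
      case (Suc k)
      then show ?case using M'(5)[OF S(2)] funpow_swap1[of "\<lambda>h. comm h x" k a] by (simp add: AS)
    qed (simp add: A0)
    then show ?thesis using e M'(2) N'(1) NA[of n] by (auto simp: engel_def subgrpD)
  qed
  ultimately show ?thesis by (simp add: L_def A0)
qed

text \<open>Going down the derived series, \<open>x\<close> together with each derived term
  generates a subnormal subgroup. At the trivial term this is the cyclic group of \<open>x\<close>,
  which is locally nilpotent and so lies in the radical.\<close>

theorem soluble_engel:
  assumes S: "subgrp S" and e: "engel n x S" and d: "ders d S = {0}"
  shows "x \<in> hp S"
proof -
  have x: "x \<in> S" using e by (simp add: engel_def)
  have 1: "subn (gen (insert x (ders i S))) S" for i
  proof (induction i)
    case 0
    have "insert x S = S" using x by blast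
    then show ?case using S by (simp add: gen_subgrp subn.refl)
  next
    case (Suc i)
    have "subn (gen (insert x (ders (Suc i) S))) (gen (insert x (ders i S)))"
      by (rule soluble_engel_step[OF S x e nsubgrp_ders[OF S] nsubgrp_ders[OF S] ders_decreasing[OF S]])
        (auto intro: gen_incl)
    then show ?case using Suc by (rule subn_trans[rotated])
  qed
  have "gen (insert x {0}) \<subseteq> gen {x}" by (rule gen_mono') (auto intro: gen_incl gen.zero)
  then have "lnil (gen (insert x {0}))" using lnil_mono gen_singleton_lnil by blast
  moreover have "subn (gen (insert x {0})) S" using 1[of d] d by simp
  ultimately show ?thesis using subn_subset_hp gen_incl by blast
qed

section \<open>Adjoining one Engel element to a locally nilpotent group\<close>

lemma comm_gen_insert:
  assumes R: "subgrp R" "normalizes y R"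
  shows "nsubgrp R (gen (insert y R))" "ders 1 (gen (insert y R)) \<subseteq> R"
proof -
  let ?B = "gen (insert y R)"
  have n: "normalizes h R" if "h \<in> ?B" for h
    by (rule normalizes_gen[OF _ that]) (use R normalizes_subgrp in auto)
  show RB: "nsubgrp R ?B"
    by (rule nsubgrpI[OF R(1) _ n]) (auto intro: gen_incl)
  note B = nsubgrpD[OF RB]
  have 1: "comm a b \<in> R" if m: "a \<in> insert y R" "b \<in> insert y R" for a b
  proof -
    have ab: "a \<in> ?B" "b \<in> ?B" using m by (auto intro: gen_incl)
    consider "a \<in> R" | "b \<in> R" | "a = b" using m by blast
    then show ?thesis
    proof cases
      case 3 then show ?thesis using R(1) by (simp add: comm_def add.assoc subgrpD)
    qed (use B(5,6) ab in auto)
  qed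
  have 2: "comm a b \<in> R" if "a \<in> insert y R" "b \<in> ?B" for a b
    by (rule comm_gen_mem[OF R(1) n _ that(2)]) (use 1 that in auto)
  have 3: "comm b a \<in> R" if "a \<in> insert y R" "b \<in> ?B" for a b
    unfolding comm_swap[of b a] by (rule subgrpD(3)[OF R(1) 2[OF that]])
  have 4: "comm b a \<in> R" if "a \<in> ?B" "b \<in> ?B" for a b
    by (rule comm_gen_mem[OF R(1) n _ that(1)]) (use 3 that in auto)
  show "ders 1 ?B \<subseteq> R" using 4 by (auto intro!: gen_least[OF _ R(1)])
qed

text \<open>The quotient by \<open>Q\<close> is cyclic and \<open>Q\<close> is nilpotent, so the
  group is soluble and \<open>soluble_engel\<close> puts \<open>y\<close> into the radical;
  \<open>Q\<close> lies there as a nilpotent normal subgroup.\<close>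

lemma lnil_insert_nilpotent:
  assumes Q: "subgrp Q" "lcs c Q = {0}" "normalizes y Q" and e: "engel n y (gen (insert y Q))"
  shows "lnil (gen (insert y Q))"
proof -
  let ?B = "gen (insert y Q)"
  note B = comm_gen_insert[OF Q(1,3)]
  have "ders (c + 1) ?B \<subseteq> lcs c Q"
    using ders_mono[OF B(2), of c] ders_subset_lcs[OF Q(1), of c] unfolding ders_add by (rule order_trans)
  then have "ders (c + 1) ?B = {0}" using Q(2) subgrpD(1)[OF subgrp_ders[OF subgrp_gen]] by blast
  then have "y \<in> hp ?B" using soluble_engel[OF subgrp_gen e] by blast
  moreover have "Q \<subseteq> hp ?B" using subset_hp[OF B(1)] nilpotent_imp_lnil Q by blast
  ultimately have "?B \<subseteq> hp ?B" using gen_least[OF _ subgrp_hp[OF subgrp_gen]] by blast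
  then show ?thesis using lnil_mono lnil_hp subgrp_gen by blast
qed

text \<open>The Engel identity stops the iterated commutators with \<open>y\<close> after
  \<open>n\<close> steps, so \<open>Z\<close> stays finite. Since \<open>- y\<close> is not assumed
  to be Engel, invariance under it needs an argument of its own. The last clause locates
  \<open>Z\<close> in any subgroup that contains \<open>Y\<close> and is normalized by
  \<open>y\<close>.\<close>

lemma engel_finite_closure:
  assumes "finite Y" and e: "\<And>g. g \<in> Y \<Longrightarrow> ((\<lambda>h. comm h y) ^^ n) g = 0"
  obtains Z where "finite Z" "Y \<subseteq> Z" "normalizes y (gen Z)"
    "\<And>P. Y \<subseteq> P \<Longrightarrow> (\<And>a. a \<in> P \<Longrightarrow> comm a y \<in> P) \<Longrightarrow> Z \<subseteq> P"
proof -
  let ?f = "\<lambda>h. comm h y"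
  define Z where "Z = (\<Union>k \<le> n. (?f ^^ k) ` Y)"
  have c1: "?f z \<in> Z \<or> ?f z = 0" if z: "z \<in> Z" for z
  proof -
    obtain k g where k: "k \<le> n" "z = (?f ^^ k) g" "g \<in> Y" using z by (auto simp: Z_def)
    show ?thesis
    proof (cases "k = n")
      case True then show ?thesis using e k by simp
    next
      case False
      then have "?f z = (?f ^^ Suc k) g" "Suc k \<le> n" using k by auto
      then have "?f z \<in> Z" using imageI[OF k(3), of "?f ^^ Suc k"]
        unfolding Z_def by (intro UN_I[of "Suc k"]) simp_all
      then show ?thesis ..
    qed
  qed
  have cy: "conjg y z \<in> gen Z" if "z \<in> Z" for z
    using c1[OF that] that by (auto simp: conjg_conv_comm intro: gen_plus gen_incl)
  \<comment> \<open>The generators \<open>[g,\<^sub>k y]\<close> are reached from the trivial one \<open>[g,\<^sub>n y]\<close> by descending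
    on \<open>k\<close>, so that conjugation by \<open>y\<close> is surjective on the subgroup they generate.\<close>
  have cm: "conjg (- y) ((?f ^^ (n - k)) g) \<in> gen Z" if g: "g \<in> Y" and "k \<le> n" for k g
    using that(2)
  proof (induction k)
    case 0 then show ?case using e[OF g] by (simp add: gen.zero)
  next
    case (Suc k)
    let ?z = "(?f ^^ (n - Suc k)) g"
    have z: "?f ?z = (?f ^^ (n - k)) g" using Suc.prems by (metis Suc_diff_Suc Suc_le_lessD funpow.simps(2) o_apply)
    have "?z = conjg (- y) (conjg y ?z)" by simp
    also have "\<dots> = conjg (- y) ?z + conjg (- y) (?f ?z)" by (simp only: conjg_conv_comm[of y] conjg_plus)
    finally have "conjg (- y) ?z = ?z + - conjg (- y) (?f ?z)" by (metis add.assoc add_0_right right_minus)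
    moreover have "?z \<in> Z" unfolding Z_def using g by (intro UN_I[of "n - Suc k"] imageI) auto
    ultimately show ?case using Suc z by (auto intro: gen_plus gen_incl gen_uminus)
  qed
  show thesis
  proof (rule that)
    show "finite Z" using assms(1) by (simp add: Z_def)
    have "(?f ^^ 0) ` Y \<subseteq> Z" unfolding Z_def by (rule UN_upper) simp
    then show "Y \<subseteq> Z" by simp
    show "normalizes y (gen Z)"
    proof (rule normalizes_genI)
      show "conjg (- y) s \<in> gen Z" if s: "s \<in> Z" for s
      proof -
        obtain k g where "k \<le> n" "s = (?f ^^ k) g" "g \<in> Y" using s by (auto simp: Z_def)
        then show ?thesis using cm[of g "n - k"] by simp
      qed
    qed (rule cy)
    show "Z \<subseteq> P" if "Y \<subseteq> P" "\<And>a. a \<in> P \<Longrightarrow> comm a y \<in> P" for P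
    proof -
      have "(?f ^^ k) g \<in> P" if "g \<in> P" for k g
        by (induction k) (use that \<open>\<And>a. a \<in> P \<Longrightarrow> comm a y \<in> P\<close> in auto)
      then show ?thesis using that(1) by (auto simp: Z_def)
    qed
  qed
qed

text \<open>Reduces to nilpotent \<open>R\<close>: the part of a finite set that lies in
  \<open>R\<close> is enclosed in a finitely generated, hence nilpotent, subgroup of
  \<open>R\<close> that \<open>y\<close> normalizes.\<close>

theorem lnil_insert_engel:
  assumes R: "subgrp R" "lnil R" "normalizes y R" and e: "engel n y (gen (insert y R))"
  shows "lnil (gen (insert y R))"
  unfolding lnil_def
proof (intro allI impI)
  fix S assume "finite S \<and> S \<subseteq> gen (insert y R)"
  then obtain S0 where S0: "finite S0" "S0 \<subseteq> insert y R" "S \<subseteq> gen S0" using finite_subset_gen by metis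
  define Y where "Y = S0 \<inter> R"
  have Y: "finite Y" "Y \<subseteq> R" using S0 by (auto simp: Y_def)
  have "((\<lambda>h. comm h y) ^^ n) g = 0" if "g \<in> Y" for g
    using e that Y(2) gen_incl[of g "insert y R"] by (auto simp: engel_def)
  from engel_finite_closure[OF Y(1) this] obtain Z where Z: "finite Z" "Y \<subseteq> Z" "normalizes y (gen Z)"
    "\<And>P. Y \<subseteq> P \<Longrightarrow> (\<And>a. a \<in> P \<Longrightarrow> comm a y \<in> P) \<Longrightarrow> Z \<subseteq> P" by blast
  have ZR: "Z \<subseteq> R"
  proof (rule Z(4)[OF Y(2)])
    fix a assume "a \<in> R"
    then show "comm a y \<in> R" using R(1,3) by (simp add: comm_conv_conjg(1) normalizes_def subgrpD)
  qed
  then obtain c where c: "lcs c (gen Z) = {0}" using R(2) Z(1) unfolding lnil_def by blast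
  have sub: "gen (insert y (gen Z)) \<subseteq> gen (insert y R)"
    using gen_least[OF ZR R(1)] by (intro gen_mono) auto
  have "engel n y (gen (insert y (gen Z)))"
    by (rule engel_subset[OF e sub]) (simp add: gen_incl)
  then have l: "lnil (gen (insert y (gen Z)))" by (rule lnil_insert_nilpotent[OF subgrp_gen c Z(3)])
  have "S0 \<subseteq> gen (insert y (gen Z))"
  proof
    fix s assume "s \<in> S0"
    then have "s \<in> insert y Z" using S0(2) Z(2) by (auto simp: Y_def)
    then have "s \<in> insert y (gen Z)" using gen_incl'[of Z] by blast
    then show "s \<in> gen (insert y (gen Z))" by (rule gen_incl)
  qed
  then have "gen S \<subseteq> gen (insert y (gen Z))" using gen_mono'[OF S0(3)] gen_mono' by blast
  then have "S \<subseteq> gen (insert y (gen Z))" using gen_incl' by blast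
  then show "\<exists>c. lcs c (gen S) = {0}" using l \<open>finite S \<and> _\<close> unfolding lnil_def by blast
qed

section \<open>Baer's theorem for finite groups\<close>

lemma normalizer_grows:
  assumes P: "subgrp P" "lcs c P = {0}" and X: "\<And>g. g \<in> P \<Longrightarrow> normalizes g X"
    and J: "J \<subseteq> X \<inter> P" "\<not> X \<inter> P \<subseteq> gen J"
  shows "\<exists>x \<in> X \<inter> P. x \<notin> gen J \<and> normalizes x (gen J)"
proof -
  \<comment> \<open>\<open>L\<close> descends from above \<open>P\<close> to \<open>gen J\<close>.
    At the last \<open>k\<close> where \<open>X \<inter> L k\<close> escapes \<open>gen J\<close>,
    any escaping \<open>x\<close> normalizes \<open>L (Suc k)\<close>, and as \<open>X\<close> is
    invariant under \<open>P\<close> also \<open>gen (X \<inter> L (Suc k)) = gen J\<close>. So the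
    normalizing element can be found in \<open>X\<close>.\<close>
  define L where "L k = gen (J \<union> lcs k P)" for k
  have "P \<subseteq> L 0" by (auto simp: L_def intro: gen_incl)
  then have "\<not> X \<inter> L 0 \<subseteq> gen J" using J(2) by blast
  moreover have "L c \<subseteq> gen J"
    unfolding L_def by (rule gen_mono') (auto simp: P(2) intro: gen_incl gen.zero)
  ultimately obtain k where k: "\<not> X \<inter> L k \<subseteq> gen J" "X \<inter> L (Suc k) \<subseteq> gen J"
    using ex_least_nat_less[of "\<lambda>k. X \<inter> L k \<subseteq> gen J" c] by blast
  then obtain x where x: "x \<in> X" "x \<in> L k" "x \<notin> gen J" by blast
  have lP: "lcs i P \<subseteq> P" for i using lcs_antimono[OF P(1), of 0 i] by simp
  have LP: "L i \<subseteq> P" for i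
    unfolding L_def by (rule gen_least[OF _ P(1)]) (use J(1) lP in auto)
  have JL: "J \<subseteq> L i" for i by (auto simp: L_def intro: gen_incl)
  have cj: "conjg g s \<in> L (Suc k)" if g: "g \<in> lcs k P" and s: "s \<in> J \<union> lcs (Suc k) P" for g s
    using s
  proof
    assume s: "s \<in> J"
    then have "comm g s \<in> lcs (Suc k) P" using J(1) by (intro comm_lcs[OF g]) auto
    then have "- comm g s \<in> lcs (Suc k) P" using subgrp_lcs[OF P(1)] by (rule subgrpD(3)[rotated])
    then show ?thesis using s unfolding L_def conjg_conv_comm comm_swap[of g s]
      by (intro gen_plus gen_incl) simp_all
  next
    assume "s \<in> lcs (Suc k) P"
    then have "conjg g s \<in> lcs (Suc k) P"
      using nsubgrpD(4)[OF nsubgrp_lcs[OF P(1)]] g lP by blast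
    then show ?thesis unfolding L_def by (intro gen_incl) simp
  qed
  have "normalizes x (L (Suc k))"
  proof (rule normalizes_gen[OF _ x(2)[unfolded L_def]], intro ballI)
    fix g assume "g \<in> J \<union> lcs k P"
    then show "normalizes g (L (Suc k))"
    proof
      assume "g \<in> J"
      then show ?thesis unfolding L_def by (intro normalizes_subgrp subgrp_gen gen_incl) simp
    next
      assume g: "g \<in> lcs k P"
      then have "- g \<in> lcs k P" using subgrp_lcs[OF P(1)] by (rule subgrpD(3)[rotated])
      then show ?thesis unfolding L_def using cj g by (intro normalizes_genI) (simp_all add: L_def)
    qed
  qed
  moreover have "x \<in> P" using x(2) LP by blast
  ultimately have nx: "normalizes x (gen (X \<inter> L (Suc k)))"
    by (intro normalizes_gen_set normalizes_Int X)
  have gJ: "gen (X \<inter> L (Suc k)) = gen J"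
  proof
    show "gen (X \<inter> L (Suc k)) \<subseteq> gen J" by (rule gen_mono'[OF k(2)])
    show "gen J \<subseteq> gen (X \<inter> L (Suc k))" using J(1) JL by (intro gen_mono) auto
  qed
  show ?thesis using nx[unfolded gJ] x(1,3) \<open>x \<in> P\<close> by blast
qed

text \<open>Consider maximal nilpotent subgroups generated by elements of \<open>X\<close>. If there
  are two, take a pair \<open>P\<close>, \<open>Q\<close> for which \<open>gen J\<close> with
  \<open>J = X \<inter> P \<inter> Q\<close> is largest. Elements \<open>x\<close> of
  \<open>P\<close> and \<open>y\<close> of \<open>Q\<close> outside \<open>gen J\<close> normalize
  it; the vanishing of the iterated commutator of \<open>x\<close> with \<open>y\<close> then forces
  \<open>x\<close> to normalize \<open>Q\<close>, hence to lie in \<open>Q\<close>, and so in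
  \<open>J\<close>.\<close>

theorem baer_finite:
  fixes D :: "'g::group_add set"
  assumes D: "subgrp D" "finite D" and X: "X \<subseteq> D" "\<And>g. g \<in> D \<Longrightarrow> normalizes g X"
    and e: "\<And>x. x \<in> X \<Longrightarrow> engel n x D"
  shows "lnil (gen X)"
proof (rule ccontr)
  assume contra: "\<not> lnil (gen X)"
  define XS where "XS = {P. \<exists>Z \<subseteq> X. P = gen Z \<and> lnil P}"
  define mx where "mx P \<longleftrightarrow> P \<in> XS \<and> (\<forall>Q \<in> XS. P \<subseteq> Q \<longrightarrow> P = Q)" for P
  have XD: "P \<subseteq> D" if P: "P \<in> XS" for P
  proof -
    obtain Z where "Z \<subseteq> X" "P = gen Z" using P by (auto simp: XS_def)
    then show ?thesis using gen_least[OF _ D(1), of Z] X(1) by simp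
  qed
  have XSs: "subgrp P" if "P \<in> XS" for P using that by (auto simp: XS_def subgrp_gen)
  have "XS \<subseteq> Pow D" using XD by blast
  then have fin: "finite XS" by (rule finite_subset) (simp add: D(2))
  have above: "\<exists>M. mx M \<and> P \<subseteq> M" if P: "P \<in> XS" for P
    using finite_has_maximal2[OF fin P] unfolding mx_def by blast
  have conjXS: "conjg g ` P \<in> XS" if "P \<in> XS" and g: "g \<in> D" for g P
  proof -
    obtain Z where Z: "Z \<subseteq> X" "P = gen Z" "lnil P" using \<open>P \<in> XS\<close> by (auto simp: XS_def)
    have "conjg g ` Z \<subseteq> X" using Z(1) normalizesD(1)[OF X(2)[OF g]] by blast
    moreover have "conjg g ` P = gen (conjg g ` Z)" using image_gen[OF hom_on_conjg subset_UNIV] Z(2) by simp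
    ultimately show ?thesis unfolding XS_def using lnil_conjg[OF Z(3)] by blast
  qed
  have conjmx: "mx (conjg g ` P)" if "mx P" and g: "g \<in> D" for g P
    unfolding mx_def
  proof (intro conjI ballI impI)
    show "conjg g ` P \<in> XS" using that conjXS by (simp add: mx_def)
    fix Q assume Q: "Q \<in> XS" "conjg g ` P \<subseteq> Q"
    have "P \<subseteq> conjg (- g) ` Q"
    proof
      fix p assume "p \<in> P"
      then have "conjg g p \<in> Q" using Q(2) by blast
      then show "p \<in> conjg (- g) ` Q" by (intro image_eqI[of _ _ "conjg g p"]) simp_all
    qed
    moreover have "- g \<in> D" using g D(1) by (simp add: subgrpD)
    ultimately have "P = conjg (- g) ` Q" using that(1) conjXS[OF Q(1)] by (simp add: mx_def)
    then show "conjg g ` P = Q" by (simp add: image_image)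
  qed
  \<comment> \<open>Adjoining an Engel element that normalizes \<open>Q\<close> preserves local
    nilpotence, so maximality leaves no room outside \<open>Q\<close>.\<close>
  have absorb: "z \<in> Q" if Q: "mx Q" and z: "z \<in> X" "normalizes z Q" for z Q
  proof -
    obtain Z where Z: "Z \<subseteq> X" "Q = gen Z" "lnil Q" using Q by (auto simp: XS_def mx_def)
    have "gen (insert z Q) \<subseteq> D" using XD[of Q] Q z(1) X(1) by (intro gen_least[OF _ D(1)]) (auto simp: mx_def)
    then have "engel n z (gen (insert z Q))" by (rule engel_subset[OF e[OF z(1)]]) (simp add: gen_incl)
    then have l: "lnil (gen (insert z Q))" using lnil_insert_engel[of Q z n] Z z(2) by (simp add: subgrp_gen)
    have "gen (insert z Q) = gen (insert z Z)"
    proof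
      show "gen (insert z Q) \<subseteq> gen (insert z Z)"
        using gen_mono[of Z "insert z Z"] by (intro gen_mono') (auto simp: Z(2) intro: gen_incl)
      show "gen (insert z Z) \<subseteq> gen (insert z Q)"
        using gen_incl'[of Z] by (intro gen_mono) (auto simp: Z(2))
    qed
    then have "gen (insert z Q) \<in> XS"
      unfolding XS_def using l Z(1) z(1) by (intro CollectI exI[of _ "insert z Z"]) simp
    moreover have "Q \<subseteq> gen (insert z Q)" by (auto intro: gen_incl)
    ultimately have "Q = gen (insert z Q)" using Q by (simp add: mx_def)
    moreover have "z \<in> gen (insert z Q)" by (simp add: gen_incl)
    ultimately show ?thesis by simp
  qed
  define PR where "PR = {(P, Q). mx P \<and> mx Q \<and> P \<noteq> Q}"
  have "PR \<subseteq> XS \<times> XS" by (auto simp: PR_def mx_def)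
  then have finPR: "finite PR" by (rule finite_subset) (intro finite_SigmaI fin)
  have "PR \<noteq> {}"
  proof
    assume emp: "PR = {}"
    have single: "gen {x} \<in> XS" if "x \<in> X" for x using that gen_singleton_lnil by (auto simp: XS_def)
    have "gen {} \<in> XS"
    proof -
      have "gen {} \<subseteq> {0 :: 'g}" by (rule gen_least[OF _ subgrp_zero]) simp
      then show ?thesis using lnil_mono[OF lnil_zero] by (auto simp: XS_def)
    qed
    then obtain M where M: "mx M" using above by blast
    have "x \<in> M" if x: "x \<in> X" for x
    proof -
      obtain M' where "mx M'" "gen {x} \<subseteq> M'" using above[OF single[OF x]] by blast
      moreover from this have "M' = M" using emp M by (auto simp: PR_def)
      ultimately show ?thesis using gen_incl[of x "{x}"] by blast
    qed
    then have "gen X \<subseteq> M" using M by (intro gen_least) (auto simp: mx_def intro: XSs)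
    moreover have "lnil M" using M by (auto simp: mx_def XS_def)
    ultimately show False using contra lnil_mono by blast
  qed
  \<comment> \<open>The size of the subgroup generated by the common elements of \<open>X\<close>;
    two maximal members with the largest value are chosen.\<close>
  define f where "f = (\<lambda>(P, Q). card (gen (X \<inter> P \<inter> Q)))"
  have "Max (f ` PR) \<in> f ` PR" using finPR \<open>PR \<noteq> {}\<close> by (intro Max_in) auto
  then obtain P Q where PQ: "(P, Q) \<in> PR" "f (P, Q) = Max (f ` PR)" by auto
  have greatest: "card (gen (X \<inter> P' \<inter> Q')) \<le> card (gen (X \<inter> P \<inter> Q))" if "(P', Q') \<in> PR" for P' Q'
  proof -
    have "f (P', Q') \<le> f (P, Q)" unfolding PQ(2) using finPR that by (intro Max_ge) auto
    then show ?thesis by (simp add: f_def)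
  qed
  define J where "J = X \<inter> P \<inter> Q"
  have mP: "mx P" and mQ: "mx Q" and ne: "P \<noteq> Q" using PQ(1) by (auto simp: PR_def)
  have grow: "\<exists>x \<in> X \<inter> P. x \<notin> gen J \<and> normalizes x (gen J)"
    if mP: "mx P" and mQ: "mx Q" and ne: "P \<noteq> Q" and J: "J = X \<inter> P \<inter> Q" for P Q
  proof -
    obtain Z where Z: "Z \<subseteq> X" "P = gen Z" "lnil P" using mP by (auto simp: XS_def mx_def)
    have PD: "P \<subseteq> D" using mP XD by (simp add: mx_def)
    have ZP: "Z \<subseteq> P" using Z(2) gen_incl' by blast
    have "finite Z" by (rule finite_subset[OF ZP finite_subset[OF PD D(2)]])
    then have "\<exists>c. lcs c (gen Z) = {0}" using Z(3) ZP unfolding lnil_def by simp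
    then obtain c where c: "lcs c P = {0}" using Z(2) by auto
    show ?thesis
    proof (rule normalizer_grows[OF _ c])
      show "subgrp P" using Z(2) by (simp add: subgrp_gen)
      show "normalizes g X" if "g \<in> P" for g using that PD X(2) by blast
      show "J \<subseteq> X \<inter> P" using J by blast
      show "\<not> X \<inter> P \<subseteq> gen J"
      proof
        assume "X \<inter> P \<subseteq> gen J"
        then have "Z \<subseteq> gen J" using ZP Z(1) by blast
        then have "P \<subseteq> gen J" unfolding Z(2) by (rule gen_mono')
        also have "gen J \<subseteq> Q" using J mQ XSs by (intro gen_least) (auto simp: mx_def)
        finally show False using mP mQ ne by (simp add: mx_def)
      qed
    qed
  qed
  obtain x where x: "x \<in> X" "x \<in> P" "x \<notin> gen J" "normalizes x (gen J)"
    using grow[OF mP mQ ne J_def] by blast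
  have "J = X \<inter> Q \<inter> P" by (auto simp: J_def)
  from grow[OF mQ mP ne[symmetric] this] obtain y where y: "y \<in> X" "y \<in> Q" "y \<notin> gen J" "normalizes y (gen J)"
    by blast
  have QS: "subgrp Q" and QD: "Q \<subseteq> D" using mQ XSs XD by (auto simp: mx_def)
  have xD: "x \<in> D" "y \<in> D" using x y X(1) by auto
  \<comment> \<open>\<open>conjg g y\<close> differs from \<open>y\<close> by
    \<open>comm g y\<close>, so it normalizes \<open>Q\<close> and is absorbed. It lies in
    \<open>Q\<close> and in the conjugate of \<open>Q\<close> by \<open>g\<close>, but outside
    \<open>gen J\<close>; if these two were distinct, their intersection would beat the choice of
    \<open>J\<close>.\<close>
  have step: "normalizes g Q" if g: "g \<in> D" "normalizes g (gen J)" "normalizes (comm g y) Q" for g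
  proof -
    let ?y = "conjg g y"
    have "?y \<in> X" using normalizesD(1)[OF X(2)[OF g(1)] y(1)] .
    have "?y = y + - comm g y" by (simp add: conjg_conv_comm comm_swap[of g y])
    moreover have "normalizes y Q" using QS y(2) by (rule normalizes_subgrp)
    ultimately have "normalizes ?y Q"
      using subgrp_normalizer[of Q] g(3) subgrpD(2)[OF subgrp_normalizer[of Q], of y "- comm g y"]
      by (simp add: normalizes_uminus)
    then have yQ: "?y \<in> Q" using absorb[OF mQ \<open>?y \<in> X\<close>] by blast
    have JQ: "gen J \<subseteq> Q" using QS by (intro gen_least) (auto simp: J_def)
    have "Q = conjg g ` Q"
    proof (rule ccontr)
      assume "Q \<noteq> conjg g ` Q"
      then have "(Q, conjg g ` Q) \<in> PR" using mQ conjmx g(1) by (simp add: PR_def)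
      then have le: "card (gen (X \<inter> Q \<inter> conjg g ` Q)) \<le> card (gen J)" unfolding J_def by (rule greatest)
      have "conjg g ` gen J \<subseteq> conjg g ` Q" using JQ by (rule image_mono)
      then have "gen J \<subseteq> conjg g ` Q" unfolding normalizes_image[OF g(2)] .
      then have "J \<subseteq> X \<inter> Q \<inter> conjg g ` Q" using gen_incl'[of J] by (auto simp: J_def)
      then have sub: "gen J \<subseteq> gen (X \<inter> Q \<inter> conjg g ` Q)" by (rule gen_mono)
      have "?y \<in> X \<inter> Q \<inter> conjg g ` Q" using \<open>?y \<in> X\<close> yQ y(2) by simp
      then have "?y \<in> gen (X \<inter> Q \<inter> conjg g ` Q)" by (rule gen_incl)
      moreover have "?y \<notin> gen J" using y(3) normalizesD(2)[OF g(2), of ?y] by auto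
      ultimately have "gen J \<subset> gen (X \<inter> Q \<inter> conjg g ` Q)" using sub by blast
      moreover have "gen (X \<inter> Q \<inter> conjg g ` Q) \<subseteq> D" using X(1) by (intro gen_least[OF _ D(1)]) auto
      ultimately have "card (gen J) < card (gen (X \<inter> Q \<inter> conjg g ` Q))"
        by (intro psubset_card_mono finite_subset[OF _ D(2)])
      then show False using le by simp
    qed
    then have Qi: "conjg g ` Q = Q" by simp
    show ?thesis unfolding normalizes_def
    proof (intro ballI conjI)
      fix a assume a: "a \<in> Q"
      show "conjg g a \<in> Q" using imageI[OF a, of "conjg g"] unfolding Qi .
      have "a \<in> conjg g ` Q" using a unfolding Qi .
      then show "conjg (- g) a \<in> Q" by auto
    qed
  qed
  define cc where "cc i = ((\<lambda>h. comm h y) ^^ i) x" for i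
  have cD: "cc i \<in> D \<and> normalizes (cc i) (gen J)" for i
  proof (induction i)
    case 0 then show ?case using xD x by (simp add: cc_def)
  next
    case (Suc i)
    then have "comm (cc i) y \<in> {h. normalizes h (gen J)}" using y(4) by (intro subgrp_comm[OF subgrp_normalizer]) auto
    moreover have "comm (cc i) y \<in> D" using Suc xD D(1) by (simp add: subgrp_comm)
    ultimately show ?case by (simp add: cc_def)
  qed
  \<comment> \<open>Descends from the trivial commutator \<open>cc n\<close> to
    \<open>cc 0 = x\<close>.\<close>
  have "normalizes (cc (n - j)) Q" if "j \<le> n" for j using that
  proof (induction j)
    case 0
    have "cc n = 0" using e[OF y(1)] xD(1) by (simp add: engel_def cc_def)
    then show ?case by (simp add: normalizes_def)
  next
    case (Suc j)
    then have "n - j = Suc (n - Suc j)" by simp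
    then have "comm (cc (n - Suc j)) y = cc (n - j)" by (simp add: cc_def)
    then have "normalizes (comm (cc (n - Suc j)) y) Q" using Suc by simp
    then show ?case using step[of "cc (n - Suc j)"] cD[of "n - Suc j"] by blast
  qed
  from this[of n] have "normalizes x Q" by (simp add: cc_def)
  then have "x \<in> Q" using absorb[OF mQ x(1)] by blast
  then show False using x gen_incl[of x J] by (auto simp: J_def)
qed

section \<open>Baer's theorem for finite-by-cyclic groups, and the successor step for local
  nilpotence\<close>

lemma lcs_Suc_subset:
  assumes "subgrp R" "lcs c H \<subseteq> A" "\<And>a h. a \<in> A \<Longrightarrow> h \<in> H \<Longrightarrow> comm a h \<in> R"
  shows "lcs (Suc c) H \<subseteq> R"
  unfolding lcs.simps by (rule gen_least[OF _ assms(1)]) (use assms(2,3) in blast)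

text \<open>Two distinct multiples of \<open>x\<close> induce the same permutation of the finite set
  \<open>N\<close>; their difference acts trivially.\<close>

lemma power_centralizes_finite:
  assumes N: "finite N" "normalizes x N"
  obtains k where "k > 0" "\<And>a. a \<in> N \<Longrightarrow> conjg (nmul k x) a = a"
proof -
  define F where "F i = (\<lambda>a\<in>N. conjg (nmul i x) a)" for i
  have m: "conjg (nmul i x) a \<in> N" if "a \<in> N" for i a
    by (induction i) (use that N(2) in \<open>auto simp: conjg_add normalizes_def\<close>)
  have "range F \<subseteq> N \<rightarrow>\<^sub>E N" using m by (auto simp: F_def)
  then have "finite (range F)" by (rule finite_subset) (intro finite_PiE N(1))
  then have "\<not> inj F" using finite_imageD infinite_UNIV_nat by metis
  then obtain i j where ij: "i < j" "F i = F j" by (metis injI linorder_neqE_nat)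
  have "conjg (nmul (j - i) x) a = a" if a: "a \<in> N" for a
  proof -
    have "conjg (nmul j x) a = conjg (nmul i x) a" using fun_cong[OF ij(2), of a] a by (simp add: F_def)
    moreover have "nmul j x = nmul (j - i) x + nmul i x" using nmul_add_left[of "j - i" i x] ij(1) by simp
    ultimately have "conjg (nmul i x) (conjg (nmul (j - i) x) a) = conjg (nmul i x) a" by (simp add: conjg_add)
    then show ?thesis by (metis conjg_inverse(2))
  qed
  then show thesis using ij(1) that[of "j - i"] by simp
qed

lemma finite_gen_insert:
  fixes x :: "'g::group_add"
  assumes N: "subgrp N" "finite N" "normalizes x N" and k: "k > 0" "nmul k x = 0"
  shows "finite (gen (insert x N))"
proof -
  have conjN: "conjg (nmul i x) a \<in> N" if "a \<in> N" for i a
    by (induction i) (use that N(3) in \<open>auto simp: conjg_add normalizes_def\<close>)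
  have xk: "- x = nmul (k - 1) x"
    using k nmul_Suc'[of "k - 1" x] by (intro minus_unique) simp
  have step: "\<exists>j b. b \<in> N \<and> s + (nmul i x + a) = nmul j x + b" if s: "s \<in> N" and a: "a \<in> N" for s a i
  proof -
    have "s + (nmul i x + a) = nmul i x + (conjg (nmul i x) s + a)" by (simp add: conjg_def add.assoc)
    then show ?thesis using subgrpD(2)[OF N(1) conjN[OF s, of i] a] by blast
  qed
  have cover: "\<exists>i a. a \<in> N \<and> h = nmul i x + a" if "h \<in> gen (insert x N)" for h
    using that
  proof (induction rule: gen.induct)
    case zero
    show ?case using subgrpD(1)[OF N(1)] by (intro exI[of _ 0]) auto
  next
    case (add s h)
    then obtain i a where h: "a \<in> N" "h = nmul i x + a" by blast
    show ?case
    proof (cases "s = x")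
      case True
      then have "s + h = nmul (Suc i) x + a" unfolding h(2) nmul_Suc' by (simp add: add.assoc)
      then show ?thesis using h(1) by blast
    qed (use step[OF _ h(1)] add h(2) in auto)
  next
    case (sub s h)
    then obtain i a where h: "a \<in> N" "h = nmul i x + a" by blast
    show ?case
    proof (cases "s = x")
      case True
      then have "- s + h = nmul (k - 1 + i) x + a" by (simp add: h(2) xk nmul_add_left add.assoc)
      then show ?thesis using h(1) by blast
    next
      case False
      then have "- s \<in> N" using sub N(1) by (simp add: subgrpD)
      then show ?thesis using step[OF _ h(1)] h(2) by simp
    qed
  qed
  have "nmul (k * j) x = 0" for j by (induction j) (simp_all add: nmul_add_left k(2))
  then have red: "nmul i x = nmul (i mod k) x" for i
    using nmul_add_left[of "k * (i div k)" "i mod k" x] by simp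
  have "gen (insert x N) \<subseteq> (\<lambda>(i, a). nmul i x + a) ` ({..<k} \<times> N)"
  proof
    fix h assume "h \<in> gen (insert x N)"
    then obtain i a where "a \<in> N" "h = nmul i x + a" using cover by blast
    then show "h \<in> (\<lambda>(i, a). nmul i x + a) ` ({..<k} \<times> N)"
      using k(1) red[of i] by (intro image_eqI[of _ _ "(i mod k, a)"]) simp_all
  qed
  then show ?thesis by (rule finite_subset) (use N(2) in simp)
qed

text \<open>Some positive multiple \<open>z\<close> of \<open>x\<close> centralizes \<open>N\<close>
  and commutes with \<open>x\<close>, so it is central. Modulo \<open>gen {z}\<close> the group is
  finite and \<open>baer_finite\<close> applies; centrality of the kernel costs one more term of the
  lower central series.\<close>

lemma baer_finite_by_cyclic:
  fixes N :: "'g::group_add set"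
  assumes N: "subgrp N" "finite N" "normalizes x N"
    and X: "X \<subseteq> gen (insert x N)" "\<And>g. g \<in> gen (insert x N) \<Longrightarrow> normalizes g X"
    and e: "\<And>y. y \<in> X \<Longrightarrow> engel n y (gen (insert x N))"
  shows "lnil (gen X)"
proof -
  let ?L = "gen (insert x N)"
  have L: "subgrp ?L" by (rule subgrp_gen)
  have xL: "x \<in> ?L" "N \<subseteq> ?L" by (auto intro: gen_incl)
  obtain k where k: "k > 0" "\<And>a. a \<in> N \<Longrightarrow> conjg (nmul k x) a = a"
    using power_centralizes_finite[OF N(2,3)] by blast
  define z where "z = nmul k x"
  have zL: "z \<in> ?L" using xL(1) L by (simp add: z_def nmul_mem)
  have "comm z x = 0" using nmul_commutes[of x x k] by (simp add: comm_def z_def add.assoc)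
  moreover have "comm z a = 0" if "a \<in> N" for a
    using k(2)[OF that] comm_conv_conjg(1)[of a z] by (simp add: z_def comm_swap[of a])
  ultimately have "?L \<subseteq> {h. \<forall>w \<in> {z}. comm w h = 0}" by (intro gen_least[OF _ subgrp_centralizer]) auto
  then have zc: "comm h z = 0" if "h \<in> ?L" for h using that by (auto simp: comm_swap[of z h])
  have cen: "comm w h = 0" if w: "w \<in> gen {z}" and h: "h \<in> ?L" for w h
  proof -
    have "gen {z} \<subseteq> {w. \<forall>h \<in> ?L. comm h w = 0}"
      by (rule gen_least[OF _ subgrp_centralizer]) (use zc in auto)
    then have "comm h w = 0" using w h by blast
    then show ?thesis by (simp add: comm_swap[of h w])
  qed
  have Z: "nsubgrp (gen {z}) ?L"
    by (rule nsubgrpI'[OF subgrp_gen _ L]) (use zL gen_least[OF _ L, of "{z}"] in \<open>auto simp: conjg_conv_comm cen\<close>)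
  from quotient_hom[OF L Z] obtain q :: "'g \<Rightarrow> 'g set bijn"
    where q: "hom_on ?L q" "\<And>h. h \<in> ?L \<Longrightarrow> q h = 0 \<longleftrightarrow> h \<in> gen {z}" by blast
  have "q z = 0" using q(2)[OF zL] by (simp add: gen_incl)
  then have "nmul k (q x) = 0" using hom_on_nmul[OF q(1) xL(1), of k] by (simp add: z_def)
  moreover have "normalizes (q x) (q ` N)" by (rule normalizes_hom_image[OF q(1) N(3) xL])
  ultimately have "finite (gen (insert (q x) (q ` N)))"
    using finite_gen_insert[OF subgrp_image[OF q(1) N(1) xL(2)] finite_imageI[OF N(2)] _ k(1)] by blast
  then have finL: "finite (q ` ?L)" using image_gen[OF q(1) gen_incl'] by simp
  have lq: "lnil (gen (q ` X))"
  proof (rule baer_finite[OF subgrp_image[OF q(1) L subset_refl] finL])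
    show "q ` X \<subseteq> q ` ?L" using X(1) by (rule image_mono)
    show "engel n y (q ` ?L)" if "y \<in> q ` X" for y
      using that engel_image[OF q(1)] e by blast
    show "normalizes g (q ` X)" if g: "g \<in> q ` ?L" for g
    proof -
      obtain h where "g = q h" "h \<in> ?L" using g by blast
      then show ?thesis using normalizes_hom_image[OF q(1) X(2) _ X(1)] by simp
    qed
  qed
  show ?thesis unfolding lnil_def
  proof (intro allI impI)
    fix S assume S: "finite S \<and> S \<subseteq> gen X"
    have gXL: "gen X \<subseteq> ?L" using X(1) by (rule gen_mono')
    have SL: "S \<subseteq> ?L" using S gXL by blast
    have gSL: "gen S \<subseteq> ?L" using SL by (rule gen_mono')
    have "q ` S \<subseteq> gen (q ` X)" using S image_gen[OF q(1) X(1)] by blast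
    then obtain c where "lcs c (gen (q ` S)) = {0}" using lq S unfolding lnil_def by blast
    then have q0: "q ` lcs c (gen S) = {0}" using image_lcs[OF q(1) subgrp_gen gSL] image_gen[OF q(1) SL] by simp
    have "lcs c (gen S) \<subseteq> ?L" using lcs_antimono[OF subgrp_gen, of 0 c S] gSL by simp
    then have "lcs c (gen S) \<subseteq> gen {z}"
      by (intro hom_image_trivial[OF q(1), THEN iffD1, OF q(2) _ _ q0] subgrpD(1)[OF subgrp_lcs[OF subgrp_gen]])
    then have "lcs (Suc c) (gen S) \<subseteq> {0}"
      by (rule lcs_Suc_subset[OF subgrp_zero]) (use cen gSL in auto)
    then have "lcs (Suc c) (gen S) = {0}" by (rule lcs_gen_zeroI)
    then show "\<exists>c. lcs c (gen S) = {0}" by blast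
  qed
qed

text \<open>\<open>x\<close> need not lie in \<open>B\<close>, but the closure \<open>Z\<close> of
  \<open>S\<close> under commutation with \<open>x\<close> does, as \<open>B\<close> is normal. So
  \<open>gen Z\<close> is soluble or finite modulo \<open>A\<close>, and adding \<open>x\<close> to
  it gives a soluble or finite-by-cyclic group that contains all the conjugates in question.\<close>

lemma engel_conjugates_nilpotent_mod:
  fixes D :: "'g::group_add set"
  assumes D: "subgrp D" and A: "nsubgrp A D" and B: "nsubgrp B D"
    and X: "X \<subseteq> D" "\<And>g. g \<in> D \<Longrightarrow> normalizes g X" and e: "\<And>x. x \<in> X \<Longrightarrow> engel n x D"
    and fac: "lsolmod B A \<or> lfinmod B A"
    and x: "x \<in> X" and S: "finite S" "S \<subseteq> B"
  shows "\<exists>c. lcs c (gen ((\<lambda>s. conjg s x) ` S)) \<subseteq> A"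
proof -
  let ?S = "(\<lambda>s. conjg s x) ` S"
  note A' = nsubgrpD[OF A] and B' = nsubgrpD[OF B]
  have xD: "x \<in> D" using x X(1) by blast
  have SD: "S \<subseteq> D" using S(2) B'(2) by blast
  have "((\<lambda>h. comm h x) ^^ n) g = 0" if "g \<in> S" for g
    using e[OF x] that SD by (auto simp: engel_def)
  from engel_finite_closure[OF S(1) this] obtain Z where Z: "finite Z" "S \<subseteq> Z" "normalizes x (gen Z)"
    "\<And>P. S \<subseteq> P \<Longrightarrow> (\<And>a. a \<in> P \<Longrightarrow> comm a x \<in> P) \<Longrightarrow> Z \<subseteq> P" by blast
  have ZB: "Z \<subseteq> B" by (rule Z(4)[OF S(2)]) (rule B'(5)[OF xD])
  let ?N = "gen Z" and ?L = "gen (insert x (gen Z))"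
  have ND: "?N \<subseteq> D" using ZB B'(2) D by (intro gen_least) auto
  have LD: "?L \<subseteq> D" using xD ND D by (intro gen_least) auto
  have NL: "?N \<subseteq> ?L" and xL: "x \<in> ?L" by (auto intro: gen_incl)
  have SL: "S \<subseteq> ?L" using Z(2) gen_incl'[of Z] NL by blast
  have S'L: "?S \<subseteq> ?L" using SL xL subgrp_conjg[OF subgrp_gen] by blast
  from quotient_hom[OF D A] obtain q :: "'g \<Rightarrow> 'g set bijn"
    where q: "hom_on D q" "\<And>x. x \<in> D \<Longrightarrow> q x = 0 \<longleftrightarrow> x \<in> A" by blast
  have qL: "subgrp (q ` ?L)" by (rule subgrp_image[OF q(1) subgrp_gen LD])
  have qx: "engel n y' (q ` ?L)" if y': "y' \<in> q ` (X \<inter> ?L)" for y'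
  proof -
    obtain y where "y' = q y" "y \<in> X" "y \<in> ?L" using y' by blast
    then show ?thesis
      using engel_image[OF hom_on_subset[OF q(1) subgrp_gen LD] engel_subset[OF e LD]] by blast
  qed
  have key: "\<exists>K. lnil K \<and> q ` ?S \<subseteq> K"
    using fac
  proof
    assume "lsolmod B A"
    then obtain d where d: "ders d ?N \<subseteq> A" using Z(1) ZB unfolding lsolmod_def by blast
    \<comment> \<open>The extra step accounts for the cyclic quotient generated by
      \<open>x\<close>.\<close>
    have "ders (d + 1) ?L \<subseteq> ders d ?N"
      using ders_mono[OF comm_gen_insert(2)[OF subgrp_gen Z(3)], of d] unfolding ders_add .
    then have dA: "ders (d + 1) ?L \<subseteq> A" using d by blast
    have "ders (d + 1) ?L \<subseteq> D" using dA A'(2) by (rule order_trans)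
    then have "q ` ders (d + 1) ?L = {0}"
      by (intro hom_image_trivial[OF q(1), THEN iffD2, OF q(2) _ _ dA] subgrpD(1)[OF subgrp_ders[OF subgrp_gen]])
    then have "ders (d + 1) (q ` ?L) = {0}" unfolding image_ders[OF q(1) subgrp_gen LD] .
    then have "q x \<in> hp (q ` ?L)" using soluble_engel[OF qL qx] x xL by blast
    moreover have "q (conjg s x) = conjg (q s) (q x)" if "s \<in> S" for s
      using hom_onD(5)[OF q(1) xD] that SD by blast
    ultimately have "q ` ?S \<subseteq> hp (q ` ?L)"
      using nsubgrpD(4)[OF nsubgrp_hp[OF qL]] SL by (auto simp: subset_iff)
    then show ?thesis using lnil_hp[OF qL] by blast
  next
    assume "lfinmod B A"
    then have "finmod ?N A" using Z(1) ZB unfolding lfinmod_def by blast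
    then have fin: "finite (q ` ?N)" using finmod_hom[OF q A'(1) ND] by simp
    have "insert x ?N \<subseteq> D" using xD ND by blast
    then have Li: "q ` ?L = gen (insert (q x) (q ` ?N))" using image_gen[OF q(1)] by simp
    \<comment> \<open>Baer's theorem wants a set invariant under the whole group;
      \<open>X \<inter> ?L\<close> is one, and it contains the conjugates of \<open>x\<close> by
      \<open>S\<close>.\<close>
    have "lnil (gen (q ` (X \<inter> ?L)))"
    proof (rule baer_finite_by_cyclic[OF subgrp_image[OF q(1) subgrp_gen ND] fin, of "q x" _ n])
      show "normalizes (q x) (q ` ?N)" by (rule normalizes_hom_image[OF q(1) Z(3) xD ND])
      show "q ` (X \<inter> ?L) \<subseteq> gen (insert (q x) (q ` ?N))" unfolding Li[symmetric] by blast
      show "engel n y (gen (insert (q x) (q ` ?N)))" if "y \<in> q ` (X \<inter> ?L)" for y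
        using qx[OF that] by (simp add: Li)
      fix g assume "g \<in> gen (insert (q x) (q ` ?N))"
      then obtain h where h: "g = q h" "h \<in> ?L" unfolding Li[symmetric] by blast
      have "h \<in> D" using h(2) LD by blast
      then show "normalizes g (q ` (X \<inter> ?L))" unfolding h(1)
        by (intro normalizes_hom_image[OF q(1)] normalizes_Int X(2) normalizes_subgrp[OF subgrp_gen h(2)]) (use LD in auto)
    qed
    moreover have "?S \<subseteq> X \<inter> ?L"
      using S'L normalizesD(1)[OF X(2) x] SD by blast
    then have "q ` ?S \<subseteq> gen (q ` (X \<inter> ?L))" by (intro order_trans[OF image_mono gen_incl'])
    ultimately show ?thesis by (intro exI conjI)
  qed
  then obtain K where K: "lnil K" "q ` ?S \<subseteq> K" by (elim exE conjE)
  have "finite (q ` ?S)" using S(1) by simp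
  then have "\<exists>c. lcs c (gen (q ` ?S)) = {0}" by (rule lnilD[OF K(1) _ K(2)])
  then obtain c where c: "lcs c (gen (q ` ?S)) = {0}" by (elim exE)
  have S'D: "?S \<subseteq> D" using S'L LD by blast
  have gD: "gen ?S \<subseteq> D" using S'D D by (rule gen_least)
  have q0: "q ` lcs c (gen ?S) = {0}" using image_lcs[OF q(1) subgrp_gen gD] image_gen[OF q(1) S'D] c by simp
  have "lcs c (gen ?S) \<subseteq> D" using lcs_antimono[OF subgrp_gen, of 0 c ?S] gD by simp
  then have "lcs c (gen ?S) \<subseteq> A"
    by (intro hom_image_trivial[OF q(1), THEN iffD1, OF q(2) _ _ q0] subgrpD(1)[OF subgrp_lcs[OF subgrp_gen]])
  then show ?thesis by blast
qed

lemma conjugates_locally_nilpotent: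
  assumes "subgrp A" and nil: "\<And>S. finite S \<Longrightarrow> S \<subseteq> A \<Longrightarrow> \<exists>c. lcs c (gen ((\<lambda>s. conjg s y) ` S)) = {0}"
  shows "lnil (gen ((\<lambda>s. conjg s y) ` A))" "b \<in> A \<Longrightarrow> normalizes b (gen ((\<lambda>s. conjg s y) ` A))"
proof -
  let ?M = "gen ((\<lambda>s. conjg s y) ` A)"
  show "lnil ?M" unfolding lnil_def
  proof (intro allI impI)
    fix T assume "finite T \<and> T \<subseteq> ?M"
    then obtain T0 where T0: "finite T0" "T0 \<subseteq> (\<lambda>s. conjg s y) ` A" "T \<subseteq> gen T0" using finite_subset_gen by metis
    obtain T1 where T1: "T1 \<subseteq> A" "finite T1" "T0 = (\<lambda>s. conjg s y) ` T1"
      using T0(1,2) by (meson finite_subset_image)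
    obtain c where "lcs c (gen T0) = {0}" using nil[OF T1(2,1)] T1(3) by blast
    then have "lcs c (gen T) \<subseteq> {0}" using lcs_mono[OF gen_mono'[OF T0(3)], of c] by simp
    then have "lcs c (gen T) = {0}" by (rule lcs_gen_zeroI)
    then show "\<exists>c. lcs c (gen T) = {0}" by blast
  qed
  have n: "conjg b s \<in> (\<lambda>s. conjg s y) ` A" if "b \<in> A" "s \<in> (\<lambda>s. conjg s y) ` A" for b s
    using that assms(1) by (auto simp: conjg_add[symmetric] subgrpD)
  show "normalizes b ?M" if "b \<in> A"
    using n that subgrpD(3)[OF assms(1) that] by (intro normalizes_genI gen_incl) auto
qed

text \<open>Nilpotence modulo \<open>A\<close> is first improved to nilpotence modulo the radical
  \<open>?R\<close> of \<open>A\<close>. Then \<open>?R\<close> together with one conjugate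
  \<open>y\<close> generates a subnormal subgroup of the group generated by \<open>?R\<close> and
  all the conjugates, so each of these lies in the radical of that group.\<close>

lemma engel_step:
  fixes X :: "'g::group_add set"
  assumes A: "nsubgrp A (gen X)" and B: "nsubgrp B (gen X)"
    and X: "\<And>g. g \<in> gen X \<Longrightarrow> normalizes g X" and e: "\<And>x. x \<in> X \<Longrightarrow> engel n x (gen X)"
    and fac: "lsolmod B A \<or> lfinmod B A"
    and IH: "\<And>x S. x \<in> X \<Longrightarrow> finite S \<Longrightarrow> S \<subseteq> A \<Longrightarrow> \<exists>c. lcs c (gen ((\<lambda>s. conjg s x) ` S)) = {0}"
    and x: "x \<in> X" and S: "finite S" "S \<subseteq> B"
  shows "\<exists>c. lcs c (gen ((\<lambda>s. conjg s x) ` S)) = {0}"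
proof -
  let ?D = "gen X" and ?S = "(\<lambda>s. conjg s x) ` S" and ?R = "hp A"
  let ?H = "gen ?S"
  have D: "subgrp ?D" and XD: "X \<subseteq> ?D" by (auto intro: subgrp_gen gen_incl)
  note A' = nsubgrpD[OF A]
  have RA: "?R \<subseteq> A" by (rule hp_subset)
  have R: "nsubgrp ?R ?D"
    by (intro nsubgrpI subgrp_hp A'(1) normalizes_hp A'(3)) (use RA A'(2) in auto)
  note R' = nsubgrpD[OF R]
  \<comment> \<open>\<open>comm a y\<close> is \<open>- conjg a y + y\<close>, a product of
    conjugates of \<open>y\<close> under \<open>A\<close>. These generate a locally nilpotent group
    by hypothesis, and its intersection with \<open>A\<close> is normal in \<open>A\<close>.\<close>
  have 1: "comm a y \<in> ?R" if a: "a \<in> A" and y: "y \<in> X" for a y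
  proof -
    let ?M = "gen ((\<lambda>s. conjg s y) ` A)"
    note l = conjugates_locally_nilpotent(1)[OF A'(1) IH[OF y]]
    have "normalizes b ?M" if "b \<in> A" for b
      using conjugates_locally_nilpotent(2)[OF A'(1) IH[OF y] that] .
    then have "nsubgrp (?M \<inter> A) A"
      using normalizes_subgrp[OF A'(1)] by (intro nsubgrpI subgrp_Int subgrp_gen A'(1) normalizes_Int) auto
    then have "?M \<inter> A \<subseteq> ?R" using subset_hp lnil_mono[OF l] by blast
    moreover have "comm a y \<in> A" using A'(5) y XD a by blast
    moreover have "comm a y \<in> ?M"
    proof -
      have "y \<in> (\<lambda>s. conjg s y) ` A" using subgrpD(1)[OF A'(1)] by (intro image_eqI[of _ _ 0]) simp_all
      moreover have "conjg a y \<in> (\<lambda>s. conjg s y) ` A" using a by blast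
      ultimately show ?thesis unfolding comm_conv_conjg(2) by (intro gen_plus gen_uminus gen_incl)
    qed
    ultimately show ?thesis by blast
  qed
  have 2: "comm a d \<in> ?R" if "a \<in> A" "d \<in> ?D" for a d
    by (rule comm_gen_mem[OF R'(1) R'(3) 1 that(2)]) (use that in auto)
  have SD: "S \<subseteq> ?D" using S(2) nsubgrpD(2)[OF B] by blast
  have SX: "?S \<subseteq> X" using normalizesD(1)[OF X x] SD by blast
  have HD: "?H \<subseteq> ?D" using SX by (rule gen_mono)
  obtain c0 where "lcs c0 ?H \<subseteq> A"
    using engel_conjugates_nilpotent_mod[OF D A B XD X e fac x S] by blast
  \<comment> \<open>As \<open>A\<close> is central modulo \<open>?R\<close>, one more commutator
    leads from \<open>A\<close> into \<open>?R\<close>.\<close>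
  then have "lcs (Suc c0) ?H \<subseteq> ?R" using 2 HD by (intro lcs_Suc_subset[OF R'(1)]) auto
  then obtain c where c: "lcs c ?H \<subseteq> ?R" by blast
  have G: "subgrp (gen (?R \<union> ?H))" by (rule subgrp_gen)
  have "y \<in> hp (gen (?R \<union> ?H))" if y: "y \<in> ?S" for y
  proof -
    have yX: "y \<in> X" and yH: "y \<in> ?H" using subsetD[OF SX y] gen_incl[OF y] by simp_all
    have yD: "y \<in> ?D" using yX XD by blast
    have "gen (insert y ?R) \<subseteq> ?D" using yD R'(2) by (intro gen_least[OF _ D]) auto
    then have "engel n y (gen (insert y ?R))" by (rule engel_subset[OF e[OF yX]]) (simp add: gen_incl)
    then have l: "lnil (gen (insert y ?R))"
      by (rule lnil_insert_engel[OF R'(1) lnil_hp[OF A'(1)] R'(3)[OF yD]])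
    \<comment> \<open>The subnormal chain: an element of \<open>lcs k ?H\<close> moves
      \<open>y\<close> by an element of \<open>lcs (Suc k) ?H\<close>, so \<open>L (Suc k)\<close>
      is normal in \<open>L k\<close>. The chain reaches \<open>gen (insert y ?R)\<close> once
      \<open>lcs c ?H\<close> lies in \<open>?R\<close>.\<close>
    define L where "L k = gen (insert y ?R \<union> lcs k ?H)" for k
    have H: "subgrp ?H" by (rule subgrp_gen)
    have lH: "lcs k ?H \<subseteq> ?H" for k using lcs_antimono[OF H, of 0 k] by simp
    have Ln: "nsubgrp (L (Suc k)) (L k)" for k
    proof (rule nsubgrpI)
      show "subgrp (L (Suc k))" by (simp add: L_def subgrp_gen)
      show "L (Suc k) \<subseteq> L k" unfolding L_def using lcs_decreasing[OF H, of k] by (intro gen_mono) blast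
      have cj: "conjg g s \<in> L (Suc k)" if g: "g \<in> lcs k ?H" and s: "s \<in> insert y ?R \<union> lcs (Suc k) ?H" for g s
      proof -
        have gH: "g \<in> ?H" using g lH by blast
        consider "s = y" | "s \<in> ?R" | "s \<in> lcs (Suc k) ?H" using s by blast
        then show ?thesis
        proof cases
          case 1
          have "- comm g y \<in> lcs (Suc k) ?H" by (rule subgrpD(3)[OF subgrp_lcs[OF H] comm_lcs[OF g yH]])
          then show ?thesis unfolding 1 L_def conjg_conv_comm comm_swap[of g y]
            by (intro gen_plus gen_incl) simp_all
        next
          case 2
          then have "conjg g s \<in> ?R" using R'(4) gH HD by blast
          then show ?thesis unfolding L_def by (intro gen_incl) simp
        next
          case 3
          then have "conjg g s \<in> lcs (Suc k) ?H" using nsubgrpD(4)[OF nsubgrp_lcs[OF H] gH] by blast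
          then show ?thesis unfolding L_def by (intro gen_incl) simp
        qed
      qed
      fix h assume "h \<in> L k"
      then have h: "h \<in> gen (insert y ?R \<union> lcs k ?H)" by (simp add: L_def)
      show "normalizes h (L (Suc k))"
      proof (rule normalizes_gen[OF _ h], intro ballI)
        fix g assume "g \<in> insert y ?R \<union> lcs k ?H"
        then show "normalizes g (L (Suc k))"
        proof
          assume "g \<in> insert y ?R"
          then show ?thesis unfolding L_def by (intro normalizes_subgrp subgrp_gen gen_incl) blast
        next
          assume g: "g \<in> lcs k ?H"
          then have "- g \<in> lcs k ?H" using subgrp_lcs[OF H] by (rule subgrpD(3)[rotated])
          then show ?thesis unfolding L_def using cj g by (intro normalizes_genI) (simp_all add: L_def)
        qed
      qed
    qed
    \<comment> \<open>\<open>subn_chain\<close> climbs while \<open>L\<close> descends, hence the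
      reversed index.\<close>
    have "subn (L (c - 0)) (L (c - c))"
    proof (rule subn_chain[of c "\<lambda>j. L (c - j)"])
      show "subgrp (L (c - j))" for j by (simp add: L_def subgrp_gen)
      show "nsubgrp (L (c - j)) (L (c - Suc j))" if "j < c" for j
        using Ln[of "c - Suc j"] that by (simp add: Suc_diff_Suc)
    qed
    moreover have "L c = gen (insert y ?R)"
      unfolding L_def by (rule arg_cong[where f = gen]) (use c in blast)
    moreover have "L 0 = gen (?R \<union> ?H)"
      unfolding L_def by (rule arg_cong[where f = gen]) (use yH in auto)
    ultimately have "gen (insert y ?R) \<subseteq> hp (gen (?R \<union> ?H))" using subn_subset_hp[OF _ l] by simp
    then show ?thesis using gen_incl[of y "insert y ?R"] by blast
  qed
  then have "?S \<subseteq> hp (gen (?R \<union> ?H))" by blast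
  then show ?thesis by (intro lnilD[OF lnil_hp[OF G]] finite_imageI S(1))
qed

section \<open>Transfer along embeddings\<close>

lemma embeds_generate:
  assumes "embeds K f" "S \<subseteq> carrier K"
  shows "f ` generate K S = gen (f ` S)"
proof
  note f = embedsD[OF assms(1)]
  interpret group K by (rule f(1))
  have "f x \<in> gen (f ` S)" if "x \<in> generate K S" for x using that
  proof (induction rule: generate.induct)
    case (eng h1 h2)
    then show ?case using generate_in_carrier[OF assms(2)] by (simp add: f(3) gen_plus)
  qed (use assms(2) in \<open>auto simp: f gen.zero subset_iff intro: gen_incl gen_uminus\<close>)
  then show "f ` generate K S \<subseteq> gen (f ` S)" by blast
  show "gen (f ` S) \<subseteq> f ` generate K S"
    by (rule gen_least[OF _ subgrp_embeds_image[OF assms(1) generate_is_subgroup[OF assms(2)]]])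
      (intro image_mono subsetI generate.incl)
qed

lemma embeds_lower_central:
  assumes "embeds K f"
  shows "lower_central K k \<subseteq> carrier K \<and> f ` lower_central K k = lcs k (f ` carrier K)"
proof (induction k)
  case (Suc k)
  note f = embedsD[OF assms]
  interpret group K by (rule f(1))
  let ?C = "{group_commutator K x y |x y. x \<in> lower_central K k \<and> y \<in> carrier K}"
  have C: "?C \<subseteq> carrier K" using Suc by (auto simp: group_commutator_def)
  have "f ` ?C = {comm x y |x y. x \<in> f ` lower_central K k \<and> y \<in> f ` carrier K}" (is "_ = ?R")
  proof
    show "f ` ?C \<subseteq> ?R" using Suc f(6) by blast
    show "?R \<subseteq> f ` ?C"
    proof
      fix z assume "z \<in> ?R"
      then obtain x y where xy: "z = comm (f x) (f y)" "x \<in> lower_central K k" "y \<in> carrier K" by blast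
      then have "z = f (group_commutator K x y)" using Suc f(6)[of x y] by auto
      then show "z \<in> f ` ?C" using xy by blast
    qed
  qed
  then show ?case using generate_incl[OF C] embeds_generate[OF assms C] Suc by simp
qed simp

text \<open>The library's derived subgroup uses the convention \<open>x y x^-1 y^-1\<close>, whereas
  \<open>comm\<close> has the inverses first; replacing \<open>x\<close> and \<open>y\<close> by
  their inverses matches the two over a subgroup.\<close>

lemma comm_set_conv:
  assumes "subgrp H"
  shows "{x + y + - x + - y |x y. x \<in> H \<and> y \<in> H} = {comm x y |x y. x \<in> H \<and> y \<in> H}"
proof -
  have 1: "x + y + - x + - y = comm (- x) (- y)" for x y :: 'a by (simp add: comm_def)
  have 2: "comm x y = (- x) + (- y) + - (- x) + - (- y)" for x y :: 'a by (simp add: comm_def)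
  show ?thesis
  proof (intro subset_antisym subsetI)
    fix z assume "z \<in> {x + y + - x + - y |x y. x \<in> H \<and> y \<in> H}"
    then obtain x y where "z = x + y + - x + - y" "x \<in> H" "y \<in> H" by blast
    then show "z \<in> {comm x y |x y. x \<in> H \<and> y \<in> H}" unfolding 1 using subgrpD(3)[OF assms] by blast
  next
    fix z assume "z \<in> {comm x y |x y. x \<in> H \<and> y \<in> H}"
    then obtain x y where "z = comm x y" "x \<in> H" "y \<in> H" by blast
    then show "z \<in> {x + y + - x + - y |x y. x \<in> H \<and> y \<in> H}"
      unfolding 2 using subgrpD(3)[OF assms] by blast
  qed
qed

lemma embeds_derived:
  assumes "embeds K f"
  shows "subgroup ((derived K ^^ d) (carrier K)) K \<and> f ` (derived K ^^ d) (carrier K) = ders d (f ` carrier K)"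
proof (induction d)
  case 0
  show ?case using group.subgroup_self[OF embedsD(1)[OF assms]] by simp
next
  case (Suc d)
  note f = embedsD[OF assms]
  interpret group K by (rule f(1))
  let ?H = "(derived K ^^ d) (carrier K)"
  have H: "subgroup ?H K" "?H \<subseteq> carrier K" "f ` ?H = ders d (f ` carrier K)"
    using Suc subgroup.subset by auto
  have C: "derived_set K ?H \<subseteq> carrier K" by (rule derived_set_in_carrier[OF H(2)])
  have c: "f (x \<otimes>\<^bsub>K\<^esub> y \<otimes>\<^bsub>K\<^esub> inv\<^bsub>K\<^esub> x \<otimes>\<^bsub>K\<^esub> inv\<^bsub>K\<^esub> y) = f x + f y + - f x + - f y"
    if "x \<in> ?H" "y \<in> ?H" for x y
    using that H(2) by (simp add: f subset_iff)
  have "f ` derived_set K ?H = {x + y + - x + - y |x y. x \<in> f ` ?H \<and> y \<in> f ` ?H}" (is "_ = ?R")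
  proof
    show "f ` derived_set K ?H \<subseteq> ?R" using c by fastforce
    show "?R \<subseteq> f ` derived_set K ?H"
    proof
      fix z assume "z \<in> ?R"
      then obtain x y where xy: "z = f x + f y + - f x + - f y" "x \<in> ?H" "y \<in> ?H" by blast
      then show "z \<in> f ` derived_set K ?H"
        by (intro image_eqI[of _ _ "x \<otimes>\<^bsub>K\<^esub> y \<otimes>\<^bsub>K\<^esub> inv\<^bsub>K\<^esub> x \<otimes>\<^bsub>K\<^esub> inv\<^bsub>K\<^esub> y"])
          (use c in simp, blast)
    qed
  qed
  also have "\<dots> = {comm x y |x y. x \<in> f ` ?H \<and> y \<in> f ` ?H}"
    by (rule comm_set_conv[OF subgrp_embeds_image[OF assms H(1)]])
  finally have "f ` derived_set K ?H = {comm x y |x y. x \<in> f ` ?H \<and> y \<in> f ` ?H}" .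
  moreover have "f ` derived K ?H = gen (f ` derived_set K ?H)"
    unfolding derived_def[of K ?H] by (rule embeds_generate[OF assms C])
  ultimately have "f ` derived K ?H = gen {comm x y |x y. x \<in> f ` ?H \<and> y \<in> f ` ?H}" by (rule subst)
  then show ?case using derived_is_subgroup[OF H(2)] H(3) by simp
qed

lemma embeds_image_trivial:
  assumes "embeds K f" "X \<subseteq> carrier K"
  shows "f ` X = {0} \<longleftrightarrow> X = {\<one>\<^bsub>K\<^esub>}"
proof -
  note f = embedsD[OF assms(1)]
  interpret group K by (rule f(1))
  have "f ` X = f ` {\<one>\<^bsub>K\<^esub>} \<longleftrightarrow> X = {\<one>\<^bsub>K\<^esub>}"
    by (rule inj_on_image_eq_iff[OF f(2) assms(2)]) simp
  then show ?thesis by (simp add: f(4))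
qed

text \<open>A common transfer scheme for local nilpotence, solubility and finiteness: only the
  property of a single subgroup has to be translated in each case.\<close>

lemma embeds_has_locally:
  assumes "embeds K f"
    and "\<And>H. subgroup H K \<Longrightarrow> P (K\<lparr>carrier := H\<rparr>) \<longleftrightarrow> Q (f ` H)"
  shows "has_locally P K \<longleftrightarrow> (\<forall>S. finite S \<and> S \<subseteq> f ` carrier K \<longrightarrow> Q (gen S))"
proof -
  interpret group K by (rule embedsD(1)[OF assms(1)])
  have *: "P (K\<lparr>carrier := generate K S\<rparr>) \<longleftrightarrow> Q (gen (f ` S))" if "S \<subseteq> carrier K" for S
    using assms(2)[OF generate_is_subgroup[OF that]] embeds_generate[OF assms(1) that] by simp
  show ?thesis unfolding has_locally_def
  proof (intro iffI allI impI)
    fix S assume P: "\<forall>S. finite S \<and> S \<subseteq> carrier K \<longrightarrow> P (K\<lparr>carrier := generate K S\<rparr>)"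
      and "finite S \<and> S \<subseteq> f ` carrier K"
    then obtain S' where S': "S' \<subseteq> carrier K" "finite S'" "S = f ` S'" by (meson finite_subset_image)
    then show "Q (gen S)" using P *[OF S'(1)] by simp
  next
    fix S assume Q: "\<forall>S. finite S \<and> S \<subseteq> f ` carrier K \<longrightarrow> Q (gen S)" and S: "finite S \<and> S \<subseteq> carrier K"
    then have "Q (gen (f ` S))" using image_mono[of S "carrier K" f] by simp
    then show "P (K\<lparr>carrier := generate K S\<rparr>)" using * S by simp
  qed
qed

lemma locally_nilpotent_iff_lnil:
  assumes "embeds K f"
  shows "locally_nilpotent K \<longleftrightarrow> lnil (f ` carrier K)"
  unfolding lnil_def
proof (rule embeds_has_locally[OF assms])
  fix H assume "subgroup H K"
  note e = embeds_subgroup[OF assms this]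
  show "nilpotent_group (K\<lparr>carrier := H\<rparr>) \<longleftrightarrow> (\<exists>c. lcs c (f ` H) = {0})"
    unfolding nilpotent_group_def
  proof (intro iff_exI)
    fix c
    show "lower_central (K\<lparr>carrier := H\<rparr>) c = {\<one>\<^bsub>K\<lparr>carrier := H\<rparr>\<^esub>} \<longleftrightarrow> lcs c (f ` H) = {0}"
      using embeds_lower_central[OF e, of c] embeds_image_trivial[OF e, of "lower_central (K\<lparr>carrier := H\<rparr>) c"] by simp
  qed
qed

lemma locally_soluble_iff_lsolmod:
  assumes "embeds K f"
  shows "locally_soluble K \<longleftrightarrow> lsolmod (f ` carrier K) {0}"
  unfolding lsolmod_def
proof (rule embeds_has_locally[OF assms])
  fix H assume H: "subgroup H K"
  note e = embeds_subgroup[OF assms H]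
  interpret L: group "K\<lparr>carrier := H\<rparr>" by (rule embedsD(1)[OF e])
  have z: "ders d (f ` H) \<subseteq> {0} \<longleftrightarrow> ders d (f ` H) = {0}" for d
    using subgrpD(1)[OF subgrp_ders[OF subgrp_embeds_image[OF assms H]]] by blast
  show "solvable (K\<lparr>carrier := H\<rparr>) \<longleftrightarrow> (\<exists>d. ders d (f ` H) \<subseteq> {0})"
    unfolding L.solvable_iff_trivial_derived_seq
  proof (intro iff_exI)
    fix d
    let ?X = "(derived (K\<lparr>carrier := H\<rparr>) ^^ d) (carrier (K\<lparr>carrier := H\<rparr>))"
    have X: "subgroup ?X (K\<lparr>carrier := H\<rparr>)" "f ` ?X = ders d (f ` H)" using embeds_derived[OF e, of d] by simp_all
    show "?X = {\<one>\<^bsub>K\<lparr>carrier := H\<rparr>\<^esub>} \<longleftrightarrow> ders d (f ` H) \<subseteq> {0}"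
      unfolding z embeds_image_trivial[OF e subgroup.subset[OF X(1)], symmetric] X(2) ..
  qed
qed

lemma finmod_zero: "finmod X {0} \<longleftrightarrow> finite X"
  using finmod_hom[of UNIV id "{0}" X] by (simp add: hom_on_def subgrp_UNIV subgrp_zero)

lemma locally_finite_iff_lfinmod:
  assumes "embeds K f"
  shows "locally_finite K \<longleftrightarrow> lfinmod (f ` carrier K) {0}"
  unfolding lfinmod_def finmod_zero
proof (rule embeds_has_locally[OF assms])
  fix H assume "subgroup H K"
  then have "inj_on f H" using embedsD(2)[OF assms] subgroup.subset inj_on_subset by metis
  then show "finite (carrier (K\<lparr>carrier := H\<rparr>)) \<longleftrightarrow> finite (f ` H)" by (simp add: finite_image_iff)
qed

lemma lsolmod_image:
  assumes "hom_on D h" "B \<subseteq> D" "subgrp B" "lsolmod B A"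
  shows "lsolmod (h ` B) (h ` A)"
  unfolding lsolmod_def
proof (intro allI impI)
  fix S assume "finite S \<and> S \<subseteq> h ` B"
  then obtain S' where S: "S' \<subseteq> B" "finite S'" "S = h ` S'" by (meson finite_subset_image)
  then obtain d where d: "ders d (gen S') \<subseteq> A" using lsolmodD[OF assms(4)] by blast
  have "S' \<subseteq> D" "gen S' \<subseteq> D" using S(1) assms(2) gen_least[OF S(1) assms(3)] by auto
  then have "ders d (gen S) = h ` ders d (gen S')"
    using image_ders[OF assms(1) subgrp_gen] image_gen[OF assms(1)] S(3) by simp
  then show "\<exists>d. ders d (gen S) \<subseteq> h ` A" using image_mono[OF d, of h] by metis
qed

lemma lfinmod_image:
  assumes "hom_on D h" "B \<subseteq> D" "subgrp B" "A \<subseteq> D" "subgrp A" "lfinmod B A"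
  shows "lfinmod (h ` B) (h ` A)"
  unfolding lfinmod_def
proof (intro allI impI)
  fix S assume "finite S \<and> S \<subseteq> h ` B"
  then obtain S' where S: "S' \<subseteq> B" "finite S'" "S = h ` S'" by (meson finite_subset_image)
  then have d: "finmod (gen S') A" by (intro lfinmodD[OF assms(6)])
  have D: "S' \<subseteq> D" "gen S' \<subseteq> D" using S(1) assms(2) gen_least[OF S(1) assms(3)] by auto
  show "finmod (gen S) (h ` A)"
    using finmod_image[OF assms(1,5,4) D(2) d] image_gen[OF assms(1) D(1)] S(3) by simp
qed

lemma lsolmod_kernelI:
  assumes "hom_on D h" "\<And>x. x \<in> D \<Longrightarrow> h x = 0 \<longleftrightarrow> x \<in> A"
    and "lsolmod (h ` D) {0}"
  shows "lsolmod D A"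
  unfolding lsolmod_def
proof (intro allI impI)
  fix S assume S: "finite S \<and> S \<subseteq> D"
  then have "\<exists>d. ders d (gen (h ` S)) \<subseteq> {0}" by (intro lsolmodD[OF assms(3)] finite_imageI image_mono) simp_all
  then obtain d where d: "ders d (gen (h ` S)) \<subseteq> {0}" by (elim exE)
  have g: "gen S \<subseteq> D" using S hom_onD(1)[OF assms(1)] by (intro gen_least) auto
  have "h ` ders d (gen S) = ders d (gen (h ` S))"
    using image_ders[OF assms(1) subgrp_gen g] image_gen[OF assms(1)] S by simp
  then have 0: "h ` ders d (gen S) \<subseteq> {0}" using d by simp
  have D: "ders d (gen S) \<subseteq> D" using ders_antimono[OF subgrp_gen, of 0 d S] g by simp
  have "ders d (gen S) \<subseteq> A"
  proof
    fix x assume x: "x \<in> ders d (gen S)"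
    then have "h x = 0" using 0 by blast
    then show "x \<in> A" using assms(2)[of x] x D by blast
  qed
  then show "\<exists>d. ders d (gen S) \<subseteq> A" ..
qed

lemma lfinmod_kernel_iff:
  assumes "hom_on D h" "\<And>x. x \<in> D \<Longrightarrow> h x = 0 \<longleftrightarrow> x \<in> A" "subgrp A"
  shows "lfinmod D A \<longleftrightarrow> lfinmod (h ` D) {0}"
proof -
  have *: "finmod (gen S) A \<longleftrightarrow> finite (gen (h ` S))" if "S \<subseteq> D" for S
    using finmod_hom[OF assms gen_least[OF that hom_onD(1)[OF assms(1)]]] image_gen[OF assms(1) that] by simp
  show ?thesis unfolding lfinmod_def finmod_zero
  proof (intro iffI allI impI)
    fix S assume l: "\<forall>S. finite S \<and> S \<subseteq> D \<longrightarrow> finmod (gen S) A" and "finite S \<and> S \<subseteq> h ` D"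
    then obtain S' where S': "S' \<subseteq> D" "finite S'" "S = h ` S'" by (meson finite_subset_image)
    then show "finite (gen S)" using l *[OF S'(1)] by simp
  next
    fix S assume l: "\<forall>S. finite S \<and> S \<subseteq> h ` D \<longrightarrow> finite (gen S)" and S: "finite S \<and> S \<subseteq> D"
    then have "finite (gen (h ` S))" using image_mono[of S D h] by simp
    then show "finmod (gen S) A" using *[of S] S by simp
  qed
qed

lemma nsubgrp_embeds_image:
  assumes "embeds K f" "N \<lhd> K"
  shows "nsubgrp (f ` N) (f ` carrier K)"
proof (rule nsubgrpI')
  note f = embedsD[OF assms(1)]
  interpret group K by (rule f(1))
  have N: "subgroup N K" using assms(2) by (rule normal_imp_subgroup)
  show "subgrp (f ` N)" "subgrp (f ` carrier K)"
    using subgrp_embeds_image[OF assms(1)] N subgroup_self by auto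
  show "f ` N \<subseteq> f ` carrier K" using subgroup.subset[OF N] by blast
  fix h x assume "h \<in> f ` carrier K" "x \<in> f ` N"
  then obtain g y where gy: "h = f g" "g \<in> carrier K" "x = f y" "y \<in> N" by blast
  have y: "y \<in> carrier K" using gy(4) subgroup.subset[OF N] by blast
  have "inv\<^bsub>K\<^esub> g \<otimes>\<^bsub>K\<^esub> y \<otimes>\<^bsub>K\<^esub> inv\<^bsub>K\<^esub> (inv\<^bsub>K\<^esub> g) \<in> N"
    using normal_invE(2)[OF assms(2) _ gy(4), of "inv\<^bsub>K\<^esub> g"] gy(2) by simp
  moreover have "f (inv\<^bsub>K\<^esub> g \<otimes>\<^bsub>K\<^esub> y \<otimes>\<^bsub>K\<^esub> inv\<^bsub>K\<^esub> (inv\<^bsub>K\<^esub> g)) = conjg h x"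
    using gy y by (simp add: f conjg_def)
  ultimately show "conjg h x \<in> f ` N" by (metis imageI)
qed

lemma locally_soluble_quotient_iff:
  assumes "embeds K f" "N \<lhd> K"
  shows "locally_soluble (K Mod N) \<longleftrightarrow> lsolmod (f ` carrier K) (f ` N)"
proof -
  obtain h :: "'c \<Rightarrow> 'a set bijn" and \<psi> where h: "embeds (K Mod N) \<psi>" "hom_on (f ` carrier K) h"
    "\<And>x. x \<in> f ` carrier K \<Longrightarrow> h x = 0 \<longleftrightarrow> x \<in> f ` N" "h ` f ` carrier K = \<psi> ` carrier (K Mod N)"
    using quotient_embeds[OF assms] by metis
  note N = nsubgrpD[OF nsubgrp_embeds_image[OF assms]]
  have "h ` f ` N = {0}"
    using hom_image_trivial[OF h(2,3) N(2) subgrpD(1)[OF N(1)]] by blast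
  then have "lsolmod (h ` f ` carrier K) {0}" if "lsolmod (f ` carrier K) (f ` N)"
    using lsolmod_image[OF h(2) subset_refl subgrp_carrier_image[OF assms(1)] that] by simp
  then show ?thesis
    using lsolmod_kernelI[OF h(2,3)] locally_soluble_iff_lsolmod[OF h(1)] unfolding h(4) by blast
qed

lemma locally_finite_quotient_iff:
  assumes "embeds K f" "N \<lhd> K"
  shows "locally_finite (K Mod N) \<longleftrightarrow> lfinmod (f ` carrier K) (f ` N)"
proof -
  obtain h :: "'c \<Rightarrow> 'a set bijn" and \<psi> where h: "embeds (K Mod N) \<psi>" "hom_on (f ` carrier K) h"
    "\<And>x. x \<in> f ` carrier K \<Longrightarrow> h x = 0 \<longleftrightarrow> x \<in> f ` N" "h ` f ` carrier K = \<psi> ` carrier (K Mod N)"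
    using quotient_embeds[OF assms(1,2)] by metis
  note N = nsubgrpD[OF nsubgrp_embeds_image[OF assms(1,2)]]
  show ?thesis
    using lfinmod_kernel_iff[OF h(2,3) N(1)] locally_finite_iff_lfinmod[OF h(1)] unfolding h(4) by blast
qed

section \<open>Word values\<close>

primrec cev :: "('x \<Rightarrow> 'g::group_add) \<Rightarrow> 'x gword \<Rightarrow> 'g" where
  "cev \<sigma> (Var x) = \<sigma> x"
| "cev \<sigma> One = 0"
| "cev \<sigma> (Inv a) = - cev \<sigma> a"
| "cev \<sigma> (Mul a b) = cev \<sigma> a + cev \<sigma> b"

definition wvals :: "'g::group_add set \<Rightarrow> 'x gword \<Rightarrow> 'g set" where
  "wvals H w = {cev \<sigma> w | \<sigma>. range \<sigma> \<subseteq> H}"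

lemma wvalsI: "range \<sigma> \<subseteq> H \<Longrightarrow> cev \<sigma> w \<in> wvals H w"
  by (auto simp: wvals_def)

lemma wvalsE:
  assumes "t \<in> wvals H w" obtains \<sigma> where "t = cev \<sigma> w" "range \<sigma> \<subseteq> H"
  using assms by (auto simp: wvals_def)

lemma cev_commutator: "cev \<sigma> (word_commutator a b) = comm (cev \<sigma> a) (cev \<sigma> b)"
  by (simp add: word_commutator_def comm_def)

lemma cev_cong: "(\<And>x. x \<in> set_gword w \<Longrightarrow> \<sigma> x = \<tau> x) \<Longrightarrow> cev \<sigma> w = cev \<tau> w"
  by (induction w) auto

lemma cev_map: "cev \<sigma> (map_gword g w) = cev (\<sigma> \<circ> g) w"
  by (induction w) auto

lemma cev_word_pow: "cev \<sigma> (word_pow v k) = nmul k (cev \<sigma> v)"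
  by (induction k) auto

lemma cev_mem: "subgrp H \<Longrightarrow> range \<sigma> \<subseteq> H \<Longrightarrow> cev \<sigma> w \<in> H"
  by (induction w) (auto simp: subgrpD)

lemma conjg_cev: "conjg g (cev \<sigma> w) = cev (conjg g \<circ> \<sigma>) w"
  by (induction w) (auto simp: conjg_uminus conjg_plus)

lemma cev_trivial: "cev (\<lambda>_. 0) w = 0"
  by (induction w) auto

lemma wvals_subset: "subgrp H \<Longrightarrow> wvals H w \<subseteq> H"
  by (auto simp: wvals_def cev_mem)

lemma zero_mem_wvals: "subgrp H \<Longrightarrow> 0 \<in> wvals H w"
  unfolding wvals_def using cev_trivial[of w] subgrpD(1)[of H]
  by (intro CollectI exI[of _ "\<lambda>_. 0"]) auto

lemma conjg_wvals: "subgrp H \<Longrightarrow> g \<in> H \<Longrightarrow> t \<in> wvals H w \<Longrightarrow> conjg g t \<in> wvals H w"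
proof -
  assume a: "subgrp H" "g \<in> H" "t \<in> wvals H w"
  then obtain \<sigma> where "t = cev \<sigma> w" "range \<sigma> \<subseteq> H" by (auto simp: wvals_def)
  then have "conjg g t = cev (conjg g \<circ> \<sigma>) w" "range (conjg g \<circ> \<sigma>) \<subseteq> H"
    using a by (auto simp: conjg_cev subgrp_conjg subset_iff)
  then show ?thesis using wvalsI[of "conjg g \<circ> \<sigma>" H w] by simp
qed

lemma normalizes_wvals: "subgrp H \<Longrightarrow> g \<in> H \<Longrightarrow> normalizes g (wvals H w)"
  by (simp add: normalizes_def conjg_wvals subgrpD)

text \<open>The step for commutators rests on \<open>[\<alpha>, \<beta>]\<^sup>-\<^sup>1 = [\<alpha>\<^sup>-\<^sup>1, \<beta>]\<^sup>\<alpha>\<close>.\<close>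

lemma uminus_wvals:
  assumes "multilinear_commutator s u" "subgrp H" "t \<in> wvals H u"
  shows "- t \<in> wvals H u"
  using assms(1,3)
proof (induction arbitrary: t rule: multilinear_commutator.induct)
  case (variable x)
  then obtain \<sigma> where "t = \<sigma> x" "range \<sigma> \<subseteq> H" by (auto simp: wvals_def)
  then show ?case unfolding wvals_def using assms(2)
    by (intro CollectI exI[of _ "\<lambda>y. - \<sigma> y"]) (auto simp: subgrpD subset_iff)
next
  case (commutator s a t' b)
  then obtain \<sigma> where \<sigma>: "t = comm (cev \<sigma> a) (cev \<sigma> b)" "range \<sigma> \<subseteq> H"
    by (auto simp: wvals_def cev_commutator)
  obtain \<tau> where \<tau>: "- cev \<sigma> a = cev \<tau> a" "range \<tau> \<subseteq> H"
    by (rule wvalsE[OF commutator.IH(1)[OF wvalsI[OF \<sigma>(2)]]])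
  define \<rho> where "\<rho> x = (if x \<in> set_gword a then \<tau> x else \<sigma> x)" for x
  have "cev \<rho> a = cev \<tau> a" by (rule cev_cong) (simp add: \<rho>_def)
  moreover have "cev \<rho> b = cev \<sigma> b"
    by (rule cev_cong) (use commutator.hyps(3) in \<open>auto simp: \<rho>_def\<close>)
  moreover have "range \<rho> \<subseteq> H" using \<sigma>(2) \<tau>(2) by (auto simp: \<rho>_def)
  then have "cev \<rho> (word_commutator a b) \<in> wvals H (word_commutator a b)" by (rule wvalsI)
  ultimately have "comm (- cev \<sigma> a) (cev \<sigma> b) \<in> wvals H (word_commutator a b)"
    by (simp add: cev_commutator \<tau>(1))
  then have "conjg (cev \<sigma> a) (comm (- cev \<sigma> a) (cev \<sigma> b)) \<in> wvals H (word_commutator a b)"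
    using cev_mem[OF assms(2) \<sigma>(2)] by (intro conjg_wvals assms(2))
  moreover have "conjg (cev \<sigma> a) (comm (- cev \<sigma> a) (cev \<sigma> b)) = - t"
    by (simp add: \<sigma>(1) comm_uminus_left conjg_uminus)
  ultimately show ?case by simp
qed

lemma cev_product_mem: "subgrp H \<Longrightarrow> range \<sigma> \<subseteq> H \<Longrightarrow> cev \<sigma> (product_of_words k u) \<in> gen (wvals H u)"
proof (induction k)
  case (Suc k)
  have "cev (\<sigma> \<circ> Pair k) u \<in> wvals H u" using Suc.prems(2) by (intro wvalsI) auto
  then show ?case using Suc by (simp add: cev_map gen_plus gen_incl)
qed (simp add: gen.zero)

lemma wvals_pow_subset:
  assumes "subgrp H" shows "wvals H (word_pow (product_of_words k u) m) \<subseteq> gen (wvals H u)"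
proof
  fix t assume "t \<in> wvals H (word_pow (product_of_words k u) m)"
  then obtain \<sigma> where "t = nmul m (cev \<sigma> (product_of_words k u))" "range \<sigma> \<subseteq> H"
    by (auto simp: cev_word_pow elim: wvalsE)
  then show "t \<in> gen (wvals H u)" using nmul_mem[OF subgrp_gen cev_product_mem[OF assms]] by blast
qed

lemma four_fold_product:
  assumes H: "subgrp H" and t: "a \<in> wvals H u" "b \<in> wvals H u" "c \<in> wvals H u" "d \<in> wvals H u"
    and "k \<ge> 4"
  shows "nmul m (a + b + c + d) \<in> wvals H (word_pow (product_of_words k u) m)"
proof -
  from t obtain \<alpha> \<beta> \<gamma> \<delta> where s: "a = cev \<alpha> u" "range \<alpha> \<subseteq> H" "b = cev \<beta> u" "range \<beta> \<subseteq> H"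
    "c = cev \<gamma> u" "range \<gamma> \<subseteq> H" "d = cev \<delta> u" "range \<delta> \<subseteq> H" by (auto simp: wvals_def)
  \<comment> \<open>Variable \<open>(i, x)\<close> belongs to factor \<open>i\<close>. The first
    four factors receive the given values, and all others are evaluated at \<open>0\<close> and
    vanish.\<close>
  define \<rho> where "\<rho> i = (if i = 0 then \<alpha> else if i = 1 then \<beta> else if i = 2 then \<gamma>
    else if i = 3 then \<delta> else (\<lambda>_. 0))" for i :: nat
  define \<sigma> where "\<sigma> = (\<lambda>(i, x). \<rho> i x)"
  have comp: "\<sigma> \<circ> Pair i = \<rho> i" for i by (auto simp: \<sigma>_def)
  have "range (\<rho> i) \<subseteq> H" for i using s subgrpD(1)[OF H] by (auto simp: \<rho>_def)
  then have r: "range \<sigma> \<subseteq> H" by (auto simp: \<sigma>_def)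
  have "cev \<sigma> (product_of_words k u) = a + b + c + d"
    using \<open>k \<ge> 4\<close>
  proof (induction k rule: dec_induct)
    case base
    show ?case by (simp add: eval_nat_numeral cev_map comp) (simp add: \<rho>_def s add.assoc eval_nat_numeral)
  next
    case (step k)
    then have "cev (\<sigma> \<circ> Pair k) u = 0" by (simp add: comp \<rho>_def cev_trivial)
    then show ?case using step by (simp add: cev_map)
  qed
  then show ?thesis using wvalsI[OF r, of "word_pow (product_of_words k u) m"] by (simp add: cev_word_pow)
qed

lemma embeds_word_eval:
  assumes "embeds G f" "range \<rho> \<subseteq> carrier G"
  shows "word_eval G \<rho> w \<in> carrier G \<and> f (word_eval G \<rho> w) = cev (f \<circ> \<rho>) w"
proof -
  note f = embedsD[OF assms(1)]
  interpret group G by (rule f(1))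
  show ?thesis by (induction w) (use assms(2) in \<open>auto simp: f\<close>)
qed

lemma word_values_carrier: "embeds G f \<Longrightarrow> word_values G w \<subseteq> carrier G"
  using embeds_word_eval by (auto simp: word_values_def)

lemma embeds_word_values:
  assumes "embeds G f" shows "f ` word_values G w = wvals (f ` carrier G) w"
proof
  show "f ` word_values G w \<subseteq> wvals (f ` carrier G) w"
  proof
    fix z assume "z \<in> f ` word_values G w"
    then obtain \<rho> where \<rho>: "z = f (word_eval G \<rho> w)" "range \<rho> \<subseteq> carrier G" by (auto simp: word_values_def)
    then have "z = cev (f \<circ> \<rho>) w" "range (f \<circ> \<rho>) \<subseteq> f ` carrier G"
      using embeds_word_eval[OF assms \<rho>(2)] by auto
    then show "z \<in> wvals (f ` carrier G) w" using wvalsI[of "f \<circ> \<rho>"] by simp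
  qed
  show "wvals (f ` carrier G) w \<subseteq> f ` word_values G w"
  proof
    fix z assume "z \<in> wvals (f ` carrier G) w"
    then obtain \<sigma> where \<sigma>: "z = cev \<sigma> w" "range \<sigma> \<subseteq> f ` carrier G" by (auto simp: wvals_def)
    define \<rho> where "\<rho> = inv_into (carrier G) f \<circ> \<sigma>"
    have \<sigma>': "\<sigma> x \<in> f ` carrier G" for x using \<sigma>(2) by blast
    have "range \<rho> \<subseteq> carrier G" using inv_into_into[OF \<sigma>'] by (auto simp: \<rho>_def)
    moreover have "f \<circ> \<rho> = \<sigma>" using f_inv_into_f[OF \<sigma>'] by (simp add: \<rho>_def fun_eq_iff)
    ultimately have "z = f (word_eval G \<rho> w)" "word_eval G \<rho> w \<in> word_values G w"
      using embeds_word_eval[OF assms, of \<rho> w] \<sigma>(1) by (auto simp: word_values_def)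
    then show "z \<in> f ` word_values G w" by blast
  qed
qed

lemma embeds_engel:
  assumes "embeds G f" "engel_element G n x"
  shows "engel n (f x) (f ` carrier G)"
proof -
  note f = embedsD[OF assms(1)]
  interpret group G by (rule f(1))
  have x: "x \<in> carrier G" using assms(2) by (simp add: engel_element_def)
  have *: "((\<lambda>h. group_commutator G h x) ^^ k) g \<in> carrier G \<and>
    f (((\<lambda>h. group_commutator G h x) ^^ k) g) = ((\<lambda>h. comm h (f x)) ^^ k) (f g)" if "g \<in> carrier G" for g k
  proof (induction k)
    case (Suc k)
    then show ?case using x by (simp add: f(6)) (simp add: group_commutator_def)
  qed (use that in simp)
  show ?thesis unfolding engel_def
  proof (intro conjI ballI)
    show "f x \<in> f ` carrier G" using x by (rule imageI)
    fix y assume "y \<in> f ` carrier G"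
    then obtain g where g: "y = f g" "g \<in> carrier G" by blast
    then have "((\<lambda>h. group_commutator G h x) ^^ n) g = \<one>\<^bsub>G\<^esub>"
      using assms(2) by (simp add: engel_element_def)
    then show "((\<lambda>h. comm h (f x)) ^^ n) y = 0" using *[OF g(2), of n] f(4) g(1) by simp
  qed
qed

section \<open>Induction along ascending normal series\<close>

lemma finite_subset_limit:
  assumes S: "ascending_normal_series K r C" and "I \<subseteq> Field r" "I \<noteq> {}"
    and "finite X" "X \<subseteq> (\<Union>i \<in> I. C i)"
  shows "\<exists>i \<in> I. X \<subseteq> C i"
  using assms(4,5)
proof (induction rule: finite_induct)
  case empty then show ?case using assms(3) by blast
next
  case (insert x X)
  then obtain i j where ij: "i \<in> I" "X \<subseteq> C i" "j \<in> I" "x \<in> C j" by auto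
  interpret wo_rel r using S by unfold_locales (simp add: ascending_normal_series_def)
  have "(i, j) \<in> r \<or> (j, i) \<in> r" using TOTALS ij assms(2) by blast
  then have "C i \<subseteq> C j \<or> C j \<subseteq> C i" using ascending_normal_series_mono[OF S] by blast
  then show ?case using ij by blast
qed

text \<open>For a property of finite subsets the limit case is automatic, as a finite subset of the
  union lies in one earlier term. The least term is trivial and has only two subsets, which are the
  two base cases.\<close>

lemma series_induct:
  assumes S: "ascending_normal_series K r C"
    and base: "Q {}" "Q {\<one>\<^bsub>K\<^esub>}"
    and step: "\<And>i j X. \<lbrakk>is_successor r i j; \<And>X. finite X \<Longrightarrow> X \<subseteq> C i \<Longrightarrow> Q X; finite X; X \<subseteq> C j\<rbrakk> \<Longrightarrow> Q X"
    and X: "finite X" "X \<subseteq> carrier K"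
  shows "Q X"
proof -
  have W: "Well_order r" using S by (simp add: ascending_normal_series_def)
  interpret wo_rel r using W by unfold_locales
  have all: "\<forall>j. j \<in> Field r \<longrightarrow> (\<forall>X. finite X \<and> X \<subseteq> C j \<longrightarrow> Q X)"
  proof (rule allI, rule well_order_induct[of "\<lambda>j. j \<in> Field r \<longrightarrow> (\<forall>X. finite X \<and> X \<subseteq> C j \<longrightarrow> Q X)"], intro impI allI)
    fix j X assume IH: "\<forall>k. k \<noteq> j \<and> (k, j) \<in> r \<longrightarrow> k \<in> Field r \<longrightarrow> (\<forall>X. finite X \<and> X \<subseteq> C k \<longrightarrow> Q X)"
      and j: "j \<in> Field r" and X: "finite X \<and> X \<subseteq> C j"
    have IH': "Q X" if "k \<in> underS j" "finite X" "X \<subseteq> C k" for k X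
      using IH that Order_Relation.underS_Field[of r j] by (auto simp: underS_def)
    consider "underS j = {}" | i where "is_successor r i j"
      | "underS j \<noteq> {}" "\<nexists>i. is_successor r i j" by blast
    then show "Q X"
    proof cases
      case 1
      then have "C j = {\<one>\<^bsub>K\<^esub>}" using S j by (simp add: ascending_normal_series_def)
      then have "X = {} \<or> X = {\<one>\<^bsub>K\<^esub>}" using X by auto
      then show ?thesis using base by auto
    next
      case (2 i)
      then have i: "i \<in> Field r" "underS j = under i" by (auto simp: is_successor_def)
      have "i \<in> underS j" unfolding i(2) by (rule Refl_under_in[OF REFL i(1)])
      then show ?thesis using step[OF 2] IH' X by blast
    next
      case 3
      then have "C j = (\<Union>i \<in> underS j. C i)"
        using S j unfolding ascending_normal_series_def by blast
      then obtain i where "i \<in> underS j" "X \<subseteq> C i"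
        using finite_subset_limit[OF S Order_Relation.underS_Field 3(1), of X] X by auto
      then show ?thesis using IH' X by blast
    qed
  qed
  have "\<exists>t \<in> Field r. under t = Field r \<and> C t = carrier K"
    using S unfolding ascending_normal_series_def by (elim conjE)
  then obtain t where "t \<in> Field r" "C t = carrier K" by blast
  then show ?thesis using all X by simp
qed

lemma series_terms:
  assumes "embeds K f" "ascending_normal_series K r C" "is_successor r i j"
  shows "nsubgrp (f ` C i) (f ` carrier K)" "nsubgrp (f ` C j) (f ` carrier K)" "f ` C i \<subseteq> f ` C j"
    "locally_soluble (K\<lparr>carrier := C j\<rparr> Mod C i) \<or> locally_finite (K\<lparr>carrier := C j\<rparr> Mod C i) \<Longrightarrow>
      lsolmod (f ` C j) (f ` C i) \<or> lfinmod (f ` C j) (f ` C i)"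
proof -
  interpret group K by (rule embedsD(1)[OF assms(1)])
  have F: "i \<in> Field r" "j \<in> Field r" using assms(3) by (auto simp: is_successor_def)
  have C: "C i \<lhd> K" "C j \<lhd> K" using assms(2) F by (auto simp: ascending_normal_series_def)
  have sub: "C i \<subseteq> C j" using assms(2,3) unfolding ascending_normal_series_def by blast
  show "nsubgrp (f ` C i) (f ` carrier K)" "nsubgrp (f ` C j) (f ` carrier K)"
    by (rule nsubgrp_embeds_image[OF assms(1) C(1)], rule nsubgrp_embeds_image[OF assms(1) C(2)])
  show "f ` C i \<subseteq> f ` C j" using sub by (rule image_mono)
  have Cj: "subgroup (C j) K" using C(2) by (rule normal_imp_subgroup)
  note e = embeds_subgroup[OF assms(1) Cj]
  have n: "C i \<lhd> K\<lparr>carrier := C j\<rparr>" by (rule normal_restrict_supergroup[OF Cj C(1) sub])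
  assume "locally_soluble (K\<lparr>carrier := C j\<rparr> Mod C i) \<or> locally_finite (K\<lparr>carrier := C j\<rparr> Mod C i)"
  then show "lsolmod (f ` C j) (f ` C i) \<or> lfinmod (f ` C j) (f ` C i)"
    using locally_soluble_quotient_iff[OF e n] locally_finite_quotient_iff[OF e n] by auto
qed

lemma lsolmod_Int:
  assumes "subgrp D" "lsolmod B A" shows "lsolmod (B \<inter> D) (A \<inter> D)"
  unfolding lsolmod_def
proof (intro allI impI)
  fix S assume S: "finite S \<and> S \<subseteq> B \<inter> D"
  then obtain d where "ders d (gen S) \<subseteq> A" using lsolmodD[OF assms(2)] by blast
  moreover have "ders d (gen S) \<subseteq> gen S" using ders_antimono[OF subgrp_gen, of 0 d S] by simp
  moreover have "gen S \<subseteq> D" using S assms(1) gen_least by blast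
  ultimately show "\<exists>d. ders d (gen S) \<subseteq> A \<inter> D" by blast
qed

lemma lfinmod_Int:
  assumes "subgrp D" "subgrp A" "lfinmod B A" shows "lfinmod (B \<inter> D) (A \<inter> D)"
  unfolding lfinmod_def
proof (intro allI impI)
  fix S assume S: "finite S \<and> S \<subseteq> B \<inter> D"
  then have "finmod (gen S) A" by (intro lfinmodD[OF assms(3)]) auto
  moreover have "gen S \<subseteq> D" using S assms(1) gen_least by blast
  ultimately show "finmod (gen S) (A \<inter> D)" by (intro finmod_Int assms(1,2))
qed

text \<open>The series belongs to \<open>K\<close>, whereas the argument takes place in
  \<open>gen X\<close>; its terms are intersected with \<open>gen X\<close> at each successor step
  instead of building a new series.\<close>

theorem engel_generated_locally_nilpotent:
  fixes f :: "'a \<Rightarrow> 'g::group_add"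
  assumes K: "embeds K f" and series: "has_locally_soluble_or_finite_series K"
    and X: "X \<subseteq> f ` carrier K" "\<And>g. g \<in> f ` carrier K \<Longrightarrow> normalizes g X"
    and e: "\<And>x. x \<in> X \<Longrightarrow> engel n x (gen X)"
  shows "lnil (gen X)"
proof -
  let ?D = "gen X"
  obtain r :: "'a set rel" and C where S: "ascending_normal_series K r C"
    "\<And>i j. is_successor r i j \<Longrightarrow>
        locally_soluble (K\<lparr>carrier := C j\<rparr> Mod C i) \<or> locally_finite (K\<lparr>carrier := C j\<rparr> Mod C i)"
    using series unfolding has_locally_soluble_or_finite_series_def by blast
  have D: "subgrp ?D" by (rule subgrp_gen)
  have DK: "?D \<subseteq> f ` carrier K" using X(1) subgrp_carrier_image[OF K] by (rule gen_least)
  have Xn: "normalizes g X" if "g \<in> ?D" for g using that DK X(2) by blast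
  \<comment> \<open>The premise makes \<open>Q\<close> vacuous for sets leaving
    \<open>gen X\<close>, so the induction along the series of \<open>K\<close> proves a statement
    about \<open>gen X\<close>.\<close>
  define Q where "Q S \<longleftrightarrow> (f ` S \<subseteq> ?D \<longrightarrow> (\<forall>x \<in> X. \<exists>c. lcs c (gen ((\<lambda>s. conjg s x) ` f ` S)) = {0}))" for S
  have "Q S" if "finite S" "S \<subseteq> carrier K" for S
  proof (rule series_induct[OF S(1) _ _ _ that])
    have single: "\<exists>c. lcs c (gen Y) = {0}" if "Y \<subseteq> {x}" for Y and x :: 'g
      using that finite_subset[OF that] gen_incl'[of "{x}"] by (intro lnilD[OF gen_singleton_lnil]) auto
    show "Q {}" unfolding Q_def using single[of "{}"] by simp
    show "Q {\<one>\<^bsub>K\<^esub>}" unfolding Q_def using single by auto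
    fix i j S assume ij: "is_successor r i j" and IH: "\<And>S. finite S \<Longrightarrow> S \<subseteq> C i \<Longrightarrow> Q S"
      and fin: "finite S" "S \<subseteq> C j"
    note t = series_terms[OF K S(1) ij]
    have DI: "f ` carrier K \<inter> ?D = ?D" using DK by blast
    have n: "nsubgrp (f ` C i \<inter> ?D) ?D" "nsubgrp (f ` C j \<inter> ?D) ?D"
      using nsubgrp_Int[OF t(1) D] nsubgrp_Int[OF t(2) D] unfolding DI .
    have fac: "lsolmod (f ` C j \<inter> ?D) (f ` C i \<inter> ?D) \<or> lfinmod (f ` C j \<inter> ?D) (f ` C i \<inter> ?D)"
      using t(4)[OF S(2)[OF ij]] lsolmod_Int[OF D] lfinmod_Int[OF D nsubgrpD(1)[OF t(1)]] by blast
    show "Q S" unfolding Q_def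
    proof (intro impI ballI)
      fix x assume sub: "f ` S \<subseteq> ?D" and x: "x \<in> X"
      show "\<exists>c. lcs c (gen ((\<lambda>s. conjg s x) ` f ` S)) = {0}"
      proof (rule engel_step[OF n Xn e fac _ x])
        show "finite (f ` S)" using fin(1) by simp
        show "f ` S \<subseteq> f ` C j \<inter> ?D" using sub image_mono[OF fin(2)] by simp
        fix y T assume y: "y \<in> X" and T: "finite T" "T \<subseteq> f ` C i \<inter> ?D"
        obtain T' where T': "T' \<subseteq> C i" "finite T'" "T = f ` T'"
          using T by (metis finite_subset_image Int_subset_iff)
        then have "f ` T' \<subseteq> ?D" using T(2) by simp
        then show "\<exists>c. lcs c (gen ((\<lambda>s. conjg s y) ` T)) = {0}"
          using IH[OF T'(2,1)] y T'(3) unfolding Q_def by simp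
      qed
    qed
  qed
  note Q = this
  have nil: "\<exists>c. lcs c (gen ((\<lambda>s. conjg s x) ` T)) = {0}" if x: "x \<in> X" and T: "finite T" "T \<subseteq> ?D" for x T
  proof -
    have "T \<subseteq> f ` carrier K" using T(2) DK by (rule order_trans)
    then obtain S where "S \<subseteq> carrier K" "finite S" "T = f ` S" using T(1) by (meson finite_subset_image)
    then show ?thesis using Q[of S] T(2) x unfolding Q_def by simp
  qed
  \<comment> \<open>With all of \<open>?D\<close> in place of a term, the conjugates of
    \<open>x\<close> generate a locally nilpotent normal subgroup, which the radical
    contains.\<close>
  have "X \<subseteq> hp ?D"
  proof
    fix x assume x: "x \<in> X"
    let ?M = "gen ((\<lambda>s. conjg s x) ` ?D)"
    have "(\<lambda>s. conjg s x) ` ?D \<subseteq> ?D" using subgrp_conjg[OF D] gen_incl[OF x] by blast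
    then have "nsubgrp ?M ?D"
      using conjugates_locally_nilpotent(2)[OF D nil[OF x]] by (intro nsubgrpI subgrp_gen gen_mono')
    then have "?M \<subseteq> hp ?D" using conjugates_locally_nilpotent(1)[OF D nil[OF x]] by (rule subset_hp)
    moreover have "x \<in> (\<lambda>s. conjg s x) ` ?D" by (rule image_eqI[of _ _ 0]) (simp_all add: gen.zero)
    then have "x \<in> ?M" by (rule gen_incl)
    ultimately show "x \<in> hp ?D" by blast
  qed
  then have "?D \<subseteq> hp ?D" using subgrp_hp[OF D] by (rule gen_least)
  then show ?thesis using lnil_mono[OF lnil_hp[OF D]] by blast
qed

text \<open>\<open>h\<close> will be the quotient map from \<open>u(G)\<close> to
  \<open>u(G)/N\<close>, and \<open>T\<close> the set of images of \<open>u\<close>-values. The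
  induction runs over finite subsets of the carrier of \<open>K\<close>, so the series itself need
  not be carried over to the quotient, only its terms.\<close>

theorem bounded_torsion_locally_finite:
  fixes f :: "'a \<Rightarrow> 'g::group_add" and h :: "'g \<Rightarrow> 'h::group_add"
  assumes K: "embeds K f" and series: "has_locally_soluble_or_finite_series K"
    and h: "hom_on (f ` carrier K) h" and T: "gen T = h ` f ` carrier K" "0 \<in> T"
    "\<And>t. t \<in> T \<Longrightarrow> - t \<in> T" "\<And>g t. g \<in> gen T \<Longrightarrow> t \<in> T \<Longrightarrow> conjg g t \<in> T"
    and tors: "m > 0" "\<And>a b c d. \<lbrakk>a \<in> T; b \<in> T; c \<in> T; d \<in> T\<rbrakk> \<Longrightarrow> nmul m (a + b + c + d) = 0"
  shows "lfinmod (h ` f ` carrier K) {0}"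
proof -
  let ?U = "gen T"
  \<comment> \<open>Products of two: the commutator of any element with an element of
    \<open>T\<close> falls into \<open>T2\<close>, and \<open>T2\<close> meets the torsion condition
    of \<open>torset\<close> because four-fold products do.\<close>
  define T2 where "T2 = {a + b | a b. a \<in> T \<and> b \<in> T}"
  obtain r :: "'a set rel" and C where S: "ascending_normal_series K r C"
    "\<And>i j. is_successor r i j \<Longrightarrow>
        locally_soluble (K\<lparr>carrier := C j\<rparr> Mod C i) \<or> locally_finite (K\<lparr>carrier := C j\<rparr> Mod C i)"
    using series unfolding has_locally_soluble_or_finite_series_def by blast
  have T2I: "a + b \<in> T2" if "a \<in> T" "b \<in> T" for a b using that by (auto simp: T2_def)
  have TT2: "T \<subseteq> T2"
  proof
    fix t assume "t \<in> T"
    then have "t + 0 \<in> T2" using T(2) by (rule T2I)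
    then show "t \<in> T2" by simp
  qed
  have tor: "torset m T2 ?U"
    unfolding torset_def
  proof (intro conjI ballI)
    show "subgrp ?U" by (rule subgrp_gen)
    show "T2 \<subseteq> ?U" by (auto simp: T2_def intro: gen_plus gen_incl)
    show "0 \<in> T2" using T(2) TT2 by blast
    show "- t \<in> T2" if t: "t \<in> T2" for t
    proof -
      obtain a b where "t = a + b" "a \<in> T" "b \<in> T" using t by (auto simp: T2_def)
      then show ?thesis using T2I[OF T(3) T(3)] by (simp add: minus_add)
    qed
    show "conjg g t \<in> T2" if gt: "g \<in> ?U" "t \<in> T2" for g t
    proof -
      obtain a b where "t = a + b" "a \<in> T" "b \<in> T" using gt(2) by (auto simp: T2_def)
      then show ?thesis using T2I[OF T(4)[OF gt(1)] T(4)[OF gt(1)]] by (simp add: conjg_plus)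
    qed
    show "nmul m (a + b) = 0" if "a \<in> T2" "b \<in> T2" for a b
      using that tors(2) by (auto simp: T2_def add.assoc[symmetric])
  qed
  define Q where "Q S \<longleftrightarrow> (h ` f ` S \<subseteq> T2 \<longrightarrow> finite (gen (h ` f ` S)))" for S
  have "Q S" if "finite S" "S \<subseteq> carrier K" for S
  proof (rule series_induct[OF S(1) _ _ _ that])
    have triv: "finite (gen Y)" if "Y \<subseteq> {0}" for Y :: "'h set"
      using gen_least[OF that subgrp_zero] by (rule finite_subset) simp
    show "Q {}" "Q {\<one>\<^bsub>K\<^esub>}" unfolding Q_def
      using triv[of "h ` f ` {}"] triv[of "h ` f ` {\<one>\<^bsub>K\<^esub>}"] embedsD(4)[OF K] hom_onD(3)[OF h] by simp_all
    fix i j S assume ij: "is_successor r i j" and IH: "\<And>S. finite S \<Longrightarrow> S \<subseteq> C i \<Longrightarrow> Q S"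
      and fin: "finite S" "S \<subseteq> C j"
    note t = series_terms[OF K S(1) ij]
    note t1 = nsubgrpD[OF t(1)] and t2 = nsubgrpD[OF t(2)]
    let ?A = "h ` f ` C i" and ?B = "h ` f ` C j"
    have A: "nsubgrp ?A ?U"
      unfolding T(1) by (rule nsubgrp_image[OF h t(1) hom_onD(1)[OF h] subset_refl])
    have B: "?B \<subseteq> ?U" unfolding T(1) using t2(2) by (rule image_mono)
    have fac: "lsolmod ?B ?A \<or> lfinmod ?B ?A"
      using t(4)[OF S(2)[OF ij]] lsolmod_image[OF h t2(2,1)] lfinmod_image[OF h t2(2,1) t1(2,1)] by blast
    note A' = nsubgrpD[OF A]
    let ?E = "gen (T2 \<inter> ?A)"
    have En: "normalizes u ?E" if u: "u \<in> ?U" for u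
    proof -
      have "normalizes u T2" using tor u unfolding torset_def normalizes_def by (auto simp: gen_uminus)
      then show ?thesis using A'(3)[OF u] by (intro normalizes_gen_set normalizes_Int)
    qed
    \<comment> \<open>It is enough to commute with the generators in \<open>T\<close>, and
      \<open>comm a s = - conjg a s + s\<close> lies both in \<open>T2\<close> and in the normal
      subgroup \<open>?A\<close>.\<close>
    have cen: "comm a u \<in> ?E" if a: "a \<in> ?A" and u: "u \<in> ?U" for a u
    proof (rule comm_gen_mem[OF subgrp_gen En _ u])
      fix s assume s: "s \<in> T"
      have "- conjg a s \<in> T" using T(3,4) s a A'(2) by blast
      then have "comm a s \<in> T2" using s unfolding comm_conv_conjg(2) T2_def by blast
      moreover have "comm a s \<in> ?A" using A'(5)[OF gen_incl[OF s] a] .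
      ultimately show "comm a s \<in> ?E" by (simp add: gen_incl)
    qed
    show "Q S" unfolding Q_def
    proof
      assume sub: "h ` f ` S \<subseteq> T2"
      show "finite (gen (h ` f ` S))"
      proof (rule locally_finite_step[OF tor tors(1) A B cen _ fac])
        show "finite (h ` f ` S)" using fin(1) by simp
        show "h ` f ` S \<subseteq> T2 \<inter> ?B" using sub fin(2) by blast
        fix Y assume Y: "finite Y" "Y \<subseteq> T2 \<inter> ?A"
        then obtain Y1 where Y1: "Y1 \<subseteq> f ` C i" "finite Y1" "Y = h ` Y1"
          by (metis finite_subset_image Int_subset_iff)
        then obtain Y2 where Y2: "Y2 \<subseteq> C i" "finite Y2" "Y1 = f ` Y2" by (meson finite_subset_image)
        show "finite (gen Y)" using IH[OF Y2(2,1)] Y(2) Y1(3) Y2(3) unfolding Q_def by simp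
      qed
    qed
  qed
  note Q = this
  have fin: "finite (gen Y)" if Y: "finite Y" "Y \<subseteq> T" for Y
  proof -
    have "Y \<subseteq> h ` f ` carrier K" using Y(2) gen_incl'[of T] T(1) by simp
    then obtain Y1 where Y1: "Y1 \<subseteq> f ` carrier K" "finite Y1" "Y = h ` Y1" using Y(1) by (meson finite_subset_image)
    then obtain Y2 where Y2: "Y2 \<subseteq> carrier K" "finite Y2" "Y1 = f ` Y2" by (meson finite_subset_image)
    show ?thesis using Q[OF Y2(2,1)] order_trans[OF Y(2) TT2] Y1(3) Y2(3) unfolding Q_def by simp
  qed
  show ?thesis unfolding lfinmod_def finmod_zero T(1)[symmetric]
  proof (intro allI impI)
    fix S assume "finite S \<and> S \<subseteq> ?U"
    then obtain S0 where "finite S0" "S0 \<subseteq> T" "S \<subseteq> gen S0" using finite_subset_gen by metis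
    then show "finite (gen S)" using fin[of S0] finite_subset[OF gen_mono'] by blast
  qed
qed

section \<open>The two inclusions\<close>

lemma normal_embedsI:
  assumes "embeds K f" "subgroup N K" "nsubgrp (f ` N) (f ` carrier K)"
  shows "N \<lhd> K"
proof -
  note f = embedsD[OF assms(1)]
  interpret group K by (rule f(1))
  show ?thesis
  proof (rule normal_invI[OF assms(2)])
    fix x h assume x: "x \<in> carrier K" and h: "h \<in> N"
    have hK: "h \<in> carrier K" using h subgroup.subset[OF assms(2)] by blast
    have "conjg (- f x) (f h) \<in> f ` N"
    proof (rule nsubgrpD(4)[OF assms(3)])
      show "- f x \<in> f ` carrier K" using x f(5)[OF x] by (metis imageI inv_closed)
    qed (use h in simp)
    moreover have "conjg (- f x) (f h) = f (x \<otimes>\<^bsub>K\<^esub> h \<otimes>\<^bsub>K\<^esub> inv\<^bsub>K\<^esub> x)"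
      using x hK by (simp add: f conjg_def)
    moreover have "x \<otimes>\<^bsub>K\<^esub> h \<otimes>\<^bsub>K\<^esub> inv\<^bsub>K\<^esub> x \<in> carrier K" using x hK by simp
    ultimately show "x \<otimes>\<^bsub>K\<^esub> h \<otimes>\<^bsub>K\<^esub> inv\<^bsub>K\<^esub> x \<in> N"
      using inj_on_image_mem_iff[OF f(2) _ subgroup.subset[OF assms(2)]] by simp
  qed
qed

text \<open>Under the embedding \<open>f\<close> the \<open>u\<close>-values become \<open>T\<close>
  and the \<open>w\<close>-values \<open>W\<close>. The two preceding theorems are applied to the
  same series of \<open>u(G)\<close>, once with \<open>W\<close> and once with the images of
  \<open>T\<close> modulo \<open>gen W\<close>.\<close>

theorem class_U_locally_nilpotent_by_locally_finite:
  fixes G :: "'a monoid" and u :: "'x gword"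
  assumes G: "group G" and m: "m > 0" and u: "multilinear_commutator s u" and k: "k \<ge> 4"
    and eng: "\<And>x. x \<in> word_values G (word_pow (product_of_words k u) m) \<Longrightarrow> engel_element G n x"
    and series: "has_locally_soluble_or_finite_series (G\<lparr>carrier := verbal_subgroup G u\<rparr>)"
  shows "locally_nilpotent_by_locally_finite (G\<lparr>carrier := verbal_subgroup G u\<rparr>)"
proof -
  interpret group G by (rule G)
  define w where "w = word_pow (product_of_words k u) m"
  obtain f :: "'a \<Rightarrow> 'a bijn" where f: "embeds G f" using cayley_embedding[OF G] by blast
  let ?H = "f ` carrier G"
  define T where "T = wvals ?H u"
  define W where "W = wvals ?H w"
  define U where "U = verbal_subgroup G u"
  define N where "N = verbal_subgroup G w"
  define K where "K = G\<lparr>carrier := U\<rparr>"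
  have H: "subgrp ?H" by (rule subgrp_carrier_image[OF f])
  have U: "subgroup U G" unfolding U_def verbal_subgroup_def
    by (rule generate_is_subgroup[OF word_values_carrier[OF f]])
  have N: "subgroup N G" unfolding N_def verbal_subgroup_def
    by (rule generate_is_subgroup[OF word_values_carrier[OF f]])
  have fU: "f ` U = gen T"
    unfolding U_def verbal_subgroup_def T_def embeds_word_values[OF f, symmetric]
    by (rule embeds_generate[OF f word_values_carrier[OF f]])
  have fN: "f ` N = gen W"
    unfolding N_def verbal_subgroup_def W_def embeds_word_values[OF f, symmetric]
    by (rule embeds_generate[OF f word_values_carrier[OF f]])
  have K: "embeds K f" unfolding K_def by (rule embeds_subgroup[OF f U])
  have cK: "carrier K = U" by (simp add: K_def)
  have WT: "W \<subseteq> gen T" unfolding W_def T_def w_def by (rule wvals_pow_subset[OF H])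
  have TH: "gen T \<subseteq> ?H" unfolding T_def by (rule gen_least[OF wvals_subset[OF H] H])
  have fNU: "f ` N \<subseteq> f ` U" unfolding fN fU using WT by (rule gen_mono')
  have NU: "N \<subseteq> U"
  proof
    fix x assume x: "x \<in> N"
    then have "f x \<in> f ` U" using fNU by blast
    then show "x \<in> U"
      using inj_on_image_mem_iff[OF embedsD(2)[OF f] subsetD[OF subgroup.subset[OF N] x] subgroup.subset[OF U]] by blast
  qed
  have NK: "subgroup N K" unfolding K_def by (rule subgroup_incl[OF N U NU])
  have Wn: "normalizes g W" if "g \<in> gen T" for g
    unfolding W_def using that TH by (intro normalizes_wvals[OF H]) blast
  have nW: "nsubgrp (gen W) (gen T)"
    using WT Wn by (intro nsubgrpI subgrp_gen gen_mono' normalizes_gen_set)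
  have NnK: "N \<lhd> K" by (rule normal_embedsI[OF K NK]) (simp add: cK fN fU nW)
  \<comment> \<open>The hypothesis is the Engel condition in all of \<open>G\<close>; it is
    inherited by the subgroup generated by the \<open>w\<close>-values.\<close>
  have We: "engel n x (gen W)" if x: "x \<in> W" for x
  proof -
    have "x \<in> f ` word_values G w" using x by (simp add: W_def embeds_word_values[OF f])
    then have "engel n x ?H" using embeds_engel[OF f] eng unfolding w_def by blast
    moreover have "gen W \<subseteq> ?H" using nsubgrpD(2)[OF nW] TH by (rule order_trans)
    ultimately show ?thesis using gen_incl[OF x] by (rule engel_subset)
  qed
  have series': "has_locally_soluble_or_finite_series K" using series by (simp add: K_def U_def)
  have "lnil (gen W)"
    by (rule engel_generated_locally_nilpotent[OF K series' _ _ We]) (use WT Wn in \<open>simp_all add: cK fU\<close>)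
  moreover have "embeds (K\<lparr>carrier := N\<rparr>) f" by (rule embeds_subgroup[OF K NK])
  ultimately have ln: "locally_nilpotent (K\<lparr>carrier := N\<rparr>)"
    using locally_nilpotent_iff_lnil[of "K\<lparr>carrier := N\<rparr>" f] by (simp add: fN)
  \<comment> \<open>In this quotient every \<open>w\<close>-value vanishes, and
    \<open>four_fold_product\<close> turns that into the exponent \<open>m\<close> for products of
    four \<open>u\<close>-values.\<close>
  obtain h :: "'a bijn \<Rightarrow> 'a bijn set bijn" where h: "hom_on (gen T) h" "\<And>x. x \<in> gen T \<Longrightarrow> h x = 0 \<longleftrightarrow> x \<in> gen W"
    using quotient_hom[OF subgrp_gen nW] by blast
  have TT: "T \<subseteq> gen T" by (rule gen_incl')
  have hT: "gen (h ` T) = h ` gen T" by (rule image_gen[OF h(1) TT, symmetric])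
  have "lfinmod (h ` f ` carrier K) {0}"
  proof (rule bounded_torsion_locally_finite[OF K series' _ _ _ _ _ m, of h "h ` T"])
    show "hom_on (f ` carrier K) h" "gen (h ` T) = h ` f ` carrier K" using h(1) hT by (simp_all add: cK fU)
    have "0 \<in> T" unfolding T_def by (rule zero_mem_wvals[OF H])
    then show "0 \<in> h ` T" using imageI[of 0 T h] hom_onD(3)[OF h(1)] by simp
    show "- t \<in> h ` T" if t: "t \<in> h ` T" for t
    proof -
      obtain a where a: "t = h a" "a \<in> T" using t by blast
      then have "- a \<in> T" unfolding T_def by (intro uminus_wvals[OF u H])
      moreover have "h (- a) = - t" using hom_onD(4)[OF h(1)] a TT by blast
      ultimately show ?thesis by (metis imageI)
    qed
    show "conjg g t \<in> h ` T" if gt: "g \<in> gen (h ` T)" "t \<in> h ` T" for g t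
    proof -
      obtain a b where ab: "t = h a" "a \<in> T" "g = h b" "b \<in> gen T" using gt unfolding hT by blast
      have "conjg b a \<in> T" using ab(2,4) TH unfolding T_def by (intro conjg_wvals[OF H]) auto
      moreover have "h (conjg b a) = conjg g t" using hom_onD(5)[OF h(1)] ab TT by blast
      ultimately show ?thesis by (metis imageI)
    qed
    fix a b c d assume "a \<in> h ` T" "b \<in> h ` T" "c \<in> h ` T" "d \<in> h ` T"
    then obtain a' b' c' d' where t: "a = h a'" "b = h b'" "c = h c'" "d = h d'"
      "a' \<in> T" "b' \<in> T" "c' \<in> T" "d' \<in> T" by blast
    then have "nmul m (a' + b' + c' + d') \<in> W"
      unfolding T_def W_def w_def using k by (intro four_fold_product[OF H])
    then have "nmul m (a' + b' + c' + d') \<in> gen W" by (rule gen_incl)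
    then have "h (nmul m (a' + b' + c' + d')) = 0" using h(2) nsubgrpD(2)[OF nW] by blast
    moreover have g: "a' \<in> gen T" "b' \<in> gen T" "c' \<in> gen T" "d' \<in> gen T" using t TT by auto
    then have "h (nmul m (a' + b' + c' + d')) = nmul m (a + b + c + d)"
      using hom_on_nmul[OF h(1)] hom_onD(2)[OF h(1)] t(1-4) by (simp add: gen_plus)
    ultimately show "nmul m (a + b + c + d) = 0" by simp
  qed
  then have "lfinmod (gen T) (gen W)"
    using lfinmod_kernel_iff[OF h nsubgrpD(1)[OF nW]] by (simp add: cK fU)
  then have "locally_finite (K Mod N)"
    using locally_finite_quotient_iff[OF K NnK] by (simp add: cK fU fN)
  then have "locally_nilpotent_by_locally_finite K"
    unfolding locally_nilpotent_by_locally_finite_def using NnK ln by blast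
  then show ?thesis by (simp add: K_def U_def)
qed

text \<open>The series is \<open>1\<close>, \<open>N\<close>, \<open>K\<close>. The first factor is
  locally soluble because each derived term lies in the lower central term of the same
  index.\<close>

theorem locally_nilpotent_by_locally_finite_series:
  fixes K :: "('a, 'b) monoid_scheme"
  assumes K: "group K" and LL: "locally_nilpotent_by_locally_finite K"
  shows "has_locally_soluble_or_finite_series K"
proof -
  interpret group K by (rule K)
  obtain N where N: "N \<lhd> K" "locally_nilpotent (K\<lparr>carrier := N\<rparr>)" "locally_finite (K Mod N)"
    using LL unfolding locally_nilpotent_by_locally_finite_def by blast
  obtain f :: "'a \<Rightarrow> 'a bijn" where f: "embeds K f" using cayley_embedding[OF K] by blast
  have Ns: "subgroup N K" by (rule normal_imp_subgroup[OF N(1)])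
  have one: "{\<one>\<^bsub>K\<^esub>} \<subseteq> N" "N \<subseteq> carrier K" using subgroup.one_closed[OF Ns] subgroup.subset[OF Ns] by auto
  \<comment> \<open>Three terms indexed by \<open>0\<close>, \<open>1\<close>, \<open>2\<close>;
    repetitions, as for trivial \<open>N\<close>, are allowed at this stage.\<close>
  define C where "C i = (if i = 0 then {\<one>\<^bsub>K\<^esub>} else if i = 1 then N else carrier K)" for i :: nat
  have uS: "underS (natLeq_on 3) j = {..<j}" and un: "under (natLeq_on 3) j = {..j}" if "j < 3" for j
    using that by (auto simp: underS_def under_def)
  have succ: "is_successor (natLeq_on 3) i j \<longleftrightarrow> j < 3 \<and> j = Suc i" for i j
  proof (cases "i < 3 \<and> j < 3")
    case True
    have "{..<j} = {..i} \<longleftrightarrow> j = Suc i" by (metis lessThan_Suc_atMost lessThan_eq_iff)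
    then show ?thesis using True by (simp add: is_successor_def Field_natLeq_on uS un)
  qed (auto simp: is_successor_def Field_natLeq_on)
  have "ascending_normal_series K (natLeq_on 3) C"
    unfolding ascending_normal_series_def Field_natLeq_on
  proof (intro conjI ballI impI allI)
    show "well_order_on {x. x < 3} (natLeq_on 3)" by (rule natLeq_on_well_order_on)
    show "C i \<lhd> K" for i
      using N(1) one_is_normal normal_invI[OF subgroup_self] by (auto simp: C_def)
    show "C i = {\<one>\<^bsub>K\<^esub>}" if "i \<in> {x. x < 3}" "underS (natLeq_on 3) i = {}" for i
      using that by (auto simp: uS C_def lessThan_empty_iff)
    show "\<exists>t \<in> {x. x < 3}. under (natLeq_on 3) t = {x. x < 3} \<and> C t = carrier K"
      by (intro bexI[of _ 2]) (auto simp: un C_def)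
    show "C i \<subseteq> C j" if "is_successor (natLeq_on 3) i j" for i j
      using that one by (auto simp: succ C_def)
    show "C l = (\<Union>i \<in> underS (natLeq_on 3) l. C i)"
      if l: "l \<in> {x. x < 3}" "underS (natLeq_on 3) l \<noteq> {} \<and> (\<nexists>i. is_successor (natLeq_on 3) i l)" for l
    proof -
      \<comment> \<open>Every index other than \<open>0\<close> is a successor, so there are no
        limits.\<close>
      have "l \<noteq> 0" using l by (auto simp: uS)
      then have "is_successor (natLeq_on 3) (l - 1) l" using l(1) by (simp add: succ)
      then show ?thesis using l(2) by blast
    qed
  qed
  \<comment> \<open>The series is indexed by numbers, whereas the definition quantifies over index
    sets of type \<open>'a set\<close>; reindexing by the terms bridges this.\<close>
  from ascending_normal_series_reindex[OF this] obtain r :: "'a set rel" and D where r: "ascending_normal_series K r D"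
    "\<forall>A B. is_successor r A B \<longrightarrow> (\<exists>i j. is_successor (natLeq_on 3) i j \<and> D A = C i \<and> D B = C j)" by blast
  have fac: "locally_soluble (K\<lparr>carrier := C j\<rparr> Mod C i) \<or> locally_finite (K\<lparr>carrier := C j\<rparr> Mod C i)"
    if "is_successor (natLeq_on 3) i j" for i j
  proof (cases "i = 0")
    case True
    note e = embeds_subgroup[OF f Ns]
    have "lnil (f ` N)" using N(2) locally_nilpotent_iff_lnil[OF e] by simp
    then have "lsolmod (f ` N) {0}"
      unfolding lnil_def lsolmod_def using ders_subset_lcs[OF subgrp_gen] by metis
    moreover have "f ` {\<one>\<^bsub>K\<^esub>} = {0}" using embedsD(4)[OF f] by simp
    moreover have "{\<one>\<^bsub>K\<^esub>} \<lhd> K\<lparr>carrier := N\<rparr>"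
      by (rule normal_restrict_supergroup[OF Ns one_is_normal one(1)])
    ultimately have "locally_soluble (K\<lparr>carrier := N\<rparr> Mod {\<one>\<^bsub>K\<^esub>})"
      using locally_soluble_quotient_iff[OF e] by simp
    then show ?thesis using True that by (simp add: succ C_def)
  next
    case False
    then have "i = 1" "j = 2" using that by (auto simp: succ)
    then show ?thesis using N(3) by (simp add: C_def)
  qed
  have "locally_soluble (K\<lparr>carrier := D B\<rparr> Mod D A) \<or> locally_finite (K\<lparr>carrier := D B\<rparr> Mod D A)"
    if AB: "is_successor r A B" for A B
  proof -
    obtain i j where ij: "is_successor (natLeq_on 3) i j" and D: "D A = C i" "D B = C j"
      using r(2) AB by blast
    show ?thesis unfolding D by (rule fac[OF ij])
  qed
  then show ?thesis using r(1) unfolding has_locally_soluble_or_finite_series_def by blast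
qed

theorem mainTheorem6:
  fixes m n s :: nat and u :: "nat gword" and v w :: "(nat \<times> nat) gword"
  assumes "m > 0" and "n > 0"
    and "multilinear_commutator s u"
    and "v = product_of_words 896 u"
    and "w = word_pow v m"
  shows "(class_U m n u :: 'a monoid set) =
    {G. group G \<and> (\<forall>x \<in> word_values G w. engel_element G n x) \<and>
      locally_nilpotent_by_locally_finite (G\<lparr>carrier := verbal_subgroup G u\<rparr>)}"
proof -
  \<comment> \<open>The two classes share the Engel condition, so only the conditions on
    \<open>u(G)\<close> are compared, for groups that already satisfy it.\<close>
  have "has_locally_soluble_or_finite_series (G\<lparr>carrier := verbal_subgroup G u\<rparr>) \<longleftrightarrow>
      locally_nilpotent_by_locally_finite (G\<lparr>carrier := verbal_subgroup G u\<rparr>)"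
    if G: "group G" "\<forall>x \<in> word_values G w. engel_element G n x" for G :: "'a monoid"
  proof
    assume "has_locally_soluble_or_finite_series (G\<lparr>carrier := verbal_subgroup G u\<rparr>)"
    then show "locally_nilpotent_by_locally_finite (G\<lparr>carrier := verbal_subgroup G u\<rparr>)"
      using G(2) by (intro class_U_locally_nilpotent_by_locally_finite[where k = 896 and n = n, OF G(1) assms(1,3)]) (simp_all add: assms(4,5))
  next
    assume l: "locally_nilpotent_by_locally_finite (G\<lparr>carrier := verbal_subgroup G u\<rparr>)"
    obtain f :: "'a \<Rightarrow> 'a bijn" where f: "embeds G f" using cayley_embedding[OF G(1)] by blast
    have "subgroup (verbal_subgroup G u) G" unfolding verbal_subgroup_def
      by (rule group.generate_is_subgroup[OF G(1) word_values_carrier[OF f]])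
    then have "group (G\<lparr>carrier := verbal_subgroup G u\<rparr>)" by (rule group.subgroup_imp_group[OF G(1)])
    then show "has_locally_soluble_or_finite_series (G\<lparr>carrier := verbal_subgroup G u\<rparr>)"
      using l by (rule locally_nilpotent_by_locally_finite_series)
  qed
  then show ?thesis unfolding class_U_def assms(4,5) by blast
qed

end
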